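(* The concurrent stack algorithm SEC (Sharded Elimination and Combining), as defined in the context, is a linearizable implementation of a stack: every history of $\mathrm{Push}$, $\mathrm{Pop}$ and $\mathrm{Peek}$ operations produced by an execution of SEC by finitely many asynchronous threads is linearizable with respect to the sequential specification of the stack given in the context.
   Context: **Model.** Finitely many asynchronous threads execute in a sequentially consistent shared memory. Atomic steps are reads, writes, and the primitives fetch&increment (increments an integer cell and returns its old value), T&S (sets a boolean cell to TRUE and returns its old value) and $\mathrm{CAS}(x,\text{old},\text{new})$ (if $x=\text{old}$, sets $x:=\text{new}$ and returns TRUE; otherwise leaves $x$ unchanged and returns FALSE). Every allocation yields a fresh object; memory is never reused. Each thread executes a sequence of operations $\mathrm{Push}(v)$ ($v$ an integer), $\mathrm{Pop}()$, $\mathrm{Peek}()$, one at a time. **Sequential stack.** The state is a finite sequence of integers, initially empty. $\mathrm{Push}(v)$ places $v$ on top and returns TRUE. $\mathrm{Pop}()$ removes and returns the top value, or returns EMPTY (a value distinct from all integers) if the sequence is empty. $\mathrm{Peek}()$ returns the top value without changing the state, or EMPTY if the sequence is empty. **Linearizability.** A history (sequence of invocation and response events) is linearizable if it can be completed, by adding responses to some pending operations and discarding the other pending ones, so that the resulting operations admit a total order that extends real-time precedence (if one operation responds before another is invoked it comes first) and that is a legal sequential stack history with the same responses. **Data structures of SEC.** A Node has fields $value$ (integer) and $next$ (pointer to Node or null). A shared pointer $stackTop$ is initially null. There are $K\ge 1$ aggregators; every thread is assigned to one fixed aggregator, and at most $P$ threads are assigned to each aggregator. An aggregator $A$ has one field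 $A.batch$, a pointer to a Batch, initially pointing to a fresh batch. A Batch has integer fields $pushCount$, $popCount$, $pushCountAtFreeze$, $popCountAtFreeze$ (initially $0$), an array $eliminationArray[0..P-1]$ of Node pointers (initially null), a Node pointer $subStackTop$ (initially null) and booleans $isFreezerDecided$, $isBatchApplied$ (initially FALSE). **FreezeBatch($A,B$).** $B.popCountAtFreeze := B.popCount$; then $B.pushCountAtFreeze := B.pushCount$; then set $A.batch$ to a freshly allocated batch in its initial state. **Push($v$)** by a thread assigned to aggregator $A$. Allocate a node $n$ with value $v$ and $next=$ null. Repeat: (1) $B := A.batch$. (2) $s :=$ fetch&increment$(B.pushCount)$. (3) $B.eliminationArray[s] := n$. (4) If $s=0$ and T&S$(B.isFreezerDecided)$ returns FALSE, execute FreezeBatch($A,B$); else spin while $A.batch = B$. (5) If $s \ge B.pushCountAtFreeze$, go back to (1). (6) If $s < B.popCountAtFreeze$, return TRUE (the operation is eliminated). (7) If $s = B.popCountAtFreeze$ (the thread is the combiner of $B$), execute PushToStack($B,s$), set $B.isBatchApplied :=$ TRUE, and return TRUE. Otherwise spin until $B.isBatchApplied$ is TRUE and return TRUE. **PushToStack($B,s$).** $bot := top := B.eliminationArray[s]$. For $i=s+1,\dots,B.pushCountAtFreeze-1$ in order: spin until $B.eliminationArray[i]\ne$ null; let $t$ be that node; $t.next := top$; $top := t$. Then repeat: $x := stackTop$; $bot.next := x$; if $\mathrm{CAS}(stackTop,x,top)$ succeeds, return. **Pop()** by a thread assigned to aggregator $A$. Repeat: (1) $B := A.batch$. (2) $s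 :=$ fetch&increment$(B.popCount)$. (3) If $s=0$ and T&S$(B.isFreezerDecided)$ returns FALSE, execute FreezeBatch($A,B$); else spin while $A.batch=B$. (4) If $s \ge B.popCountAtFreeze$, go back to (1). (5) If $s < B.pushCountAtFreeze$ (the operation is eliminated), spin until $B.eliminationArray[s]\neq$ null and return $B.eliminationArray[s].value$. (6) If $s = B.pushCountAtFreeze$ (the thread is the combiner of $B$), execute PopFromStack($B,s$) and set $B.isBatchApplied :=$ TRUE; otherwise spin until $B.isBatchApplied$ is TRUE. (7) Return GetValue($B$, $s - B.pushCountAtFreeze$). **PopFromStack($B,s$).** Let $m := B.popCountAtFreeze - s$. Repeat: $top := stackTop$; $bot := top$; $m$ times, if $bot\ne$ null then $bot := bot.next$; if $\mathrm{CAS}(stackTop,top,bot)$ succeeds, leave the loop. Then $B.subStackTop := top$. **GetValue($B,j$).** $t := B.subStackTop$; $j$ times: if $t=$ null return EMPTY, else $t := t.next$. Then return EMPTY if $t=$ null, and $t.value$ otherwise. **Peek().** Read $stackTop$ once; return EMPTY if it is null, otherwise the value of the node it points to. *)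

theory Defs
  imports Main
begin

section \<open>Histories and linearizability\<close>

datatype ('t, 'op, 'res) event = Inv 't 'op | Res 't 'res

fun event_thread :: "('t, 'op, 'res) event \<Rightarrow> 't" where
  "event_thread (Inv t _) = t"
| "event_thread (Res t _) = t"

fun is_Inv :: "('t, 'op, 'res) event \<Rightarrow> bool" where
  "is_Inv (Inv _ _) = True"
| "is_Inv (Res _ _) = False"

type_synonym ('t, 'op, 'res) history = "('t, 'op, 'res) event list"

fun alternating :: "('t, 'op, 'res) history \<Rightarrow> bool" where
  "alternating [] = True"
| "alternating [e] = is_Inv e"
| "alternating (e # e' # es) = (is_Inv e \<and> \<not> is_Inv e' \<and> alternating es)"

definition wf_history :: "('t, 'op, 'res) history \<Rightarrow> bool" where
  "wf_history h \<longleftrightarrow> (\<forall>t. alternating (filter (\<lambda>e. event_thread e = t) h))"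

text \<open>An operation of a history is identified with the position of its invocation event.\<close>

definition op_positions :: "('t, 'op, 'res) history \<Rightarrow> nat set" where
  "op_positions h = {i. i < length h \<and> is_Inv (h ! i)}"

text \<open>Position \<open>j\<close> holds the response to the invocation at position \<open>i\<close>.\<close>

definition responds :: "('t, 'op, 'res) history \<Rightarrow> nat \<Rightarrow> nat \<Rightarrow> bool" where
  "responds h i j \<longleftrightarrow> i < j \<and> j < length h \<and> is_Inv (h ! i) \<and> \<not> is_Inv (h ! j) \<and>
     event_thread (h ! j) = event_thread (h ! i) \<and>
     (\<forall>k. i < k \<and> k < j \<longrightarrow> event_thread (h ! k) \<noteq> event_thread (h ! i))"

definition pending :: "('t, 'op, 'res) history \<Rightarrow> nat \<Rightarrow> bool" where
  "pending h i \<longleftrightarrow> i \<in> op_positions h \<and> (\<nexists>j. responds h i j)"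

definition discard_pending :: "('t, 'op, 'res) history \<Rightarrow> ('t, 'op, 'res) history" where
  "discard_pending h = nths h {i. \<not> pending h i}"

definition completion :: "('t, 'op, 'res) history \<Rightarrow> ('t, 'op, 'res) history \<Rightarrow> bool" where
  "completion h c \<longleftrightarrow> (\<exists>rs. (\<forall>e \<in> set rs. \<not> is_Inv e) \<and> wf_history (h @ rs) \<and>
     c = discard_pending (h @ rs))"

definition precedes :: "('t, 'op, 'res) history \<Rightarrow> nat \<Rightarrow> nat \<Rightarrow> bool" where
  "precedes c i j \<longleftrightarrow> j \<in> op_positions c \<and> (\<exists>k. responds c i k \<and> k < j)"

definition op_result :: "('t, 'op, 'res) history \<Rightarrow> nat \<Rightarrow> 'op \<times> 'res \<Rightarrow> bool" where
  "op_result c i x \<longleftrightarrow> (\<exists>t k. responds c i k \<and> c ! i = Inv t (fst x) \<and> c ! k = Res t (snd x))"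

text \<open>The list \<open>\<pi>\<close> enumerates the operations of the complete history \<open>c\<close> in the
  linearization order; \<open>S\<close> is the resulting sequential history.\<close>

definition linearization ::
  "(('op \<times> 'res) list \<Rightarrow> bool) \<Rightarrow> ('t, 'op, 'res) history \<Rightarrow> nat list \<Rightarrow> ('op \<times> 'res) list \<Rightarrow> bool"
where
  "linearization legal c \<pi> S \<longleftrightarrow>
     distinct \<pi> \<and> set \<pi> = op_positions c \<and>
     (\<forall>a < length \<pi>. \<forall>b < length \<pi>. precedes c (\<pi> ! a) (\<pi> ! b) \<longrightarrow> a < b) \<and>
     list_all2 (op_result c) \<pi> S \<and> legal S"

definition linearizable ::
  "(('op \<times> 'res) list \<Rightarrow> bool) \<Rightarrow> ('t, 'op, 'res) history \<Rightarrow> bool"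
where
  "linearizable legal h \<longleftrightarrow> (\<exists>c \<pi> S. completion h c \<and> linearization legal c \<pi> S)"


section \<open>The sequential stack\<close>

datatype stack_op = Push int | Pop | Peek

datatype stack_res = RTrue | REmpty | RVal int

fun stack_apply :: "stack_op \<Rightarrow> int list \<Rightarrow> int list \<times> stack_res" where
  "stack_apply (Push v) xs = (v # xs, RTrue)"
| "stack_apply Pop [] = ([], REmpty)"
| "stack_apply Pop (x # xs) = (xs, RVal x)"
| "stack_apply Peek [] = ([], REmpty)"
| "stack_apply Peek (x # xs) = (x # xs, RVal x)"

fun stack_legal_from :: "int list \<Rightarrow> (stack_op \<times> stack_res) list \<Rightarrow> bool" where
  "stack_legal_from xs [] = True"
| "stack_legal_from xs ((oper, r) # S) =
     (snd (stack_apply oper xs) = r \<and> stack_legal_from (fst (stack_apply oper xs)) S)"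

definition stack_legal :: "(stack_op \<times> stack_res) list \<Rightarrow> bool" where
  "stack_legal = stack_legal_from []"


section \<open>Shared memory of SEC\<close>

text \<open>Nodes and batches live at natural-number addresses; \<open>None\<close> is null. The sets
  \<open>node_alloc\<close> and \<open>batch_alloc\<close> collect all addresses ever allocated, and an allocation may
  pick any address outside them. Counters start at 0 and are only incremented, so they are of
  type \<^typ>\<open>nat\<close>; the two subtractions below are reached only after a test that their result is not
  negative.

  Dereferencing null and indexing \<open>eliminationArray\<close> beyond its length \<open>P\<close> do not block a
  thread: reads yield unspecified values (through \<open>the\<close> and \<open>(!)\<close>), an out-of-range array
  write has no effect. That neither affects correctness is part of what has to be proved.\<close>

type_synonym node_ptr = "nat option"
type_synonym batch_ref = nat

record node =
  "value" :: int
  "next" :: node_ptr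

record batch =
  pushCount :: nat
  popCount :: nat
  pushCountAtFreeze :: nat
  popCountAtFreeze :: nat
  eliminationArray :: "node_ptr list"
  subStackTop :: node_ptr
  isFreezerDecided :: bool
  isBatchApplied :: bool

record shared =
  nodes :: "nat \<Rightarrow> node"
  node_alloc :: "nat set"
  batches :: "batch_ref \<Rightarrow> batch"
  batch_alloc :: "batch_ref set"
  agg_batch :: "nat \<Rightarrow> batch_ref"
  stackTop :: node_ptr

definition fresh_batch :: "nat \<Rightarrow> batch" where
  "fresh_batch P = \<lparr> pushCount = 0, popCount = 0, pushCountAtFreeze = 0, popCountAtFreeze = 0,
     eliminationArray = replicate P None, subStackTop = None,
     isFreezerDecided = False, isBatchApplied = False \<rparr>"

definition initial :: "nat \<Rightarrow> nat \<Rightarrow> shared \<Rightarrow> bool" where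
  "initial K P \<sigma> \<longleftrightarrow> stackTop \<sigma> = None \<and> node_alloc \<sigma> = {} \<and>
     inj_on (agg_batch \<sigma>) {..<K} \<and> batch_alloc \<sigma> = agg_batch \<sigma> ` {..<K} \<and>
     (\<forall>B \<in> batch_alloc \<sigma>. batches \<sigma> B = fresh_batch P)"

definition upd_batch :: "batch_ref \<Rightarrow> (batch \<Rightarrow> batch) \<Rightarrow> shared \<Rightarrow> shared" where
  "upd_batch B f \<sigma> = \<sigma>\<lparr>batches := (batches \<sigma>)(B := f (batches \<sigma> B))\<rparr>"

definition set_next :: "node_ptr \<Rightarrow> node_ptr \<Rightarrow> shared \<Rightarrow> shared" where
  "set_next p q \<sigma> = \<sigma>\<lparr>nodes := (nodes \<sigma>)(the p := (nodes \<sigma> (the p))\<lparr>next := q\<rparr>)\<rparr>"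

abbreviation value_of :: "shared \<Rightarrow> node_ptr \<Rightarrow> int" where
  "value_of \<sigma> p \<equiv> value (nodes \<sigma> (the p))"

abbreviation next_of :: "shared \<Rightarrow> node_ptr \<Rightarrow> node_ptr" where
  "next_of \<sigma> p \<equiv> next (nodes \<sigma> (the p))"


section \<open>The algorithm\<close>

text \<open>A control point carries the local variables that are live there. Conventions for the
  arguments: \<open>n\<close> the node being pushed, \<open>B\<close> the batch, \<open>s\<close> the value returned by
  fetch&increment; \<open>Pusher n\<close> and \<open>Popper\<close> record which operation is executing
  FreezeBatch, so that control can return to it.\<close>

datatype role = Pusher node_ptr | Popper

datatype freeze_pc =
    FrzReadPop role batch_ref nat
  | FrzWritePop role batch_ref nat nat
  | FrzReadPush role batch_ref nat
  | FrzWritePush role batch_ref nat nat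
  | FrzAlloc role batch_ref nat
  | FrzInstall role batch_ref nat batch_ref

datatype push_pc =
    PushAlloc int
  | PushGetBatch node_ptr
  | PushCount node_ptr batch_ref
  | PushAnnounce node_ptr batch_ref nat
  | PushTAS node_ptr batch_ref nat
  | PushSpin node_ptr batch_ref nat
  | PushCheckFrozen node_ptr batch_ref nat
  | PushCheckElim batch_ref nat
  | PushCheckCombiner batch_ref nat
  | PushSetApplied batch_ref
  | PushWaitApplied batch_ref

text \<open>PushToStack: the arguments are \<open>B\<close>, the pointers bot and top (written \<open>bt\<close> and \<open>tp\<close>, since
  \<^const>\<open>bot\<close> and \<^const>\<open>top\<close> are taken), then the loop index \<open>i\<close> and \<open>t\<close>, or \<open>x\<close>.\<close>

datatype push_to_stack_pc =
    PTSInit batch_ref nat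
  | PTSLoop batch_ref node_ptr node_ptr nat
  | PTSWait batch_ref node_ptr node_ptr nat
  | PTSLink batch_ref node_ptr node_ptr nat node_ptr
  | PTSReadTop batch_ref node_ptr node_ptr
  | PTSSetBot batch_ref node_ptr node_ptr node_ptr
  | PTSCas batch_ref node_ptr node_ptr node_ptr

datatype pop_pc =
    PopGetBatch
  | PopCount batch_ref
  | PopTAS batch_ref nat
  | PopSpin batch_ref nat
  | PopCheckFrozen batch_ref nat
  | PopCheckElim batch_ref nat
  | PopWaitElim batch_ref nat
  | PopReadElim batch_ref nat
  | PopReadValue node_ptr
  | PopCheckCombiner batch_ref nat
  | PopSetApplied batch_ref nat
  | PopWaitApplied batch_ref nat
  | PopOffset batch_ref nat

text \<open>PopFromStack: the arguments are \<open>B s m tp bt\<close>, then the number of remaining iterations.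
  GetValue: \<open>GVWalk\<close> takes \<open>t\<close> and the number of remaining iterations.\<close>

datatype pop_from_stack_pc =
    PFSInit batch_ref nat
  | PFSReadTop batch_ref nat nat
  | PFSWalk batch_ref nat nat node_ptr node_ptr nat
  | PFSCas batch_ref nat nat node_ptr node_ptr
  | PFSStore batch_ref nat node_ptr

datatype get_value_pc =
    GVInit batch_ref nat
  | GVWalk node_ptr nat

datatype peek_pc =
    PeekReadTop
  | PeekReadValue node_ptr

datatype pc =
    Idle
  | Returning stack_res
  | InFreeze freeze_pc
  | InPush push_pc
  | InPTS push_to_stack_pc
  | InPop pop_pc
  | InPFS pop_from_stack_pc
  | InGV get_value_pc
  | InPeek peek_pc

fun start :: "stack_op \<Rightarrow> pc" where
  "start (Push v) = InPush (PushAlloc v)"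
| "start Pop = InPop PopGetBatch"
| "start Peek = InPeek PeekReadTop"

fun after_freeze :: "role \<Rightarrow> batch_ref \<Rightarrow> nat \<Rightarrow> pc" where
  "after_freeze (Pusher n) B s = InPush (PushCheckFrozen n B s)"
| "after_freeze Popper B s = InPop (PopCheckFrozen B s)"

text \<open>\<open>sec_step P A \<sigma> p \<sigma>' p'\<close>: a thread assigned to aggregator \<open>A\<close> takes one step from control
  point \<open>p\<close>. Every step performs at most one shared-memory access; local computation and
  branching are merged into it. A failed iteration of a spin loop is a step back to the same
  control point. A newly allocated object is initialised in the allocating step, when no other
  thread can know its address.\<close>

inductive sec_step :: "nat \<Rightarrow> nat \<Rightarrow> shared \<Rightarrow> pc \<Rightarrow> shared \<Rightarrow> pc \<Rightarrow> bool"
  for P :: nat and A :: nat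
where
  frz_read_pop:
    "sec_step P A \<sigma> (InFreeze (FrzReadPop r B s))
       \<sigma> (InFreeze (FrzWritePop r B s (popCount (batches \<sigma> B))))"
| frz_write_pop:
    "sec_step P A \<sigma> (InFreeze (FrzWritePop r B s c))
       (upd_batch B (popCountAtFreeze_update (\<lambda>_. c)) \<sigma>)
       (InFreeze (FrzReadPush r B s))"
| frz_read_push:
    "sec_step P A \<sigma> (InFreeze (FrzReadPush r B s))
       \<sigma> (InFreeze (FrzWritePush r B s (pushCount (batches \<sigma> B))))"
| frz_write_push:
    "sec_step P A \<sigma> (InFreeze (FrzWritePush r B s c))
       (upd_batch B (pushCountAtFreeze_update (\<lambda>_. c)) \<sigma>)
       (InFreeze (FrzAlloc r B s))"
| frz_alloc:
    "B' \<notin> batch_alloc \<sigma> \<Longrightarrow>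
     sec_step P A \<sigma> (InFreeze (FrzAlloc r B s))
       (\<sigma>\<lparr>batch_alloc := insert B' (batch_alloc \<sigma>), batches := (batches \<sigma>)(B' := fresh_batch P)\<rparr>)
       (InFreeze (FrzInstall r B s B'))"
| frz_install:
    "sec_step P A \<sigma> (InFreeze (FrzInstall r B s B'))
       (\<sigma>\<lparr>agg_batch := (agg_batch \<sigma>)(A := B')\<rparr>)
       (after_freeze r B s)"

| push_alloc:
    "a \<notin> node_alloc \<sigma> \<Longrightarrow>
     sec_step P A \<sigma> (InPush (PushAlloc v))
       (\<sigma>\<lparr>node_alloc := insert a (node_alloc \<sigma>),
          nodes := (nodes \<sigma>)(a := \<lparr>value = v, next = None\<rparr>)\<rparr>)
       (InPush (PushGetBatch (Some a)))"
| push_get_batch: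
    "sec_step P A \<sigma> (InPush (PushGetBatch n)) \<sigma> (InPush (PushCount n (agg_batch \<sigma> A)))"
| push_count:
    "sec_step P A \<sigma> (InPush (PushCount n B)) (upd_batch B (pushCount_update Suc) \<sigma>)
       (InPush (PushAnnounce n B (pushCount (batches \<sigma> B))))"
| push_announce:
    "sec_step P A \<sigma> (InPush (PushAnnounce n B s))
       (upd_batch B (eliminationArray_update (\<lambda>E. E[s := n])) \<sigma>)
       (if s = 0 then InPush (PushTAS n B s) else InPush (PushSpin n B s))"
| push_tas:
    "sec_step P A \<sigma> (InPush (PushTAS n B s))
       (upd_batch B (isFreezerDecided_update (\<lambda>_. True)) \<sigma>)
       (if isFreezerDecided (batches \<sigma> B) then InPush (PushSpin n B s)
        else InFreeze (FrzReadPop (Pusher n) B s))"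
| push_spin:
    "sec_step P A \<sigma> (InPush (PushSpin n B s)) \<sigma>
       (if agg_batch \<sigma> A = B then InPush (PushSpin n B s)
        else InPush (PushCheckFrozen n B s))"
| push_check_frozen:
    "sec_step P A \<sigma> (InPush (PushCheckFrozen n B s)) \<sigma>
       (if s \<ge> pushCountAtFreeze (batches \<sigma> B) then InPush (PushGetBatch n)
        else InPush (PushCheckElim B s))"
| push_check_elim:
    "sec_step P A \<sigma> (InPush (PushCheckElim B s)) \<sigma>
       (if s < popCountAtFreeze (batches \<sigma> B) then Returning RTrue
        else InPush (PushCheckCombiner B s))"
| push_check_combiner:
    "sec_step P A \<sigma> (InPush (PushCheckCombiner B s)) \<sigma>
       (if s = popCountAtFreeze (batches \<sigma> B) then InPTS (PTSInit B s)
        else InPush (PushWaitApplied B))"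
| push_set_applied:
    "sec_step P A \<sigma> (InPush (PushSetApplied B))
       (upd_batch B (isBatchApplied_update (\<lambda>_. True)) \<sigma>)
       (Returning RTrue)"
| push_wait_applied:
    "sec_step P A \<sigma> (InPush (PushWaitApplied B)) \<sigma>
       (if isBatchApplied (batches \<sigma> B) then Returning RTrue
        else InPush (PushWaitApplied B))"

| pts_init:
    "e = eliminationArray (batches \<sigma> B) ! s \<Longrightarrow>
     sec_step P A \<sigma> (InPTS (PTSInit B s)) \<sigma> (InPTS (PTSLoop B e e (s + 1)))"
| pts_loop:
    "sec_step P A \<sigma> (InPTS (PTSLoop B bt tp i)) \<sigma>
       (if i < pushCountAtFreeze (batches \<sigma> B) then InPTS (PTSWait B bt tp i)
        else InPTS (PTSReadTop B bt tp))"
| pts_wait: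
    "t = eliminationArray (batches \<sigma> B) ! i \<Longrightarrow>
     sec_step P A \<sigma> (InPTS (PTSWait B bt tp i)) \<sigma>
       (if t \<noteq> None then InPTS (PTSLink B bt tp i t) else InPTS (PTSWait B bt tp i))"
| pts_link:
    "sec_step P A \<sigma> (InPTS (PTSLink B bt tp i t))
       (set_next t tp \<sigma>) (InPTS (PTSLoop B bt t (i + 1)))"
| pts_read_top:
    "sec_step P A \<sigma> (InPTS (PTSReadTop B bt tp)) \<sigma> (InPTS (PTSSetBot B bt tp (stackTop \<sigma>)))"
| pts_set_bot:
    "sec_step P A \<sigma> (InPTS (PTSSetBot B bt tp x))
       (set_next bt x \<sigma>) (InPTS (PTSCas B bt tp x))"
| pts_cas_success:
    "stackTop \<sigma> = x \<Longrightarrow>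
     sec_step P A \<sigma> (InPTS (PTSCas B bt tp x)) (\<sigma>\<lparr>stackTop := tp\<rparr>) (InPush (PushSetApplied B))"
| pts_cas_failure:
    "stackTop \<sigma> \<noteq> x \<Longrightarrow>
     sec_step P A \<sigma> (InPTS (PTSCas B bt tp x)) \<sigma> (InPTS (PTSReadTop B bt tp))"

| pop_get_batch:
    "sec_step P A \<sigma> (InPop PopGetBatch) \<sigma> (InPop (PopCount (agg_batch \<sigma> A)))"
| pop_count:
    "s = popCount (batches \<sigma> B) \<Longrightarrow>
     sec_step P A \<sigma> (InPop (PopCount B)) (upd_batch B (popCount_update Suc) \<sigma>)
       (if s = 0 then InPop (PopTAS B s) else InPop (PopSpin B s))"
| pop_tas:
    "sec_step P A \<sigma> (InPop (PopTAS B s))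
       (upd_batch B (isFreezerDecided_update (\<lambda>_. True)) \<sigma>)
       (if isFreezerDecided (batches \<sigma> B) then InPop (PopSpin B s)
        else InFreeze (FrzReadPop Popper B s))"
| pop_spin:
    "sec_step P A \<sigma> (InPop (PopSpin B s)) \<sigma>
       (if agg_batch \<sigma> A = B then InPop (PopSpin B s) else InPop (PopCheckFrozen B s))"
| pop_check_frozen:
    "sec_step P A \<sigma> (InPop (PopCheckFrozen B s)) \<sigma>
       (if s \<ge> popCountAtFreeze (batches \<sigma> B) then InPop PopGetBatch
        else InPop (PopCheckElim B s))"
| pop_check_elim:
    "sec_step P A \<sigma> (InPop (PopCheckElim B s)) \<sigma>
       (if s < pushCountAtFreeze (batches \<sigma> B) then InPop (PopWaitElim B s)
        else InPop (PopCheckCombiner B s))"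
| pop_wait_elim:
    "sec_step P A \<sigma> (InPop (PopWaitElim B s)) \<sigma>
       (if eliminationArray (batches \<sigma> B) ! s \<noteq> None then InPop (PopReadElim B s)
        else InPop (PopWaitElim B s))"
| pop_read_elim:
    "sec_step P A \<sigma> (InPop (PopReadElim B s))
       \<sigma> (InPop (PopReadValue (eliminationArray (batches \<sigma> B) ! s)))"
| pop_read_value:
    "sec_step P A \<sigma> (InPop (PopReadValue p)) \<sigma> (Returning (RVal (value_of \<sigma> p)))"
| pop_check_combiner:
    "sec_step P A \<sigma> (InPop (PopCheckCombiner B s)) \<sigma>
       (if s = pushCountAtFreeze (batches \<sigma> B) then InPFS (PFSInit B s)
        else InPop (PopWaitApplied B s))"
| pop_set_applied:
    "sec_step P A \<sigma> (InPop (PopSetApplied B s))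
       (upd_batch B (isBatchApplied_update (\<lambda>_. True)) \<sigma>)
       (InPop (PopOffset B s))"
| pop_wait_applied:
    "sec_step P A \<sigma> (InPop (PopWaitApplied B s)) \<sigma>
       (if isBatchApplied (batches \<sigma> B) then InPop (PopOffset B s)
        else InPop (PopWaitApplied B s))"
| pop_offset:
    "sec_step P A \<sigma> (InPop (PopOffset B s))
       \<sigma> (InGV (GVInit B (s - pushCountAtFreeze (batches \<sigma> B))))"

| pfs_init:
    "sec_step P A \<sigma> (InPFS (PFSInit B s))
       \<sigma> (InPFS (PFSReadTop B s (popCountAtFreeze (batches \<sigma> B) - s)))"
| pfs_read_top:
    "sec_step P A \<sigma> (InPFS (PFSReadTop B s m))
       \<sigma> (InPFS (PFSWalk B s m (stackTop \<sigma>) (stackTop \<sigma>) m))"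
| pfs_walk:
    "sec_step P A \<sigma> (InPFS (PFSWalk B s m tp bt (Suc k))) \<sigma>
       (InPFS (PFSWalk B s m tp (if bt \<noteq> None then next_of \<sigma> bt else bt) k))"
| pfs_walk_done:
    "sec_step P A \<sigma> (InPFS (PFSWalk B s m tp bt 0)) \<sigma> (InPFS (PFSCas B s m tp bt))"
| pfs_cas_success:
    "stackTop \<sigma> = tp \<Longrightarrow>
     sec_step P A \<sigma> (InPFS (PFSCas B s m tp bt)) (\<sigma>\<lparr>stackTop := bt\<rparr>) (InPFS (PFSStore B s tp))"
| pfs_cas_failure:
    "stackTop \<sigma> \<noteq> tp \<Longrightarrow>
     sec_step P A \<sigma> (InPFS (PFSCas B s m tp bt)) \<sigma> (InPFS (PFSReadTop B s m))"
| pfs_store: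
    "sec_step P A \<sigma> (InPFS (PFSStore B s tp)) (upd_batch B (subStackTop_update (\<lambda>_. tp)) \<sigma>)
       (InPop (PopSetApplied B s))"

| gv_init:
    "sec_step P A \<sigma> (InGV (GVInit B j)) \<sigma> (InGV (GVWalk (subStackTop (batches \<sigma> B)) j))"
| gv_walk:
    "sec_step P A \<sigma> (InGV (GVWalk t (Suc j))) \<sigma>
       (if t = None then Returning REmpty else InGV (GVWalk (next_of \<sigma> t) j))"
| gv_walk_done:
    "sec_step P A \<sigma> (InGV (GVWalk t 0)) \<sigma>
       (if t = None then Returning REmpty else Returning (RVal (value_of \<sigma> t)))"

| peek_read_top:
    "sec_step P A \<sigma> (InPeek PeekReadTop) \<sigma>
       (if stackTop \<sigma> = None then Returning REmpty
        else InPeek (PeekReadValue (stackTop \<sigma>)))"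
| peek_read_value:
    "sec_step P A \<sigma> (InPeek (PeekReadValue p)) \<sigma> (Returning (RVal (value_of \<sigma> p)))"

text \<open>\<open>sec_execution K P T agg \<sigma> L h\<close>: some finite execution with \<open>K\<close> aggregators and arrays of
  length \<open>P\<close>, in which only threads in \<open>T\<close> take steps and each thread \<open>t\<close> is assigned to
  aggregator \<open>agg t\<close>, ends with shared memory \<open>\<sigma>\<close> and control points \<open>L\<close> and has produced the
  history \<open>h\<close>. Which operations are invoked, and the interleaving, are arbitrary.\<close>

inductive sec_execution ::
  "nat \<Rightarrow> nat \<Rightarrow> 't set \<Rightarrow> ('t \<Rightarrow> nat) \<Rightarrow>
   shared \<Rightarrow> ('t \<Rightarrow> pc) \<Rightarrow> ('t, stack_op, stack_res) history \<Rightarrow> bool"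
  for K P :: nat and T :: "'t set" and agg :: "'t \<Rightarrow> nat"
where
  exec_init:
    "initial K P \<sigma> \<Longrightarrow> sec_execution K P T agg \<sigma> (\<lambda>_. Idle) []"
| exec_invoke:
    "\<lbrakk> sec_execution K P T agg \<sigma> L h; t \<in> T; L t = Idle \<rbrakk> \<Longrightarrow>
     sec_execution K P T agg \<sigma> (L(t := start oper)) (h @ [Inv t oper])"
| exec_step:
    "\<lbrakk> sec_execution K P T agg \<sigma> L h; t \<in> T; sec_step P (agg t) \<sigma> (L t) \<sigma>' p' \<rbrakk> \<Longrightarrow>
     sec_execution K P T agg \<sigma>' (L(t := p')) h"
| exec_return:
    "\<lbrakk> sec_execution K P T agg \<sigma> L h; t \<in> T; L t = Returning r \<rbrakk> \<Longrightarrow>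
     sec_execution K P T agg \<sigma> (L(t := Idle)) (h @ [Res t r])"

definition sec_history ::
  "nat \<Rightarrow> nat \<Rightarrow> 't set \<Rightarrow> ('t \<Rightarrow> nat) \<Rightarrow> ('t, stack_op, stack_res) history \<Rightarrow> bool"
where
  "sec_history K P T agg h \<longleftrightarrow> (\<exists>\<sigma> L. sec_execution K P T agg \<sigma> L h)"

end

(* Every operation gets a linearization point inside its interval.  An eliminated push/pop pair
   takes effect, the push immediately followed by the pop, at the read of pushCount in FreezeBatch:
   this read fixes which threads the batch serves, and none of them can return before A.batch is
   replaced.  The remaining pushes or pops of a batch take effect together at the successful CAS of
   the combiner, while all of them still wait for isBatchApplied, and a Peek takes effect when it
   reads stackTop.  ABA is harmless: the next field of a node never changes once the node has been
   reachable from stackTop, so the pointer found in stackTop determines the whole stack.  Indices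
   into eliminationArray stay below P because a thread joins a batch at most once. *)

theory Submission
  imports Defs
begin

text \<open>Many operations are made to take effect by another thread: the freezer completes the
  eliminated pairs, a combiner the rest of its batch. The status of a waiting thread thus changes
  without a step of its own. \<open>push_slot\<close> and \<open>pop_slot\<close> absorb this by
  describing the status as a function of the batch, through \<open>push_res\<close> and
  \<open>pop_res\<close>, so that one assertion holds before and after the change. Conversely, the
  helping thread must know that all operations it completes are still pending;
  \<open>engaged\<close> provides this by tying their threads to control points inside the batch.
  Interference is handled by the fixed list of conditions \<open>rely\<close>, which each step
  establishes once for all other threads, instead of one check for each pair of control points. What
  protects a node under construction from a second combiner is therefore not its presence in an
  array but its claim, made at the freeze and never revoked.\<close>

section \<open>Linearization points\<close>

text \<open>\<open>Done i oper r\<close>: the operation invoked at position \<open>i\<close> has taken effect with result \<open>r\<close>, but has not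
  responded.\<close>

datatype ('op, 'res) op_status = NoOp | Pending nat 'op | Done nat 'op 'res

text \<open>Separates the reasoning about histories from the algorithm. Nothing ties the rule
  \<open>linearize\<close> to a step of thread \<open>t\<close>, so a step of another thread can
  make the operation of \<open>t\<close> take effect. That it is enabled only between invocation and
  response gives real-time order.\<close>

inductive lin_exec ::
  "('t \<Rightarrow> ('op, 'res) op_status) \<Rightarrow> ('t, 'op, 'res) history \<Rightarrow> (nat \<times> 'op \<times> 'res) list \<Rightarrow> bool"
where
  init: "lin_exec (\<lambda>_. NoOp) [] []"
| invoke: "\<lbrakk>lin_exec st h lin; st t = NoOp\<rbrakk>
    \<Longrightarrow> lin_exec (st(t := Pending (length h) oper)) (h @ [Inv t oper]) lin"
| linearize: "\<lbrakk>lin_exec st h lin; st t = Pending i oper\<rbrakk>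
    \<Longrightarrow> lin_exec (st(t := Done i oper r)) h (lin @ [(i, oper, r)])"
| return: "\<lbrakk>lin_exec st h lin; st t = Done i oper r\<rbrakk>
    \<Longrightarrow> lin_exec (st(t := NoOp)) (h @ [Res t r]) lin"

section \<open>Invariants of histories with linearization points\<close>

lemma alternating_snoc:
  "alternating (xs @ [e]) \<longleftrightarrow> alternating xs \<and> (is_Inv e \<longleftrightarrow> even (length xs))"
  \<comment> \<open>\<open>alternating\<close> consumes events in pairs from the front, whereas
    histories grow at the end; the parity of the length bridges the two.\<close>
  by (induction xs rule: alternating.induct) auto

lemma responds_append:
  "k < length h \<Longrightarrow> responds (h @ h') i k \<longleftrightarrow> responds h i k"
  unfolding responds_def by (auto simp: nth_append)

text \<open>Whether an operation precedes position \<open>j\<close> is decided by the events before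
  \<open>j\<close>.\<close>

lemma precedes_append:
  "j < length h \<Longrightarrow> precedes (h @ h') i j \<longleftrightarrow> precedes h i j"
proof -
  assume j: "j < length h"
  have "responds (h @ h') i k \<longleftrightarrow> responds h i k" if "k < j" for k
    using j that by (intro responds_append) simp
  with j show ?thesis unfolding precedes_def op_positions_def by (auto simp: nth_append)
qed

lemma lin_exec_alternating:
  "lin_exec st h lin \<Longrightarrow>
     alternating (filter (\<lambda>e. event_thread e = t) h) \<and>
     (even (length (filter (\<lambda>e. event_thread e = t) h)) \<longleftrightarrow> st t = NoOp)"
proof (induction rule: lin_exec.induct)
  case (invoke st h lin u oper)
  then show ?case by (cases "u = t") (simp_all add: alternating_snoc)
next
  case (linearize st h lin u i oper r)
  then show ?case by (cases "u = t") simp_all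
next
  case (return st h lin u i oper r)
  then show ?case by (cases "u = t") (simp_all add: alternating_snoc)
qed simp

lemma lin_exec_wf: "lin_exec st h lin \<Longrightarrow> wf_history h"
  unfolding wf_history_def using lin_exec_alternating[of st h lin] by blast

definition open_at :: "('t, 'op, 'res) history \<Rightarrow> 't \<Rightarrow> nat \<Rightarrow> 'op \<Rightarrow> bool" where
  "open_at h t i oper \<longleftrightarrow> i < length h \<and> h ! i = Inv t oper \<and>
     (\<forall>k. i < k \<and> k < length h \<longrightarrow> event_thread (h ! k) \<noteq> t)"

lemma open_at_not_responds: "open_at h t i oper \<Longrightarrow> \<not> responds h i k"
  unfolding open_at_def responds_def by auto

lemma open_at_snoc:
  "open_at h t i oper \<Longrightarrow> event_thread e \<noteq> t \<Longrightarrow> open_at (h @ [e]) t i oper"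
  unfolding open_at_def by (auto simp: nth_append less_Suc_eq)

lemma open_at_responds:
  "open_at h t i oper \<Longrightarrow> responds (h @ [Res t r]) i (length h)"
  unfolding open_at_def responds_def by (auto simp: nth_append)

lemma lin_exec_status':
  assumes "lin_exec st h lin"
  shows "(\<forall>i oper. st t = Pending i oper \<longrightarrow> open_at h t i oper) \<and>
    (\<forall>i oper r. st t = Done i oper r \<longrightarrow> open_at h t i oper)"
  using assms
proof (induction arbitrary: t rule: lin_exec.induct)
  case (invoke st h lin u oper)
  have "open_at (h @ [Inv u oper]) u (length h) oper" by (auto simp: open_at_def)
  then show ?case using invoke.IH[of t] open_at_snoc[of h t _ _ "Inv u oper"]
    by (cases "t = u") auto
next
  case (linearize st h lin u i oper r)
  then show ?case by simp
next
  case (return st h lin u i oper r)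
  then show ?case using open_at_snoc[of h t _ _ "Res u r"] by simp
qed simp

lemma lin_exec_status:
  assumes "lin_exec st h lin"
  shows "st t = Pending i oper \<Longrightarrow> open_at h t i oper"
    and "st t = Done i oper r \<Longrightarrow> open_at h t i oper"
  using lin_exec_status'[OF assms] by blast+

lemma lin_exec_positions:
  assumes "lin_exec st h lin"
  shows "(i, oper, r) \<in> set lin \<Longrightarrow> i < length h \<and> (\<exists>t. h ! i = Inv t oper)"
  using assms
proof (induction rule: lin_exec.induct)
  case (linearize st h lin u j oper' r')
  then show ?case using lin_exec_status(1)[OF linearize.hyps] by (auto simp: open_at_def)
qed (auto simp: nth_append less_Suc_eq)

lemma lin_exec_lin':
  assumes "lin_exec st h lin"
  shows "(\<forall>i oper. st t = Pending i oper \<longrightarrow> i \<notin> fst ` set lin) \<and>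
    (\<forall>i oper r. st t = Done i oper r \<longrightarrow> (i, oper, r) \<in> set lin)"
  using assms
proof (induction arbitrary: t rule: lin_exec.induct)
  case (invoke st h lin u oper)
  have "length h \<notin> fst ` set lin"
    using lin_exec_positions[OF invoke.hyps(1)] by (metis imageE less_irrefl prod.collapse)
  then show ?case using invoke.IH[of t] by simp
next
  case (linearize st h lin u j oper r)
  \<comment> \<open>Two threads cannot share an open position, because the event there names its
    thread.\<close>
  have "i \<noteq> j" if "t \<noteq> u" "st t = Pending i oper'" for i oper'
    using lin_exec_status(1)[OF linearize.hyps(1)] linearize.hyps(2) that
    unfolding open_at_def by (metis event.inject(1))
  then show ?case using linearize.IH[of t] by auto
qed simp_all

lemma lin_exec_lin:
  assumes "lin_exec st h lin"
  shows "st t = Pending i oper \<Longrightarrow> i \<notin> fst ` set lin"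
    and "st t = Done i oper r \<Longrightarrow> (i, oper, r) \<in> set lin"
  using lin_exec_lin'[OF assms] by blast+

text \<open>A response is possible only from \<open>Done\<close>, and \<open>Done\<close> only after
  an entry in \<open>lin\<close>; hence the response of a finished operation agrees with its
  entry.\<close>

lemma lin_exec_cases:
  assumes "lin_exec st h lin" "i < length h" "h ! i = Inv t oper"
  shows "st t = Pending i oper \<or> (\<exists>r. st t = Done i oper r) \<or>
    (\<exists>k r. responds h i k \<and> h ! k = Res t r \<and> (i, oper, r) \<in> set lin)"
  using assms
proof (induction arbitrary: i t oper rule: lin_exec.induct)
  case init then show ?case by simp
next
  case (invoke st h lin u oper')
  show ?case
  proof (cases "i = length h")
    case True then show ?thesis using invoke by auto
  next
    case False
    with invoke.prems have i: "i < length h" "h ! i = Inv t oper" by (auto simp: nth_append)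
    have r: "k < length h" if "responds h i k" for k using that by (simp add: responds_def)
    show ?thesis
    proof (cases "\<exists>k r. responds h i k \<and> h ! k = Res t r \<and> (i, oper, r) \<in> set lin")
      case True
      then obtain k r' where "responds h i k" "h ! k = Res t r'" "(i, oper, r') \<in> set lin"
        by blast
      then have "responds (h @ [Inv u oper']) i k \<and> (h @ [Inv u oper']) ! k = Res t r' \<and>
          (i, oper, r') \<in> set lin"
        using r[of k] by (simp add: responds_append nth_append)
      then show ?thesis by blast
    next
      case False
      then show ?thesis using invoke.IH[OF i] invoke.hyps(2) by (cases "t = u") auto
    qed
  qed
next
  case (linearize st h lin u j oper' r')
  then have "st t = Pending i oper \<or> (\<exists>r. st t = Done i oper r) \<or>
    (\<exists>k r. responds h i k \<and> h ! k = Res t r \<and> (i, oper, r) \<in> set lin)" by blast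
  then show ?case using linearize.hyps(2) by (cases "u = t") auto
next
  case (return st h lin u j oper' r')
  from return.prems have i: "i < length h" "h ! i = Inv t oper"
    by (auto simp: nth_append less_Suc_eq split: if_splits)
  have r: "k < length h" if "responds h i k" for k using that by (simp add: responds_def)
  show ?case
  proof (cases "\<exists>k r. responds h i k \<and> h ! k = Res t r \<and> (i, oper, r) \<in> set lin")
    case True
    then obtain k r' where "responds h i k" "h ! k = Res t r'" "(i, oper, r') \<in> set lin"
      by blast
    then have "responds (h @ [Res u r]) i k \<and> (h @ [Res u r]) ! k = Res t r' \<and>
        (i, oper, r') \<in> set lin" for r
      using r[of k] by (simp add: responds_append nth_append)
    then show ?thesis by blast
  next
    case False
    show ?thesis
    proof (cases "u = t")
      case True
      with False return.IH[OF i] return.hyps(2) have "j = i" "oper' = oper" by auto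
      then have "responds (h @ [Res u r']) i (length h) \<and>
          (h @ [Res u r']) ! length h = Res t r' \<and> (i, oper, r') \<in> set lin"
        using open_at_responds[OF lin_exec_status(2)[OF return.hyps(1,2)]]
          lin_exec_lin(2)[OF return.hyps(1,2)] True by simp
      then show ?thesis by blast
    next
      case False2: False
      then show ?thesis using False return.IH[OF i] by auto
    qed
  qed
qed

lemma lin_exec_distinct:
  "lin_exec st h lin \<Longrightarrow> distinct (map fst lin)"
  by (induction rule: lin_exec.induct) (auto dest: lin_exec_lin(1))

text \<open>An operation is still open when it is appended to \<open>lin\<close>, so at that moment
  it precedes nothing; later events create no precedence between positions already present.\<close>

lemma lin_exec_order:
  assumes "lin_exec st h lin"
  shows "a < b \<Longrightarrow> b < length lin \<Longrightarrow> \<not> precedes h (fst (lin ! b)) (fst (lin ! a))"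
  using assms
proof (induction arbitrary: a b rule: lin_exec.induct)
  case init then show ?case by simp
next
  case (invoke st h lin t oper)
  have "fst (lin ! a) < length h" using invoke.prems nth_mem[of a lin]
      lin_exec_positions[OF invoke.hyps(1), of "fst (lin ! a)" "fst (snd (lin ! a))" "snd (snd (lin ! a))"]
    by simp
  then show ?case using invoke by (auto simp: precedes_append)
next
  case (return st h lin t i oper r)
  have "fst (lin ! a) < length h" using return.prems nth_mem[of a lin]
      lin_exec_positions[OF return.hyps(1), of "fst (lin ! a)" "fst (snd (lin ! a))" "snd (snd (lin ! a))"]
    by simp
  then show ?case using return by (auto simp: precedes_append)
next
  case (linearize st h lin t i oper r)
  show ?case
  proof (cases "b < length lin")
    case True then show ?thesis using linearize by (auto simp: nth_append)
  next
    case False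
    then have "b = length lin" using linearize.prems by simp
    moreover have "\<not> precedes h i x" for x
      using open_at_not_responds[OF lin_exec_status(1)[OF linearize.hyps]]
      unfolding precedes_def by blast
    ultimately show ?thesis by simp
  qed
qed

lemma lin_exec_finite: "lin_exec st h lin \<Longrightarrow> finite {t. st t \<noteq> NoOp}"
proof (induction rule: lin_exec.induct)
  case (invoke st h lin t oper)
  show ?case by (rule finite_subset[OF _ finite.insertI[OF invoke.IH]]) auto
next
  case (linearize st h lin t i oper r)
  show ?case by (rule finite_subset[OF _ finite.insertI[OF linearize.IH]]) auto
next
  case (return st h lin t i oper r)
  show ?case by (rule finite_subset[OF _ finite.insertI[OF return.IH]]) auto
qed simp

text \<open>The required completion is obtained by letting every operation that has taken effect respond.\<close>

lemma lin_exec_complete: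
  assumes "lin_exec st h lin"
  shows "\<exists>st' rs. lin_exec st' (h @ rs) lin \<and> (\<forall>e \<in> set rs. \<not> is_Inv e) \<and>
    (\<forall>t i oper r. st' t \<noteq> Done i oper r)"
  using assms
proof (induction "card {t. \<exists>i oper r. st t = Done i oper r}" arbitrary: st h)
  case (0 st h)
  \<comment> \<open>Needed because \<open>card\<close> is zero for infinite sets too.\<close>
  have "finite {t. \<exists>i oper r. st t = Done i oper r}"
    by (rule finite_subset[OF _ lin_exec_finite[OF 0(2)]]) auto
  then have "{t. \<exists>i oper r. st t = Done i oper r} = {}" using 0(1) by simp
  then show ?case using 0(2) by (intro exI[of _ st] exI[of _ "[]"]) simp
next
  case (Suc n st h)
  have fin: "finite {t. \<exists>i oper r. st t = Done i oper r}"
    by (rule finite_subset[OF _ lin_exec_finite[OF Suc(3)]]) auto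
  have "{t. \<exists>i oper r. st t = Done i oper r} \<noteq> {}" using Suc(2) by (intro notI) simp
  then obtain t i oper r where t: "st t = Done i oper r" by blast
  have eq: "{u. \<exists>i oper r. (st(t := NoOp)) u = Done i oper r} =
      {u. \<exists>i oper r. st u = Done i oper r} - {t}" by auto
  have "n = card {u. \<exists>i oper r. (st(t := NoOp)) u = Done i oper r}"
    unfolding eq using Suc(2) t by (simp add: card_Diff_singleton)
  from Suc(1)[OF this lin_exec.return[OF Suc(3) t]]
  obtain st' rs where "lin_exec st' (h @ (Res t r # rs)) lin" "\<forall>e \<in> set rs. \<not> is_Inv e"
    "\<forall>t i oper r. st' t \<noteq> Done i oper r" by (simp only: append_assoc append.simps) blast
  then show ?case by (intro exI[of _ st'] exI[of _ "Res t r # rs"]) simp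
qed

section \<open>Discarding pending operations\<close>

lemma nths_conv_map_filter:
  "nths xs I = map ((!) xs) (filter (\<lambda>i. i \<in> I) [0..<length xs])"
proof (induction xs rule: rev_induct)
  case (snoc x xs)
  have "map ((!) (xs @ [x])) (filter (\<lambda>i. i \<in> I) [0..<length xs]) =
      map ((!) xs) (filter (\<lambda>i. i \<in> I) [0..<length xs])"
    by (rule map_cong) (auto simp: nth_append)
  with snoc show ?case by (simp add: nths_append)
qed simp

lemma sorted_wrt_less_nth_iff:
  fixes ps :: "nat list"
  assumes "sorted_wrt (<) ps" "a < length ps" "b < length ps"
  shows "ps ! a < ps ! b \<longleftrightarrow> a < b"
  using sorted_wrt_nth_less[OF assms(1), of a b] sorted_wrt_nth_less[OF assms(1), of b a] assms(2,3)
  by (cases a b rule: linorder_cases) simp_all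

text \<open>\<open>linearization\<close> speaks of positions after the pending invocations have been
  removed, \<open>lin\<close> of positions before. The increasing list \<open>ps\<close> translates
  between them. A removed invocation is the last event of its thread, so removal neither creates nor
  destroys a response.\<close>

theorem lin_exec_linearizable:
  assumes ex: "lin_exec st h lin" and legal: "legal (map snd lin)"
  shows "linearizable legal h"
proof -
  obtain st' rs where ex': "lin_exec st' (h @ rs) lin" and rs: "\<forall>e \<in> set rs. \<not> is_Inv e"
    and nd: "\<And>t i oper r. st' t \<noteq> Done i oper r"
    using lin_exec_complete[OF ex] by metis
  define g where "g = h @ rs"
  note ex' = ex'[folded g_def]
  define ps where "ps = filter (\<lambda>i. i \<in> {i. \<not> pending g i}) [0..<length g]"
  define c where "c = discard_pending g"
  \<comment> \<open>Makes the surviving positions an explicit list, so that translating a position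
    amounts to indexing.\<close>
  have c: "c = map ((!) g) ps"
    unfolding c_def discard_pending_def ps_def by (rule nths_conv_map_filter)
  have completion: "completion h c"
    unfolding completion_def c_def using rs lin_exec_wf[OF ex'] by (intro exI[of _ rs])
      (simp add: g_def)
  have sorted: "sorted_wrt (<) ps" unfolding ps_def by (rule sorted_wrt_filter) simp
  note less = sorted_wrt_less_nth_iff[OF sorted]
  have len: "length c = length ps" by (simp add: c)
  have ps_set: "set ps = {i. i < length g \<and> \<not> pending g i}" by (auto simp: ps_def)
  have ps_lt: "ps ! a < length g" if "a < length ps" for a
    using ps_set that nth_mem by blast
  have pend: "pending g i \<longleftrightarrow> i < length g \<and> (\<exists>t oper. st' t = Pending i oper)" for i
  proof
    assume "pending g i"
    then have i: "i < length g" "is_Inv (g ! i)" "\<And>k. \<not> responds g i k"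
      by (auto simp: pending_def op_positions_def)
    obtain t oper where "g ! i = Inv t oper" using i(2) by (cases "g ! i") auto
    then show "i < length g \<and> (\<exists>t oper. st' t = Pending i oper)"
      using lin_exec_cases[OF ex' i(1)] i(1,3) nd by blast
  next
    assume "i < length g \<and> (\<exists>t oper. st' t = Pending i oper)"
    then obtain t oper where "open_at g t i oper" using lin_exec_status(1)[OF ex'] by blast
    then show "pending g i"
      by (auto simp: pending_def op_positions_def open_at_not_responds) (auto simp: open_at_def)
  qed
  have pend_last: "event_thread (g ! k) \<noteq> event_thread (g ! i)"
    if p: "pending g i" "i < k" "k < length g" for i k
  proof -
    obtain t oper where "open_at g t i oper"
      using p(1) pend[of i] lin_exec_status(1)[OF ex'] by blast
    then show ?thesis using p(2,3) by (auto simp: open_at_def)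
  qed
  have resp: "responds c a b \<longleftrightarrow> responds g (ps ! a) (ps ! b)"
    if a: "a < length ps" and b: "b < length ps" for a b
  proof
    assume r: "responds c a b"
    have ab: "a < b" "is_Inv (g ! (ps ! a))" "\<not> is_Inv (g ! (ps ! b))"
      "event_thread (g ! (ps ! b)) = event_thread (g ! (ps ! a))"
      using r a b by (simp_all add: responds_def c)
    have between: "event_thread (g ! (ps ! d)) \<noteq> event_thread (g ! (ps ! a))"
      if "a < d" "d < b" for d
      using r a b that by (simp add: responds_def c)
    have "event_thread (g ! k) \<noteq> event_thread (g ! (ps ! a))"
      if k: "ps ! a < k" "k < ps ! b" for k
    proof (cases "pending g k")
      case True
      then show ?thesis using pend_last[OF True k(2) ps_lt[OF b]] ab(4) by simp
    next
      case False
      then have "k \<in> set ps" using k ps_lt[OF b] by (simp add: ps_set)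
      then obtain d where d: "k = ps ! d" "d < length ps" by (auto simp: in_set_conv_nth)
      then show ?thesis using between[of d] k less[OF a d(2)] less[OF d(2) b] by simp
    qed
    then show "responds g (ps ! a) (ps ! b)"
      using ab less[OF a b] ps_lt[OF b] by (simp add: responds_def)
  next
    assume r: "responds g (ps ! a) (ps ! b)"
    have "event_thread (g ! (ps ! d)) \<noteq> event_thread (g ! (ps ! a))"
      if "a < d" "d < b" for d
    proof -
      have "d < length ps" using that b by simp
      then show ?thesis using r that less[OF a, of d] less[of d b] b by (simp add: responds_def)
    qed
    then show "responds c a b" using r a b less[OF a b] by (simp add: responds_def c)
  qed
  \<comment> \<open>The inverse of \<open>ps\<close>: the new position of a surviving event.\<close>
  define idx where "idx i = (THE a. a < length ps \<and> ps ! a = i)" for i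
  have dps: "distinct ps" by (simp add: ps_def)
  have idx_ps: "idx (ps ! a) = a" if a: "a < length ps" for a
    unfolding idx_def using a nth_eq_iff_index_eq[OF dps _ a] by (intro the_equality) blast+
  have idx: "idx i < length ps \<and> ps ! idx i = i" if i: "i \<in> set ps" for i
  proof -
    obtain a where "a < length ps" "i = ps ! a" using i by (auto simp: in_set_conv_nth)
    then show ?thesis using idx_ps by simp
  qed
  have lin_resp: "\<exists>t k. g ! i = Inv t oper \<and> responds g i k \<and> g ! k = Res t r"
    if mem: "(i, oper, r) \<in> set lin" for i oper r
  proof -
    obtain t where t: "i < length g" "g ! i = Inv t oper"
      using lin_exec_positions[OF ex' mem] by blast
    have "st' t \<noteq> Pending i oper" using lin_exec_lin(1)[OF ex'] mem by force
    then obtain k r' where k: "responds g i k" "g ! k = Res t r'" "(i, oper, r') \<in> set lin"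
      using lin_exec_cases[OF ex' t] nd by auto
    have "r' = r" using k(3) mem lin_exec_distinct[OF ex'] by (auto dest: eq_key_imp_eq_value)
    then show ?thesis using t k by auto
  qed
  have resp_ps: "i \<in> set ps \<and> k \<in> set ps" if r: "responds g i k" for i k
  proof -
    have "\<not> is_Inv (g ! k)" using r by (simp add: responds_def)
    then have "\<not> pending g k" by (auto simp: pending_def op_positions_def)
    moreover have "\<not> pending g i" using r by (auto simp: pending_def)
    ultimately show ?thesis using r by (auto simp: ps_set responds_def)
  qed
  have lin_ps: "fst x \<in> set ps" if "x \<in> set lin" for x
  proof -
    obtain i oper r where "x = (i, oper, r)" by (cases x)
    then show ?thesis using that lin_resp[of i oper r] resp_ps by auto
  qed
  define \<pi> where "\<pi> = map (\<lambda>x. idx (fst x)) lin"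
  have "inj_on idx (set ps)" by (rule inj_on_inverseI[of _ "(!) ps"]) (simp add: idx)
  then have d: "distinct \<pi>"
    using lin_exec_distinct[OF ex'] lin_ps unfolding \<pi>_def
    by (auto simp: distinct_map inj_on_def)
  have s: "set \<pi> = op_positions c"
  proof (intro equalityI subsetI)
    fix a assume "a \<in> set \<pi>"
    then obtain i oper r where x: "(i, oper, r) \<in> set lin" "a = idx i" by (auto simp: \<pi>_def)
    then show "a \<in> op_positions c"
      using lin_exec_positions[OF ex' x(1)] idx[of i] lin_ps[OF x(1)]
      by (auto simp: op_positions_def c)
  next
    fix a assume "a \<in> op_positions c"
    then have a: "a < length ps" "is_Inv (g ! (ps ! a))" by (auto simp: op_positions_def c)
    then obtain t oper where t: "g ! (ps ! a) = Inv t oper" by (cases "g ! (ps ! a)") auto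
    have "\<not> pending g (ps ! a)" using a(1) ps_set nth_mem by blast
    then have "st' t \<noteq> Pending (ps ! a) oper" using pend ps_lt a by blast
    then obtain r where "(ps ! a, oper, r) \<in> set lin"
      using lin_exec_cases[OF ex' ps_lt[OF a(1)] t] nd by auto
    then have "idx (fst (ps ! a, oper, r)) \<in> set \<pi>" unfolding \<pi>_def set_map by (rule imageI)
    then show "a \<in> set \<pi>" using idx_ps[OF a(1)] by simp
  qed
  have prec: "precedes g (ps ! a) (ps ! b)" if p: "precedes c a b" and a: "a < length ps" for a b
  proof -
    obtain k where k: "responds c a k" "k < b" "b < length ps" "is_Inv (c ! b)"
      using p by (auto simp: precedes_def op_positions_def len)
    then have "responds g (ps ! a) (ps ! k)" using a resp by simp
    moreover have "ps ! k < ps ! b" using k less by simp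
    ultimately show ?thesis using k ps_lt by (auto simp: precedes_def op_positions_def c)
  qed
  have o: "a < b" if "a < length \<pi>" "b < length \<pi>" "precedes c (\<pi> ! a) (\<pi> ! b)" for a b
  proof (rule ccontr)
    assume "\<not> a < b"
    have p: "precedes g (fst (lin ! a)) (fst (lin ! b))"
      using prec[OF that(3)] that(1,2) idx lin_ps by (simp add: \<pi>_def)
    then have "a \<noteq> b" by (auto simp: precedes_def responds_def)
    with \<open>\<not> a < b\<close> have "b < a" by simp
    then show False using lin_exec_order[OF ex', of b a] p that by (simp add: \<pi>_def)
  qed
  have res: "list_all2 (op_result c) \<pi> (map snd lin)"
  proof (unfold list_all2_conv_all_nth, intro conjI allI impI)
    show "length \<pi> = length (map snd lin)" by (simp add: \<pi>_def)
    fix a assume a: "a < length \<pi>"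
    obtain i oper r where x: "lin ! a = (i, oper, r)" by (cases "lin ! a")
    then have mem: "(i, oper, r) \<in> set lin" using a by (metis \<pi>_def length_map nth_mem)
    then obtain t k where k: "g ! i = Inv t oper" "responds g i k" "g ! k = Res t r"
      using lin_resp by blast
    have i: "idx i < length ps" "ps ! idx i = i" and k': "idx k < length ps" "ps ! idx k = k"
      using resp_ps[OF k(2)] idx by auto
    have "responds c (idx i) (idx k)" using resp i k' k(2) by simp
    then show "op_result c (\<pi> ! a) (map snd lin ! a)"
      using a x k i k' unfolding op_result_def c \<pi>_def by auto
  qed
  have "linearization legal c \<pi> (map snd lin)"
    unfolding linearization_def using d s o res legal by blast
  with completion show ?thesis unfolding linearizable_def by blast
qed

section \<open>Ghost state and invariants\<close>

text \<open>The \<open>s\<close>-th entry of \<open>pushes G B\<close> is the thread whose fetch&increment of \<open>pushCount\<close> returned \<open>s\<close>,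
  with its node; \<open>pops\<close> is analogous. \<open>frozen G B = Some (pp, pu)\<close> holds the frozen values of
  \<open>popCount\<close> and \<open>pushCount\<close> from the moment the latter is read, before it is written to memory.
  \<open>applied\<close> is set by the successful CAS of the combiner, and \<open>taken\<close> is the pointer which that CAS
  replaced if the combiner pops. A node can be announced in several batches; \<open>claim\<close> records the
  only slot in which it counts.\<close>

record 't ghost =
  pushes :: "batch_ref \<Rightarrow> ('t \<times> nat) list"
  pops :: "batch_ref \<Rightarrow> 't list"
  owner :: "batch_ref \<Rightarrow> nat"
  used :: "batch_ref set"
  freezer :: "batch_ref \<Rightarrow> 't option"
  frozen :: "batch_ref \<Rightarrow> (nat \<times> nat) option"
  applied :: "batch_ref \<Rightarrow> bool"
  taken :: "batch_ref \<Rightarrow> node_ptr"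
  creator :: "nat \<Rightarrow> 't"
  claim :: "nat \<Rightarrow> (batch_ref \<times> nat) option"
  status :: "'t \<Rightarrow> (stack_op, stack_res) op_status"

section \<open>Linked lists in memory and results determined by slots\<close>

fun chain :: "(nat \<Rightarrow> node) \<Rightarrow> nat set \<Rightarrow> node_ptr \<Rightarrow> nat list \<Rightarrow> bool" where
  "chain N D p [] \<longleftrightarrow> p = None"
| "chain N D p (a # as) \<longleftrightarrow> p = Some a \<and> a \<in> D \<and> chain N D (next (N a)) as"

text \<open>Null is a fixed point, as in the walk of PopFromStack, so pops beyond the bottom of the
  stack need no separate treatment.\<close>

fun follow :: "(nat \<Rightarrow> node) \<Rightarrow> node_ptr \<Rightarrow> nat \<Rightarrow> node_ptr" where
  "follow N p 0 = p"
| "follow N None (Suc k) = None"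
| "follow N (Some a) (Suc k) = follow N (next (N a)) k"

definition res_at :: "(nat \<Rightarrow> node) \<Rightarrow> node_ptr \<Rightarrow> stack_res" where
  "res_at N p = (case p of None \<Rightarrow> REmpty | Some a \<Rightarrow> RVal (value (N a)))"

text \<open>Makes the status a function of an optional result, so that one formula covers an
  operation before and after it takes effect.\<close>

fun stat :: "nat \<Rightarrow> stack_op \<Rightarrow> stack_res option \<Rightarrow> (stack_op, stack_res) op_status" where
  "stat i oper None = Pending i oper"
| "stat i oper (Some r) = Done i oper r"

definition node_at :: "'t ghost \<Rightarrow> batch_ref \<Rightarrow> nat \<Rightarrow> nat" where
  "node_at G B s = snd (pushes G B ! s)"

definition members :: "'t ghost \<Rightarrow> batch_ref \<Rightarrow> 't set" where
  "members G B = fst ` set (pushes G B) \<union> set (pops G B)"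

text \<open>The nodes that are or were reachable from \<open>stackTop\<close>.\<close>

definition pub :: "'t ghost \<Rightarrow> nat set" where
  "pub G = {a. \<exists>B s pp pu. claim G a = Some (B, s) \<and> frozen G B = Some (pp, pu) \<and> pp \<le> s \<and>
     applied G B}"

text \<open>Determined at the freeze already, possibly long before the thread learns of its role.
  With equal counts every served operation is eliminated and there is no combiner.\<close>

definition combiner :: "'t ghost \<Rightarrow> batch_ref \<Rightarrow> 't option" where
  "combiner G B = (case frozen G B of None \<Rightarrow> None
     | Some (pp, pu) \<Rightarrow> if pp < pu then Some (fst (pushes G B ! pp))
         else if pu < pp then Some (pops G B ! pu) else None)"

text \<open>\<open>None\<close> stands for an operation that has not taken effect, including one
  that will have to retry with another batch.\<close>

definition push_res :: "'t ghost \<Rightarrow> batch_ref \<Rightarrow> nat \<Rightarrow> stack_res option" where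
  "push_res G B s = (case frozen G B of None \<Rightarrow> None
     | Some (pp, pu) \<Rightarrow> if s < pu \<and> (s < pp \<or> applied G B) then Some RTrue else None)"

text \<open>The value comes from \<open>node_at\<close> and not from the elimination array: when an
  eliminated pair takes effect, the pusher owns its slot but may not have announced its node
  yet.\<close>

definition pop_res :: "(nat \<Rightarrow> node) \<Rightarrow> 't ghost \<Rightarrow> batch_ref \<Rightarrow> nat \<Rightarrow> stack_res option" where
  "pop_res N G B s = (case frozen G B of None \<Rightarrow> None
     | Some (pp, pu) \<Rightarrow> if s < pp then
           if s < pu then Some (RVal (value (N (node_at G B s))))
           else if applied G B then Some (res_at N (follow N (taken G B) (s - pu))) else None
         else None)"

definition retired :: "shared \<Rightarrow> 't ghost \<Rightarrow> batch_ref \<Rightarrow> bool" where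
  "retired M G B \<longleftrightarrow> B \<in> used G \<and> agg_batch M (owner G B) \<noteq> B"

abbreviation gchain :: "shared \<Rightarrow> 't ghost \<Rightarrow> node_ptr \<Rightarrow> nat list \<Rightarrow> bool" where
  "gchain M G \<equiv> chain (nodes M) (pub G)"

section \<open>Assertions at control points\<close>

text \<open>The batch in which the thread holds a slot that it has not yet finished with.\<close>

fun batch_of :: "pc \<Rightarrow> batch_ref option" where
  "batch_of (InFreeze (FrzReadPop r B s)) = Some B"
| "batch_of (InFreeze (FrzWritePop r B s c)) = Some B"
| "batch_of (InFreeze (FrzReadPush r B s)) = Some B"
| "batch_of (InFreeze (FrzWritePush r B s c)) = Some B"
| "batch_of (InFreeze (FrzAlloc r B s)) = Some B"
| "batch_of (InFreeze (FrzInstall r B s B')) = Some B"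
| "batch_of (InPush (PushAnnounce n B s)) = Some B"
| "batch_of (InPush (PushTAS n B s)) = Some B"
| "batch_of (InPush (PushSpin n B s)) = Some B"
| "batch_of (InPush (PushCheckFrozen n B s)) = Some B"
| "batch_of (InPush (PushCheckElim B s)) = Some B"
| "batch_of (InPush (PushCheckCombiner B s)) = Some B"
| "batch_of (InPush (PushSetApplied B)) = Some B"
| "batch_of (InPush (PushWaitApplied B)) = Some B"
| "batch_of (InPTS (PTSInit B s)) = Some B"
| "batch_of (InPTS (PTSLoop B bt tp i)) = Some B"
| "batch_of (InPTS (PTSWait B bt tp i)) = Some B"
| "batch_of (InPTS (PTSLink B bt tp i x)) = Some B"
| "batch_of (InPTS (PTSReadTop B bt tp)) = Some B"
| "batch_of (InPTS (PTSSetBot B bt tp x)) = Some B"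
| "batch_of (InPTS (PTSCas B bt tp x)) = Some B"
| "batch_of (InPop (PopTAS B s)) = Some B"
| "batch_of (InPop (PopSpin B s)) = Some B"
| "batch_of (InPop (PopCheckFrozen B s)) = Some B"
| "batch_of (InPop (PopCheckElim B s)) = Some B"
| "batch_of (InPop (PopWaitElim B s)) = Some B"
| "batch_of (InPop (PopReadElim B s)) = Some B"
| "batch_of (InPop (PopCheckCombiner B s)) = Some B"
| "batch_of (InPop (PopSetApplied B s)) = Some B"
| "batch_of (InPop (PopWaitApplied B s)) = Some B"
| "batch_of (InPop (PopOffset B s)) = Some B"
| "batch_of (InPFS (PFSInit B s)) = Some B"
| "batch_of (InPFS (PFSReadTop B s m)) = Some B"
| "batch_of (InPFS (PFSWalk B s m tp bt k)) = Some B"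
| "batch_of (InPFS (PFSCas B s m tp bt)) = Some B"
| "batch_of (InPFS (PFSStore B s tp)) = Some B"
| "batch_of _ = None"

text \<open>The status is dictated by the slot, so the assertion survives when a freezer or combiner
  completes the operation. The last conjunct keeps the node free for another attempt unless a freeze
  covers the slot.\<close>

definition push_slot :: "shared \<Rightarrow> 't ghost \<Rightarrow> 't \<Rightarrow> nat \<Rightarrow> batch_ref \<Rightarrow> nat \<Rightarrow> bool" where
  "push_slot M G t a B s \<longleftrightarrow> s < length (pushes G B) \<and> pushes G B ! s = (t, a) \<and>
     (\<exists>i. status G t = stat i (Push (value (nodes M a))) (push_res G B s)) \<and>
     (claim G a = None \<or> (\<exists>pp pu. frozen G B = Some (pp, pu) \<and> s < pu))"

definition pop_slot :: "shared \<Rightarrow> 't ghost \<Rightarrow> 't \<Rightarrow> batch_ref \<Rightarrow> nat \<Rightarrow> bool" where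
  "pop_slot M G t B s \<longleftrightarrow> s < length (pops G B) \<and> pops G B ! s = t \<and>
     (\<exists>i. status G t = stat i Pop (pop_res (nodes M) G B s))"

definition holds :: "shared \<Rightarrow> 't ghost \<Rightarrow> 't \<Rightarrow> node_ptr \<Rightarrow> bool" where
  "holds M G t n \<longleftrightarrow> (\<exists>a i. n = Some a \<and> a \<in> node_alloc M \<and> creator G a = t \<and>
     claim G a = None \<and> status G t = Pending i (Push (value (nodes M a))))"

definition joinable :: "nat \<Rightarrow> 't ghost \<Rightarrow> 't \<Rightarrow> batch_ref \<Rightarrow> bool" where
  "joinable A G t B \<longleftrightarrow> B \<in> used G \<and> owner G B = A \<and> t \<notin> members G B"

text \<open>The implication lets a thread that finds itself to be the combiner conclude that the
  batch has not been applied yet.\<close>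

definition waiting :: "nat \<Rightarrow> 't ghost \<Rightarrow> 't \<Rightarrow> batch_ref \<Rightarrow> bool" where
  "waiting A G t B \<longleftrightarrow> B \<in> used G \<and> owner G B = A \<and> (combiner G B = Some t \<longrightarrow> \<not> applied G B)"

definition announcing :: "nat \<Rightarrow> shared \<Rightarrow> 't ghost \<Rightarrow> 't \<Rightarrow> node_ptr \<Rightarrow> batch_ref \<Rightarrow> nat \<Rightarrow> bool" where
  "announcing A M G t n B s \<longleftrightarrow> (\<exists>a. n = Some a \<and> push_slot M G t a B s) \<and> waiting A G t B"

abbreviation cell :: "shared \<Rightarrow> batch_ref \<Rightarrow> nat \<Rightarrow> node_ptr" where
  "cell M B s \<equiv> eliminationArray (batches M B) ! s"

definition push_combining :: "shared \<Rightarrow> 't ghost \<Rightarrow> 't \<Rightarrow> batch_ref \<Rightarrow> nat \<Rightarrow> nat \<Rightarrow> bool" where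
  "push_combining M G t B pp pu \<longleftrightarrow> frozen G B = Some (pp, pu) \<and> pp < pu \<and> retired M G B \<and>
     \<not> applied G B \<and> push_slot M G t (node_at G B pp) B pp"

definition pop_combining :: "shared \<Rightarrow> 't ghost \<Rightarrow> 't \<Rightarrow> batch_ref \<Rightarrow> nat \<Rightarrow> nat \<Rightarrow> bool" where
  "pop_combining M G t B pp pu \<longleftrightarrow> frozen G B = Some (pp, pu) \<and> pu < pp \<and> retired M G B \<and>
     \<not> applied G B \<and> pop_slot M G t B pu"

text \<open>Each node points to the one in the slot below, so the largest index ends up on top. The
  node at \<open>pp\<close> is exempt: its link into the stack is chosen anew before every
  CAS.\<close>

definition linked ::
  "shared \<Rightarrow> 't ghost \<Rightarrow> batch_ref \<Rightarrow> nat \<Rightarrow> nat \<Rightarrow> node_ptr \<Rightarrow> node_ptr \<Rightarrow> bool"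
where
  "linked M G B pp i bt tp \<longleftrightarrow> pp < i \<and> bt = Some (node_at G B pp) \<and>
     tp = Some (node_at G B (i - 1)) \<and>
     (\<forall>j. pp < j \<and> j < i \<longrightarrow> next (nodes M (node_at G B j)) = Some (node_at G B (j - 1)))"

fun frz_slot :: "nat \<Rightarrow> shared \<Rightarrow> 't ghost \<Rightarrow> 't \<Rightarrow> role \<Rightarrow> batch_ref \<Rightarrow> nat \<Rightarrow> bool" where
  "frz_slot A M G t (Pusher n) B s \<longleftrightarrow> announcing A M G t n B s \<and> cell M B s = n"
| "frz_slot A M G t Popper B s \<longleftrightarrow> pop_slot M G t B s \<and> waiting A G t B"

definition freezing :: "nat \<Rightarrow> shared \<Rightarrow> 't ghost \<Rightarrow> 't \<Rightarrow> role \<Rightarrow> batch_ref \<Rightarrow> nat \<Rightarrow> bool" where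
  "freezing A M G t r B s \<longleftrightarrow> frz_slot A M G t r B s \<and> freezer G B = Some t \<and> agg_batch M A = B"

text \<open>Further pops may join after \<open>popCount\<close> has been read, hence only an upper
  bound for the value read. The bound says that all slots below that value are occupied, which is
  what the freeze needs.\<close>

fun freeze_ok :: "nat \<Rightarrow> shared \<Rightarrow> 't ghost \<Rightarrow> 't \<Rightarrow> freeze_pc \<Rightarrow> bool" where
  "freeze_ok A M G t (FrzReadPop r B s) \<longleftrightarrow> freezing A M G t r B s \<and> frozen G B = None"
| "freeze_ok A M G t (FrzWritePop r B s c) \<longleftrightarrow> freezing A M G t r B s \<and> frozen G B = None \<and>
     c \<le> length (pops G B)"
| "freeze_ok A M G t (FrzReadPush r B s) \<longleftrightarrow> freezing A M G t r B s \<and> frozen G B = None \<and>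
     popCountAtFreeze (batches M B) \<le> length (pops G B)"
| "freeze_ok A M G t (FrzWritePush r B s c) \<longleftrightarrow> freezing A M G t r B s \<and>
     frozen G B = Some (popCountAtFreeze (batches M B), c)"
| "freeze_ok A M G t (FrzAlloc r B s) \<longleftrightarrow> freezing A M G t r B s \<and>
     frozen G B = Some (popCountAtFreeze (batches M B), pushCountAtFreeze (batches M B))"
| "freeze_ok A M G t (FrzInstall r B s B') \<longleftrightarrow> freezing A M G t r B s \<and>
     frozen G B = Some (popCountAtFreeze (batches M B), pushCountAtFreeze (batches M B)) \<and>
     B' \<in> batch_alloc M - used G \<and> owner G B' = A"

text \<open>At \<open>PushCheckElim\<close> and \<open>PushCheckCombiner\<close> the control point
  no longer carries the node, so the array cell takes its place.\<close>

fun push_ok :: "nat \<Rightarrow> shared \<Rightarrow> 't ghost \<Rightarrow> 't \<Rightarrow> push_pc \<Rightarrow> bool" where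
  "push_ok A M G t (PushAlloc v) \<longleftrightarrow> (\<exists>i. status G t = Pending i (Push v))"
| "push_ok A M G t (PushGetBatch n) \<longleftrightarrow> holds M G t n"
| "push_ok A M G t (PushCount n B) \<longleftrightarrow> holds M G t n \<and> joinable A G t B"
| "push_ok A M G t (PushAnnounce n B s) \<longleftrightarrow> announcing A M G t n B s"
| "push_ok A M G t (PushTAS n B s) \<longleftrightarrow> announcing A M G t n B s \<and> cell M B s = n"
| "push_ok A M G t (PushSpin n B s) \<longleftrightarrow> announcing A M G t n B s \<and> cell M B s = n"
| "push_ok A M G t (PushCheckFrozen n B s) \<longleftrightarrow> announcing A M G t n B s \<and> cell M B s = n \<and>
     retired M G B"
| "push_ok A M G t (PushCheckElim B s) \<longleftrightarrow> announcing A M G t (cell M B s) B s \<and>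
     cell M B s \<noteq> None \<and> retired M G B \<and> (\<exists>pp pu. frozen G B = Some (pp, pu) \<and> s < pu)"
| "push_ok A M G t (PushCheckCombiner B s) \<longleftrightarrow> announcing A M G t (cell M B s) B s \<and>
     cell M B s \<noteq> None \<and> retired M G B \<and>
     (\<exists>pp pu. frozen G B = Some (pp, pu) \<and> pp \<le> s \<and> s < pu)"
| "push_ok A M G t (PushSetApplied B) \<longleftrightarrow> applied G B \<and> retired M G B \<and>
     (\<exists>a s pu. push_slot M G t a B s \<and> frozen G B = Some (s, pu) \<and> s < pu)"
| "push_ok A M G t (PushWaitApplied B) \<longleftrightarrow> retired M G B \<and>
     (\<exists>a s pp pu. push_slot M G t a B s \<and> frozen G B = Some (pp, pu) \<and> pp < s \<and> s < pu)"

fun pts_ok :: "shared \<Rightarrow> 't ghost \<Rightarrow> 't \<Rightarrow> push_to_stack_pc \<Rightarrow> bool" where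
  "pts_ok M G t (PTSInit B s) \<longleftrightarrow> (\<exists>pu. push_combining M G t B s pu) \<and>
     cell M B s = Some (node_at G B s)"
| "pts_ok M G t (PTSLoop B bt tp i) \<longleftrightarrow>
     (\<exists>pp pu. push_combining M G t B pp pu \<and> linked M G B pp i bt tp \<and> i \<le> pu)"
| "pts_ok M G t (PTSWait B bt tp i) \<longleftrightarrow>
     (\<exists>pp pu. push_combining M G t B pp pu \<and> linked M G B pp i bt tp \<and> i < pu)"
| "pts_ok M G t (PTSLink B bt tp i x) \<longleftrightarrow>
     (\<exists>pp pu. push_combining M G t B pp pu \<and> linked M G B pp i bt tp \<and> i < pu) \<and>
     x = Some (node_at G B i)"
| "pts_ok M G t (PTSReadTop B bt tp) \<longleftrightarrow>
     (\<exists>pp pu. push_combining M G t B pp pu \<and> linked M G B pp pu bt tp)"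
| "pts_ok M G t (PTSSetBot B bt tp x) \<longleftrightarrow>
     (\<exists>pp pu. push_combining M G t B pp pu \<and> linked M G B pp pu bt tp)"
| "pts_ok M G t (PTSCas B bt tp x) \<longleftrightarrow>
     (\<exists>pp pu. push_combining M G t B pp pu \<and> linked M G B pp pu bt tp \<and>
        next (nodes M (node_at G B pp)) = x)"

fun pop_ok :: "nat \<Rightarrow> shared \<Rightarrow> 't ghost \<Rightarrow> 't \<Rightarrow> pop_pc \<Rightarrow> bool" where
  "pop_ok A M G t PopGetBatch \<longleftrightarrow> (\<exists>i. status G t = Pending i Pop)"
| "pop_ok A M G t (PopCount B) \<longleftrightarrow> (\<exists>i. status G t = Pending i Pop) \<and> joinable A G t B"
| "pop_ok A M G t (PopTAS B s) \<longleftrightarrow> pop_slot M G t B s \<and> waiting A G t B"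
| "pop_ok A M G t (PopSpin B s) \<longleftrightarrow> pop_slot M G t B s \<and> waiting A G t B"
| "pop_ok A M G t (PopCheckFrozen B s) \<longleftrightarrow> pop_slot M G t B s \<and> waiting A G t B \<and> retired M G B"
| "pop_ok A M G t (PopCheckElim B s) \<longleftrightarrow> pop_slot M G t B s \<and> waiting A G t B \<and> retired M G B \<and>
     (\<exists>pp pu. frozen G B = Some (pp, pu) \<and> s < pp)"
| "pop_ok A M G t (PopWaitElim B s) \<longleftrightarrow> pop_slot M G t B s \<and> retired M G B \<and>
     (\<exists>pp pu. frozen G B = Some (pp, pu) \<and> s < pp \<and> s < pu)"
| "pop_ok A M G t (PopReadElim B s) \<longleftrightarrow> pop_slot M G t B s \<and> retired M G B \<and>
     cell M B s \<noteq> None \<and> (\<exists>pp pu. frozen G B = Some (pp, pu) \<and> s < pp \<and> s < pu)"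
| "pop_ok A M G t (PopReadValue p) \<longleftrightarrow> (\<exists>a i. p = Some a \<and> a \<in> node_alloc M \<and>
     status G t = Done i Pop (RVal (value (nodes M a))))"
| "pop_ok A M G t (PopCheckCombiner B s) \<longleftrightarrow> pop_slot M G t B s \<and> waiting A G t B \<and>
     retired M G B \<and> (\<exists>pp pu. frozen G B = Some (pp, pu) \<and> pu \<le> s \<and> s < pp)"
| "pop_ok A M G t (PopSetApplied B s) \<longleftrightarrow> pop_slot M G t B s \<and> retired M G B \<and> applied G B \<and>
     subStackTop (batches M B) = taken G B \<and> (\<exists>pp. frozen G B = Some (pp, s) \<and> s < pp)"
| "pop_ok A M G t (PopWaitApplied B s) \<longleftrightarrow> pop_slot M G t B s \<and> retired M G B \<and>
     (\<exists>pp pu. frozen G B = Some (pp, pu) \<and> pu \<le> s \<and> s < pp)"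
| "pop_ok A M G t (PopOffset B s) \<longleftrightarrow> pop_slot M G t B s \<and> retired M G B \<and>
     isBatchApplied (batches M B) \<and> (\<exists>pp pu. frozen G B = Some (pp, pu) \<and> pu \<le> s \<and> s < pp)"

text \<open>The walked pointer and the list are described in current memory. Both descriptions
  survive changes of \<open>stackTop\<close>, so that comparing the top pointer in the CAS is
  enough.\<close>

fun pfs_ok :: "shared \<Rightarrow> 't ghost \<Rightarrow> 't \<Rightarrow> pop_from_stack_pc \<Rightarrow> bool" where
  "pfs_ok M G t (PFSInit B s) \<longleftrightarrow> (\<exists>pp. pop_combining M G t B pp s)"
| "pfs_ok M G t (PFSReadTop B s m) \<longleftrightarrow> (\<exists>pp. pop_combining M G t B pp s \<and> m = pp - s)"
| "pfs_ok M G t (PFSWalk B s m tp bt k) \<longleftrightarrow> (\<exists>pp. pop_combining M G t B pp s \<and> m = pp - s) \<and>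
     k \<le> m \<and> bt = follow (nodes M) tp (m - k) \<and> (\<exists>as. gchain M G tp as)"
| "pfs_ok M G t (PFSCas B s m tp bt) \<longleftrightarrow> (\<exists>pp. pop_combining M G t B pp s \<and> m = pp - s) \<and>
     bt = follow (nodes M) tp m \<and> (\<exists>as. gchain M G tp as)"
| "pfs_ok M G t (PFSStore B s tp) \<longleftrightarrow> pop_slot M G t B s \<and> retired M G B \<and> applied G B \<and>
     taken G B = tp \<and> (\<exists>pp. frozen G B = Some (pp, s) \<and> s < pp) \<and>
     \<not> isBatchApplied (batches M B)"

text \<open>Here the thread no longer counts as being in the batch: its result is fixed, and the
  walk merely recomputes it.\<close>

fun gv_ok :: "shared \<Rightarrow> 't ghost \<Rightarrow> 't \<Rightarrow> get_value_pc \<Rightarrow> bool" where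
  "gv_ok M G t (GVInit B j) \<longleftrightarrow> isBatchApplied (batches M B) \<and>
     (\<exists>pp pu. frozen G B = Some (pp, pu) \<and> pu < pp) \<and>
     (\<exists>i as. gchain M G (taken G B) as \<and>
       status G t = Done i Pop (res_at (nodes M) (follow (nodes M) (taken G B) j)))"
| "gv_ok M G t (GVWalk p j) \<longleftrightarrow>
     (\<exists>i as. gchain M G p as \<and>
       status G t = Done i Pop (res_at (nodes M) (follow (nodes M) p j)))"

fun peek_ok :: "shared \<Rightarrow> 't ghost \<Rightarrow> 't \<Rightarrow> peek_pc \<Rightarrow> bool" where
  "peek_ok M G t PeekReadTop \<longleftrightarrow> (\<exists>i. status G t = Pending i Peek)"
| "peek_ok M G t (PeekReadValue p) \<longleftrightarrow> (\<exists>a i. p = Some a \<and> a \<in> node_alloc M \<and>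
     status G t = Done i Peek (RVal (value (nodes M a))))"

fun thread_ok :: "nat \<Rightarrow> shared \<Rightarrow> 't ghost \<Rightarrow> 't \<Rightarrow> pc \<Rightarrow> bool" where
  "thread_ok A M G t Idle \<longleftrightarrow> status G t = NoOp"
| "thread_ok A M G t (Returning r) \<longleftrightarrow> (\<exists>i oper. status G t = Done i oper r)"
| "thread_ok A M G t (InFreeze q) \<longleftrightarrow> freeze_ok A M G t q"
| "thread_ok A M G t (InPush q) \<longleftrightarrow> push_ok A M G t q"
| "thread_ok A M G t (InPTS q) \<longleftrightarrow> pts_ok M G t q"
| "thread_ok A M G t (InPop q) \<longleftrightarrow> pop_ok A M G t q"
| "thread_ok A M G t (InPFS q) \<longleftrightarrow> pfs_ok M G t q"
| "thread_ok A M G t (InGV q) \<longleftrightarrow> gv_ok M G t q"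
| "thread_ok A M G t (InPeek q) \<longleftrightarrow> peek_ok M G t q"

section \<open>Interference conditions and global invariant\<close>

text \<open>What thread \<open>t\<close> at control point \<open>p\<close> may assume about a step of another thread. Such a step may
  linearize the operation of \<open>t\<close>; the status then changes in accordance with \<open>push_res\<close> and
  \<open>pop_res\<close>.\<close>

locale rely =
  fixes A :: nat and t :: 't and p :: pc and M :: shared and G :: "'t ghost"
    and M' :: shared and G' :: "'t ghost"
  assumes status: "batch_of p = None \<Longrightarrow> status G' t = status G t"
    and push_status:
      "\<And>B s a i. \<lbrakk>batch_of p = Some B; s < length (pushes G B); pushes G B ! s = (t, a);
        status G t = stat i (Push (value (nodes M a))) (push_res G B s)\<rbrakk> \<Longrightarrow>
        status G' t = stat i (Push (value (nodes M a))) (push_res G' B s)"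
    and pop_status: "\<And>B s i. \<lbrakk>batch_of p = Some B; s < length (pops G B); pops G B ! s = t;
        status G t = stat i Pop (pop_res (nodes M) G B s)\<rbrakk> \<Longrightarrow>
        status G' t = stat i Pop (pop_res (nodes M') G' B s)"
    and node_alloc: "node_alloc M \<subseteq> node_alloc M'"
    and node_value: "\<And>a. a \<in> node_alloc M \<Longrightarrow> value (nodes M' a) = value (nodes M a)"
    and creator: "\<And>a. a \<in> node_alloc M \<Longrightarrow> creator G' a = creator G a"
    and pub: "\<And>a. a \<in> pub G \<Longrightarrow> a \<in> pub G' \<and> nodes M' a = nodes M a"
    and claim: "\<And>a. \<lbrakk>a \<in> node_alloc M; claim G a = None; creator G a = t\<rbrakk> \<Longrightarrow> claim G' a = None \<or>
        (\<exists>B s pp pu. batch_of p = Some B \<and> s < length (pushes G B) \<and> pushes G B ! s = (t, a) \<and>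
           frozen G' B = Some (pp, pu) \<and> s < pu)"
    and used: "used G \<subseteq> used G'"
    and batch_alloc: "batch_alloc M \<subseteq> batch_alloc M'"
    and pushes: "\<And>B. \<exists>xs. pushes G' B = pushes G B @ xs \<and> t \<notin> fst ` set xs"
    and pops: "\<And>B. \<exists>xs. pops G' B = pops G B @ xs \<and> t \<notin> set xs"
    and owner: "\<And>B. B \<in> batch_alloc M \<Longrightarrow> owner G' B = owner G B"
    and frozen: "\<And>B x. frozen G B = Some x \<Longrightarrow> frozen G' B = Some x"
    and not_applied: "\<And>B. frozen G B = None \<Longrightarrow> \<not> applied G' B"
    and not_frozen: "\<And>B. frozen G B = None \<Longrightarrow> freezer G B = Some t \<Longrightarrow> frozen G' B = None"
    and applied: "\<And>B. applied G B \<Longrightarrow> applied G' B"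
    and taken: "\<And>B. applied G B \<Longrightarrow> taken G' B = taken G B"
    and combiner: "\<And>B. combiner G B = Some t \<Longrightarrow> applied G' B = applied G B \<and>
        subStackTop (batches M' B) = subStackTop (batches M B) \<and>
        isBatchApplied (batches M' B) = isBatchApplied (batches M B) \<and>
        (\<forall>s < length (pushes G B). claim G (node_at G B s) = Some (B, s) \<longrightarrow>
           next (nodes M' (node_at G B s)) = next (nodes M (node_at G B s)))"
    and freezer: "\<And>B. freezer G B = Some t \<Longrightarrow> freezer G' B = Some t \<and>
        popCountAtFreeze (batches M' B) = popCountAtFreeze (batches M B) \<and>
        pushCountAtFreeze (batches M' B) = pushCountAtFreeze (batches M B)"
    and agg_batch: "freezer G (agg_batch M A) = Some t \<Longrightarrow> agg_batch M' A = agg_batch M A"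
    and not_used:
      "\<And>B. \<lbrakk>freezer G (agg_batch M A) = Some t; B \<in> batch_alloc M - used G; owner G B = A\<rbrakk>
        \<Longrightarrow> B \<notin> used G'"
    and retired: "\<And>B. retired M G B \<Longrightarrow> retired M' G' B"
    and cell:
      "\<And>B s. \<lbrakk>B \<in> used G; s < length (pushes G B); cell M B s \<noteq> None\<rbrakk> \<Longrightarrow> cell M' B s = cell M B s"
    and isBatchApplied:
      "\<And>B. \<lbrakk>B \<in> used G; isBatchApplied (batches M B)\<rbrakk> \<Longrightarrow> isBatchApplied (batches M' B)"

text \<open>A cell in the occupied range may still be null, since a slot is taken before it is
  filled. Cells beyond the range are required to be null so that a newly taken slot satisfies the
  same condition.\<close>

locale batch_ok =
  fixes P :: nat and T :: "'t set" and agg :: "'t \<Rightarrow> nat" and M :: shared and G :: "'t ghost"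
    and B :: batch_ref
  assumes pushCount: "pushCount (batches M B) = length (pushes G B)"
    and popCount: "popCount (batches M B) = length (pops G B)"
    and length: "length (eliminationArray (batches M B)) = P"
    and distinct: "distinct (map fst (pushes G B) @ pops G B)"
    and members: "\<And>t. t \<in> members G B \<Longrightarrow> t \<in> T \<and> agg t = owner G B"
    and node_alloc: "\<And>s. s < length (pushes G B) \<Longrightarrow> node_at G B s \<in> node_alloc M"
    and creator: "\<And>s. s < length (pushes G B) \<Longrightarrow> creator G (node_at G B s) = fst (pushes G B ! s)"
    and cell: "\<And>s. s < length (pushes G B) \<Longrightarrow> cell M B s = None \<or> cell M B s = Some (node_at G B s)"
    and decided: "isFreezerDecided (batches M B) \<longleftrightarrow> freezer G B \<noteq> None"
    and not_frozen: "freezer G B = None \<Longrightarrow> frozen G B = None"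
    and current: "freezer G B = None \<Longrightarrow> agg_batch M (owner G B) = B"
    and retired: "agg_batch M (owner G B) \<noteq> B \<Longrightarrow>
        frozen G B = Some (popCountAtFreeze (batches M B), pushCountAtFreeze (batches M B))"
    and not_applied: "frozen G B = None \<Longrightarrow> \<not> applied G B"
    and pops_le: "\<And>pp pu. frozen G B = Some (pp, pu) \<Longrightarrow> pp \<le> length (pops G B)"
    and pushes_le: "\<And>pp pu. frozen G B = Some (pp, pu) \<Longrightarrow> pu \<le> length (pushes G B)"
    and claim:
      "\<And>pp pu s. frozen G B = Some (pp, pu) \<Longrightarrow> s < pu \<Longrightarrow> claim G (node_at G B s) = Some (B, s)"
    and taken: "\<And>pp pu. \<lbrakk>frozen G B = Some (pp, pu); pu < pp; applied G B\<rbrakk> \<Longrightarrow>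
        \<exists>as. gchain M G (taken G B) as"
    and subStackTop: "\<And>pp pu. \<lbrakk>frozen G B = Some (pp, pu); pu < pp; isBatchApplied (batches M B)\<rbrakk> \<Longrightarrow>
        subStackTop (batches M B) = taken G B"
    and applied: "isBatchApplied (batches M B) \<Longrightarrow> applied G B"
    and cell_none: "\<And>s. length (pushes G B) \<le> s \<Longrightarrow> s < P \<Longrightarrow> cell M B s = None"

lemmas batch_okD =
  batch_ok.pushCount batch_ok.popCount batch_ok.length batch_ok.distinct batch_ok.members
  batch_ok.node_alloc batch_ok.creator batch_ok.cell batch_ok.decided batch_ok.not_frozen
  batch_ok.current batch_ok.retired batch_ok.not_applied batch_ok.pops_le batch_ok.pushes_le
  batch_ok.claim batch_ok.taken batch_ok.subStackTop batch_ok.applied batch_ok.cell_none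

definition unused_ok :: "'t ghost \<Rightarrow> batch_ref \<Rightarrow> bool" where
  "unused_ok G B \<longleftrightarrow> pushes G B = [] \<and> pops G B = [] \<and> freezer G B = None \<and> frozen G B = None \<and>
     \<not> applied G B"

text \<open>Threads that a freezer or combiner of \<open>B\<close> may yet linearize, or that still have to learn that
  \<open>B\<close> is frozen.\<close>

definition engaged :: "shared \<Rightarrow> 't ghost \<Rightarrow> batch_ref \<Rightarrow> 't \<Rightarrow> bool" where
  "engaged M G B t \<longleftrightarrow> t \<in> members G B \<and> \<not> retired M G B \<or>
     (\<exists>pp pu. frozen G B = Some (pp, pu) \<and> \<not> applied G B \<and>
       ((\<exists>s. pp \<le> s \<and> s < pu \<and> fst (pushes G B ! s) = t) \<or> (\<exists>s. pu \<le> s \<and> s < pp \<and> pops G B ! s = t)))"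

definition stack_ok :: "shared \<Rightarrow> 't ghost \<Rightarrow> int list \<Rightarrow> bool" where
  "stack_ok M G S \<longleftrightarrow> (\<exists>as. gchain M G (stackTop M) as \<and> S = map (\<lambda>a. value (nodes M a)) as) \<and>
     (\<forall>a \<in> pub G. \<exists>as. gchain M G (Some a) as)"

text \<open>Together with the field \<open>claim\<close> of \<open>batch_ok\<close>, this makes
  claims a bijection between claimed nodes and served push slots.\<close>

definition claims_ok :: "'t ghost \<Rightarrow> bool" where
  "claims_ok G \<longleftrightarrow> (\<forall>a B s. claim G a = Some (B, s) \<longrightarrow>
     (\<exists>pp pu. frozen G B = Some (pp, pu) \<and> s < pu \<and> node_at G B s = a))"

text \<open>The clause on \<open>engaged\<close> has two uses: a freezer or combiner finds the
  occupants of the slots it completes still inside the batch, and a thread outside all batches is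
  known not to be a member of the current one.\<close>

definition global_ok ::
  "nat \<Rightarrow> nat \<Rightarrow> 't set \<Rightarrow> ('t \<Rightarrow> nat) \<Rightarrow> shared \<Rightarrow> 't ghost \<Rightarrow> ('t \<Rightarrow> pc) \<Rightarrow> int list \<Rightarrow> bool"
where
  "global_ok K P T agg M G L S \<longleftrightarrow>
     used G \<subseteq> batch_alloc M \<and>
     (\<forall>A < K. agg_batch M A \<in> used G \<and> owner G (agg_batch M A) = A) \<and>
     (\<forall>B \<in> batch_alloc M - used G. batches M B = fresh_batch P) \<and>
     (\<forall>B. B \<notin> used G \<longrightarrow> unused_ok G B) \<and>
     (\<forall>B \<in> used G. batch_ok P T agg M G B) \<and>
     claims_ok G \<and> stack_ok M G S \<and>
     (\<forall>B t. engaged M G B t \<longrightarrow> batch_of (L t) = Some B)"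

text \<open>The reason for the parameter \<open>D\<close>: with the published nodes as
  \<open>D\<close>, a list survives every write to other nodes.\<close>

lemma chain_mono:
  "chain N D p as \<Longrightarrow> (\<And>a. a \<in> D \<Longrightarrow> a \<in> D' \<and> N' a = N a) \<Longrightarrow> chain N' D' p as"
  by (induction as arbitrary: p) auto

lemma chain_follow:
  "chain N D p as \<Longrightarrow> follow N p k = (if k < length as then Some (as ! k) else None)"
proof (induction as arbitrary: p k)
  case Nil then show ?case by (cases k) auto
next
  case (Cons a as) then show ?case by (cases k) auto
qed

lemma chain_follow_chain: "chain N D p as \<Longrightarrow> chain N D (follow N p k) (drop k as)"
proof (induction as arbitrary: p k)
  case Nil then show ?case by (cases k) auto
next
  case (Cons a as) then show ?case by (cases k) auto
qed

lemma chain_set: "chain N D p as \<Longrightarrow> set as \<subseteq> D"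
  by (induction as arbitrary: p) auto

text \<open>\<open>follow\<close> recurses at the head, whereas the walk of PopFromStack extends the
  path at its far end.\<close>

lemma follow_Suc:
  "follow N p (Suc k) = (case follow N p k of None \<Rightarrow> None | Some a \<Rightarrow> next (N a))"
proof (induction k arbitrary: p)
  case 0 then show ?case by (cases p) auto
next
  case (Suc k) then show ?case by (cases p) auto
qed

lemma chain_follow_cong:
  "chain N D p as \<Longrightarrow> (\<And>a. a \<in> D \<Longrightarrow> N' a = N a) \<Longrightarrow> follow N' p k = follow N p k"
proof (induction as arbitrary: p k)
  case Nil then show ?case by (cases k) auto
next
  case (Cons a as) then show ?case by (cases k) auto
qed

lemma chain_res_at_cong:
  assumes "chain N D p as" "\<And>a. a \<in> D \<Longrightarrow> N' a = N a"
  shows "res_at N' (follow N' p k) = res_at N (follow N p k)"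
proof -
  have "\<And>a. a \<in> set as \<Longrightarrow> N' a = N a" using chain_set[OF assms(1)] assms(2) by auto
  then show ?thesis
    by (simp add: chain_follow_cong[OF assms] chain_follow[OF assms(1)] res_at_def)
qed

lemma global_okD:
  assumes "global_ok K P T agg M G L S"
  shows "used G \<subseteq> batch_alloc M"
    and "\<And>A. A < K \<Longrightarrow> agg_batch M A \<in> used G"
    and "\<And>A. A < K \<Longrightarrow> owner G (agg_batch M A) = A"
    and "\<And>B. B \<in> batch_alloc M \<Longrightarrow> B \<notin> used G \<Longrightarrow> batches M B = fresh_batch P"
    and "\<And>B. B \<notin> used G \<Longrightarrow> unused_ok G B"
    and "\<And>B. B \<in> used G \<Longrightarrow> batch_ok P T agg M G B"
    and "claims_ok G" and "stack_ok M G S"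
    and "\<And>B t. engaged M G B t \<Longrightarrow> batch_of (L t) = Some B"
  using assms unfolding global_ok_def by auto

lemma global_used:
  assumes "global_ok K P T agg M G L S"
  shows "s < length (pushes G B) \<Longrightarrow> B \<in> used G"
    and "s < length (pops G B) \<Longrightarrow> B \<in> used G"
    and "frozen G B = Some x \<Longrightarrow> B \<in> used G"
    and "freezer G B = Some t \<Longrightarrow> B \<in> used G"
    and "t \<in> members G B \<Longrightarrow> B \<in> used G"
  using global_okD(5)[OF assms, of B] unfolding unused_ok_def members_def
  by (cases "B \<in> used G"; simp)+

section \<open>Stability under steps of other threads\<close>

lemma push_slot_inj:
  assumes "batch_ok P T agg M G B" "s < length (pushes G B)" "s' < length (pushes G B)"
    "fst (pushes G B ! s) = fst (pushes G B ! s')"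
  shows "s = s'"
proof -
  have "distinct (map fst (pushes G B))" using batch_ok.distinct[OF assms(1)] by simp
  then show ?thesis using assms(2-) by (metis length_map nth_eq_iff_index_eq nth_map)
qed

lemma pop_slot_inj:
  assumes "batch_ok P T agg M G B" "s < length (pops G B)" "s' < length (pops G B)"
    "pops G B ! s = pops G B ! s'"
  shows "s = s'"
proof -
  have "distinct (pops G B)" using batch_ok.distinct[OF assms(1)] by simp
  then show ?thesis using assms(2-) by (metis nth_eq_iff_index_eq)
qed

lemma push_pop_disjoint:
  assumes "batch_ok P T agg M G B" "s < length (pushes G B)" "s' < length (pops G B)"
  shows "fst (pushes G B ! s) \<noteq> pops G B ! s'"
proof
  assume eq: "fst (pushes G B ! s) = pops G B ! s'"
  have "fst ` set (pushes G B) \<inter> set (pops G B) = {}" using batch_ok.distinct[OF assms(1)] by auto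
  moreover have "fst (pushes G B ! s) \<in> fst ` set (pushes G B)" "pops G B ! s' \<in> set (pops G B)"
    using assms(2,3) by auto
  ultimately show False using eq by auto
qed

context
  fixes K P :: nat and T :: "'t set" and agg :: "'t \<Rightarrow> nat"
    and M M' :: shared and G G' :: "'t ghost" and L L' :: "'t \<Rightarrow> pc" and S S' :: "int list"
    and A :: nat and t :: 't and p :: pc
  assumes rely: "rely A t p M G M' G'"
    and glob: "global_ok K P T agg M G L S"
    and glob': "global_ok K P T agg M' G' L' S'"
begin

lemma rely_pushes_nth:
  "s < length (pushes G B) \<Longrightarrow> s < length (pushes G' B) \<and> pushes G' B ! s = pushes G B ! s"
  using rely.pushes[OF rely, of B] by (auto simp: nth_append)

lemma rely_pops_nth:
  "s < length (pops G B) \<Longrightarrow> s < length (pops G' B) \<and> pops G' B ! s = pops G B ! s"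
  using rely.pops[OF rely, of B] by (auto simp: nth_append)

lemma rely_node_at: "s < length (pushes G B) \<Longrightarrow> node_at G' B s = node_at G B s"
  using rely_pushes_nth by (simp add: node_at_def)

lemma rely_chain:
  assumes "gchain M G q as"
  shows "gchain M' G' q as"
  using chain_mono[OF assms, of "pub G'" "nodes M'"] rely.pub[OF rely] by blast

lemma rely_follow:
  assumes "gchain M G q as"
  shows "follow (nodes M') q k = follow (nodes M) q k"
  using chain_follow_cong[OF assms, of "nodes M'"] rely.pub[OF rely] by blast

lemma rely_res_at:
  assumes "gchain M G q as"
  shows "res_at (nodes M') (follow (nodes M') q k) = res_at (nodes M) (follow (nodes M) q k)"
  using chain_res_at_cong[OF assms, of "nodes M'"] rely.pub[OF rely] by blast

lemma rely_push_slot: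
  assumes "push_slot M G t a B s" "batch_of p = Some B"
  shows "push_slot M' G' t a B s"
proof -
  have s: "s < length (pushes G B)" "pushes G B ! s = (t, a)" using assms by
    (auto simp: push_slot_def)
  have B: "B \<in> used G" using global_used(1)[OF glob s(1)] .
  note ok = global_okD(6)[OF glob B]
  have a: "a = node_at G B s" using s by (simp add: node_at_def)
  have al: "a \<in> node_alloc M" "creator G a = t" using batch_ok.node_alloc[OF ok s(1)]
    batch_ok.creator[OF ok s(1)] s a by auto
  have "claim G' a = None \<or> (\<exists>pp pu. frozen G' B = Some (pp, pu) \<and> s < pu)"
  proof (cases "claim G a = None")
    case True
    from rely.claim[OF rely al(1) True al(2)] show ?thesis
    proof
      assume "\<exists>B s pp pu. batch_of p = Some B \<and> s < length (pushes G B) \<and> pushes G B ! s = (t, a) \<and>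
           frozen G' B = Some (pp, pu) \<and> s < pu"
      then obtain s' pp pu where s': "s' < length (pushes G B)" "pushes G B ! s' = (t, a)"
        "frozen G' B = Some (pp, pu)" "s' < pu" using assms(2) by auto
      \<comment> \<open>A priori the new claim could concern another slot, but a thread has only one
        push slot in a batch.\<close>
      have "s = s'" using push_slot_inj[OF ok s(1) s'(1)] s(2) s'(2) by simp
      with s' show ?thesis by blast
    qed blast
  next
    case False
    then obtain pp pu where "frozen G B = Some (pp, pu)" "s < pu"
      using assms(1) by (auto simp: push_slot_def)
    then show ?thesis using rely.frozen[OF rely] by simp
  qed
  moreover obtain i where
    "status G t = stat i (Push (value (nodes M a))) (push_res G B s)"
    using assms by (auto simp: push_slot_def)
  then have "status G' t = stat i (Push (value (nodes M' a))) (push_res G' B s)"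
    using rely.push_status[OF rely assms(2) s] rely.node_value[OF rely al(1)] by simp
  ultimately show ?thesis using s rely_pushes_nth[OF s(1)] by (auto simp: push_slot_def)
qed

lemma rely_pop_slot:
  assumes "pop_slot M G t B s" "batch_of p = Some B"
  shows "pop_slot M' G' t B s"
proof -
  have s: "s < length (pops G B)" "pops G B ! s = t" using assms by (auto simp: pop_slot_def)
  obtain i where "status G t = stat i Pop (pop_res (nodes M) G B s)"
    using assms by (auto simp: pop_slot_def)
  then have "status G' t = stat i Pop (pop_res (nodes M') G' B s)"
    using rely.pop_status[OF rely assms(2) s] by simp
  then show ?thesis using s rely_pops_nth[OF s(1)] by (auto simp: pop_slot_def)
qed

lemma rely_holds:
  assumes "holds M G t n" "batch_of p = None"
  shows "holds M' G' t n"
proof -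
  obtain a i where a: "n = Some a" "a \<in> node_alloc M" "creator G a = t" "claim G a = None"
    "status G t = Pending i (Push (value (nodes M a)))" using assms(1) by (auto simp: holds_def)
  have "claim G' a = None" using rely.claim[OF rely a(2,4,3)] assms(2) by auto
  then show ?thesis using a rely.status[OF rely assms(2)] rely.node_alloc[OF rely]
    rely.node_value[OF rely] rely.creator[OF rely] by (auto simp: holds_def)
qed

lemma rely_joinable:
  assumes "joinable A G t B"
  shows "joinable A G' t B"
proof -
  obtain xs ys where "pushes G' B = pushes G B @ xs" "t \<notin> fst ` set xs"
    "pops G' B = pops G B @ ys" "t \<notin> set ys"
    using rely.pushes[OF rely, of B] rely.pops[OF rely, of B] by blast
  then have "t \<notin> members G' B" using assms by (simp add: joinable_def members_def image_Un)
  then show ?thesis using assms rely.used[OF rely] rely.owner[OF rely, of B] global_okD(1)[OF glob]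
    by (auto simp: joinable_def)
qed

lemma rely_combiner:
  assumes "frozen G B \<noteq> None"
  shows "combiner G' B = combiner G B"
proof -
  obtain pp pu where f: "frozen G B = Some (pp, pu)" using assms by auto
  note ok = global_okD(6)[OF glob global_used(3)[OF glob f]]
  show ?thesis using f rely.frozen[OF rely f] batch_ok.pops_le[OF ok f] batch_ok.pushes_le[OF ok f]
      rely_pushes_nth[of pp B] rely_pops_nth[of pu B]
    by (simp add: combiner_def)
qed

lemma rely_waiting:
  assumes "waiting A G t B"
  shows "waiting A G' t B"
proof -
  have B: "B \<in> used G" "owner G B = A" using assms by (auto simp: waiting_def)
  have "\<not> applied G' B" if "combiner G' B = Some t"
  proof (cases "frozen G B")
    \<comment> \<open>A step that freezes the batch may make \<open>t\<close> its combiner, but it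
      does not apply the batch as well.\<close>
    case None then show ?thesis using rely.not_applied[OF rely] by simp
  next
    case Some
    then have c: "combiner G B = Some t" using rely_combiner[of B] that by simp
    then show ?thesis using rely.combiner[OF rely c] assms by (simp add: waiting_def)
  qed
  then show ?thesis using B rely.used[OF rely] rely.owner[OF rely] global_okD(1)[OF glob] by
    (auto simp: waiting_def)
qed

lemma rely_announcing:
  assumes "announcing A M G t n B s" "batch_of p = Some B"
  shows "announcing A M' G' t n B s"
  using assms rely_push_slot rely_waiting by (auto simp: announcing_def)

lemma rely_cell:
  assumes "announcing A M G t n B s" "cell M B s = n"
  shows "cell M' B s = n"
proof -
  obtain a where "n = Some a" "s < length (pushes G B)"
    using assms(1) by (auto simp: announcing_def push_slot_def)
  then show ?thesis using rely.cell[OF rely global_used(1)[OF glob], of s B s] assms(2) by simp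
qed

text \<open>\<open>rely\<close> protects the \<open>next\<close> fields of the nodes claimed by the
  batch that \<open>t\<close> combines, and all slots below \<open>pu\<close> are claimed, so the
  links built so far stay intact.\<close>

lemma rely_push_combining:
  assumes c: "push_combining M G t B pp pu" and B: "batch_of p = Some B"
  shows "push_combining M' G' t B pp pu"
    and "linked M G B pp i bt tp \<Longrightarrow> i \<le> pu \<Longrightarrow> linked M' G' B pp i bt tp"
    and "next (nodes M' (node_at G' B pp)) = next (nodes M (node_at G B pp))"
    and "i < pu \<Longrightarrow> node_at G' B i = node_at G B i"
proof -
  have f: "frozen G B = Some (pp, pu)" "pp < pu" "\<not> applied G B" "retired M G B"
    and ps: "push_slot M G t (node_at G B pp) B pp"
    using c by (auto simp: push_combining_def)
  note ok = global_okD(6)[OF glob global_used(3)[OF glob f(1)]]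
  have pu: "pu \<le> length (pushes G B)" using batch_ok.pushes_le[OF ok f(1)] .
  have comb: "combiner G B = Some t" using f ps by (simp add: combiner_def push_slot_def)
  have n: "node_at G' B i = node_at G B i" if "i < pu" for i using rely_node_at that pu by simp
  note r = rely.combiner[OF rely comb]
  have nx: "next (nodes M' (node_at G' B i)) = next (nodes M (node_at G B i))" if "i < pu" for i
    using r batch_ok.claim[OF ok f(1) that] n[OF that] that pu by simp
  show "push_combining M' G' t B pp pu"
    using r f rely.frozen[OF rely f(1)] rely.retired[OF rely f(4)] rely_push_slot[OF ps B]
      n[OF f(2)]
    by (simp add: push_combining_def)
  show "i < pu \<Longrightarrow> node_at G' B i = node_at G B i" using n .
  show "next (nodes M' (node_at G' B pp)) = next (nodes M (node_at G B pp))" using nx f(2) .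
  show "linked M G B pp i bt tp \<Longrightarrow> i \<le> pu \<Longrightarrow> linked M' G' B pp i bt tp"
    unfolding linked_def using n[of "i - 1"] n nx f(2) by auto
qed

lemma rely_pop_combining:
  assumes c: "pop_combining M G t B pp pu" and B: "batch_of p = Some B"
  shows "pop_combining M' G' t B pp pu"
proof -
  have f: "frozen G B = Some (pp, pu)" "pu < pp" "\<not> applied G B" "retired M G B"
    and ps: "pop_slot M G t B pu"
    using c by (auto simp: pop_combining_def)
  have "combiner G B = Some t" using f ps by (simp add: combiner_def pop_slot_def)
  from rely.combiner[OF rely this] show ?thesis
    using f rely.frozen[OF rely f(1)] rely.retired[OF rely f(4)] rely_pop_slot[OF ps B]
    by (simp add: pop_combining_def)
qed

lemma rely_freezing:
  assumes "freezing A M G t r B s" "batch_of p = Some B"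
  shows "freezing A M' G' t r B s"
proof -
  have "frz_slot A M' G' t r B s"
    using assms rely_announcing rely_cell rely_pop_slot rely_waiting
    by (cases r) (auto simp: freezing_def)
  then show ?thesis using assms rely.freezer[OF rely, of B] rely.agg_batch[OF rely]
    by (auto simp: freezing_def)
qed

lemma rely_freeze_ok:
  assumes "freeze_ok A M G t q" "p = InFreeze q"
  shows "freeze_ok A M' G' t q"
proof -
  obtain B r s where B: "batch_of p = Some B" and fr: "freezing A M G t r B s"
    using assms by (cases q) auto
  have f: "freezer G B = Some t" "agg_batch M A = B" using fr by (auto simp: freezing_def)
  note r = rely_freezing[OF _ B] rely.freezer[OF rely f(1)] rely.not_frozen[OF rely _ f(1)]
    rely.frozen[OF rely]
  have "length (pops G B) \<le> length (pops G' B)" using rely.pops[OF rely, of B] by auto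
  then show ?thesis
  proof (cases q)
    case (FrzInstall r' B1 s' B')
    then have B1: "B1 = B" using assms B by simp
    \<comment> \<open>While \<open>t\<close> freezes the current batch of its aggregator, no other
      thread activates a batch of that aggregator.\<close>
    have "owner G' B' = owner G B'" "B' \<notin> used G'" "B' \<in> batch_alloc M'"
      using assms(1) FrzInstall f rely.not_used[OF rely, of B'] rely.owner[OF rely, of B']
        rely.batch_alloc[OF rely]
      by auto
    then show ?thesis using assms(1) r FrzInstall B1 by auto
  qed (use assms B r in auto)
qed

lemma rely_push_ok:
  assumes "push_ok A M G t q" "p = InPush q"
  shows "push_ok A M' G' t q"
proof (cases q)
  case (PushCheckElim B s)
  then have a: "announcing A M G t (cell M B s) B s" using assms by simp
  show ?thesis using assms PushCheckElim rely_announcing[OF a] rely_cell[OF a refl]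
      rely.frozen[OF rely] rely.retired[OF rely] by auto
next
  case (PushCheckCombiner B s)
  then have a: "announcing A M G t (cell M B s) B s" using assms by simp
  show ?thesis using assms PushCheckCombiner rely_announcing[OF a] rely_cell[OF a refl]
      rely.frozen[OF rely] rely.retired[OF rely] by auto
next
  case (PushSetApplied B)
  then obtain a s pu where s: "push_slot M G t a B s" "frozen G B = Some (s, pu)" "s < pu"
    "applied G B" "retired M G B" using assms by auto
  show ?thesis using PushSetApplied assms(2) rely_push_slot[OF s(1)] rely.frozen[OF rely s(2)] s(3)
      rely.applied[OF rely s(4)] rely.retired[OF rely s(5)] by auto
next
  case (PushWaitApplied B)
  then obtain a s pp pu where s: "push_slot M G t a B s" "frozen G B = Some (pp, pu)"
    "pp < s" "s < pu" "retired M G B" using assms by auto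
  show ?thesis using PushWaitApplied assms(2) rely_push_slot[OF s(1)] rely.frozen[OF rely s(2)]
    s(3,4)
      rely.retired[OF rely s(5)] by auto
qed (use assms rely.status[OF rely] rely.retired[OF rely] rely_holds rely_joinable rely_announcing rely_cell in auto)

lemma rely_pts_ok:
  assumes "pts_ok M G t q" "p = InPTS q"
  shows "pts_ok M' G' t q"
proof (cases q)
  case (PTSInit B s)
  then obtain pu where c: "push_combining M G t B s pu" "cell M B s = Some (node_at G B s)"
    using assms by auto
  have "batch_of p = Some B" using PTSInit assms(2) by simp
  note r = rely_push_combining[OF c(1) this]
  have s: "s < length (pushes G B)" "s < pu" using c(1) by
    (auto simp: push_combining_def push_slot_def)
  show ?thesis using r(1) r(4)[OF s(2)] rely.cell[OF rely global_used(1)[OF glob s(1)] s(1)] c(2)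
      PTSInit by auto
next
  case (PTSLink B bt tp i x)
  then obtain pp pu where c: "push_combining M G t B pp pu" "linked M G B pp i bt tp" "i < pu"
    "x = Some (node_at G B i)"
    using assms by auto
  have "batch_of p = Some B" using PTSLink assms(2) by simp
  note r = rely_push_combining[OF c(1) this]
  show ?thesis using r(1) r(2)[OF c(2)] r(4)[OF c(3)] c(3,4) PTSLink by auto
next
  case (PTSCas B bt tp x)
  then obtain pp pu where c: "push_combining M G t B pp pu" "linked M G B pp pu bt tp"
    "next (nodes M (node_at G B pp)) = x"
    using assms by auto
  have "batch_of p = Some B" using PTSCas assms(2) by simp
  note r = rely_push_combining[OF c(1) this]
  show ?thesis using r(1) r(2)[OF c(2)] r(3) c(3) PTSCas by auto
qed (use assms rely_push_combining(1,2) in \<open>auto, (metis order.refl less_imp_le batch_of.simps)+\<close>)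

lemma rely_pop_ok:
  assumes "pop_ok A M G t q" "p = InPop q"
  shows "pop_ok A M' G' t q"
proof (cases q)
  case (PopReadElim B s)
  then obtain pp pu where c: "pop_slot M G t B s" "retired M G B" "cell M B s \<noteq> None"
    "frozen G B = Some (pp, pu)" "s < pp" "s < pu"
    using assms by auto
  have B: "B \<in> used G" using global_used(3)[OF glob c(4)] .
  have "s < length (pushes G B)" using batch_ok.pushes_le[OF global_okD(6)[OF glob B] c(4)] c(6)
    by simp
  from rely.cell[OF rely B this c(3)] have "cell M' B s \<noteq> None" using c(3) by simp
  then show ?thesis using c rely.frozen[OF rely] rely.retired[OF rely] rely_pop_slot PopReadElim
    assms(2) by auto
next
  case (PopSetApplied B s)
  then obtain pp where c: "pop_slot M G t B s" "retired M G B" "applied G B"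
    "subStackTop (batches M B) = taken G B" "frozen G B = Some (pp, s)" "s < pp"
    using assms by auto
  \<comment> \<open>Only the combiner may write \<open>subStackTop\<close>, so no other thread
    disturbs the stored pointer.\<close>
  have "combiner G B = Some t" using c by (simp add: combiner_def pop_slot_def)
  from rely.combiner[OF rely this] show ?thesis
    using c rely.frozen[OF rely] rely.retired[OF rely] rely.applied[OF rely] rely.taken[OF rely]
      rely_pop_slot PopSetApplied assms(2) by auto
next
  case (PopOffset B s)
  then have "B \<in> used G" using assms by (auto simp: retired_def)
  then show ?thesis using PopOffset assms rely.frozen[OF rely] rely.retired[OF rely]
    rely.isBatchApplied[OF rely] rely_pop_slot by auto
next
  case (PopReadValue x)
  then show ?thesis using assms rely.status[OF rely] rely.node_value[OF rely]
    rely.node_alloc[OF rely] by auto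
qed (use assms rely.status[OF rely] rely.frozen[OF rely] rely.retired[OF rely] rely_pop_slot rely_waiting rely_joinable in auto)

lemma rely_pfs_ok:
  assumes "pfs_ok M G t q" "p = InPFS q"
  shows "pfs_ok M' G' t q"
proof (cases q)
  case (PFSStore B s tp)
  then obtain pp where c: "pop_slot M G t B s" "retired M G B" "applied G B"
    "taken G B = tp" "frozen G B = Some (pp, s)" "s < pp" "\<not> isBatchApplied (batches M B)"
    using assms by auto
  have "combiner G B = Some t" using c by (simp add: combiner_def pop_slot_def)
  from rely.combiner[OF rely this] show ?thesis
    using c rely.frozen[OF rely] rely.retired[OF rely] rely.applied[OF rely] rely.taken[OF rely]
      rely_pop_slot PFSStore assms(2) by auto
next
  case (PFSWalk B s m tp bt k)
  then obtain as where "gchain M G tp as" using assms by auto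
  then show ?thesis using PFSWalk assms rely_pop_combining rely_chain rely_follow by fastforce
next
  case (PFSCas B s m tp bt)
  then obtain as where "gchain M G tp as" using assms by auto
  then show ?thesis using PFSCas assms rely_pop_combining rely_chain rely_follow by fastforce
qed (use assms rely_pop_combining in auto)

lemma rely_gv_ok:
  assumes "gv_ok M G t q" "p = InGV q"
  shows "gv_ok M' G' t q"
proof (cases q)
  case (GVInit B j)
  then obtain pp pu i as where c: "isBatchApplied (batches M B)" "frozen G B = Some (pp, pu)"
    "pu < pp"
    "gchain M G (taken G B) as"
    "status G t = Done i Pop (res_at (nodes M) (follow (nodes M) (taken G B) j))"
    using assms by auto
  have B: "B \<in> used G" using global_used(3)[OF glob c(2)] .
  \<comment> \<open>\<open>taken\<close> is stable only once the batch has been applied.\<close>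
  have ap: "applied G B" using batch_ok.applied[OF global_okD(6)[OF glob B] c(1)] .
  have "status G' t = status G t" using rely.status[OF rely] assms(2) GVInit by simp
  then show ?thesis using GVInit rely.isBatchApplied[OF rely B c(1)] rely.frozen[OF rely c(2)] c
      rely.taken[OF rely ap] rely_chain[OF c(4)] rely_res_at[OF c(4)] by auto
next
  case (GVWalk x j)
  then obtain i as where c: "gchain M G x as"
    "status G t = Done i Pop (res_at (nodes M) (follow (nodes M) x j))"
    using assms by auto
  have "status G' t = status G t" using rely.status[OF rely] assms(2) GVWalk by simp
  then show ?thesis using GVWalk c rely_chain[OF c(1)] rely_res_at[OF c(1)] by auto
qed

lemma rely_peek_ok:
  assumes "peek_ok M G t q" "p = InPeek q"
  shows "peek_ok M' G' t q"
  using assms rely.status[OF rely] rely.node_value[OF rely] rely.node_alloc[OF rely] by (cases q)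
    auto

lemma rely_thread_ok: "thread_ok A M G t p \<Longrightarrow> thread_ok A M' G' t p"
  using rely.status[OF rely] rely_freeze_ok rely_push_ok rely_pts_ok rely_pop_ok rely_pfs_ok
    rely_gv_ok
    rely_peek_ok by (cases p) auto

end

section \<open>Preservation by each step\<close>

definition state_after :: "int list \<Rightarrow> (stack_op \<times> stack_res) list \<Rightarrow> int list" where
  "state_after = foldl (\<lambda>xs x. fst (stack_apply (fst x) xs))"

lemma state_after_simps [simp]:
  "state_after xs [] = xs"
  "state_after xs (x # S) = state_after (fst (stack_apply (fst x) xs)) S"
  "state_after xs (S @ S') = state_after (state_after xs S) S'"
  by (simp_all add: state_after_def)

lemma stack_legal_from_Cons:
  "stack_legal_from xs (x # S) \<longleftrightarrow>
     snd (stack_apply (fst x) xs) = snd x \<and> stack_legal_from (fst (stack_apply (fst x) xs)) S"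
  by (cases x) simp

lemma stack_legal_from_append:
  "stack_legal_from xs (S @ S') \<longleftrightarrow>
     stack_legal_from xs S \<and> stack_legal_from (state_after xs S) S'"
  by (induction S arbitrary: xs)
    (simp_all add: stack_legal_from_Cons del: stack_legal_from.simps(2))

text \<open>Of the linearization only the abstract stack \<open>S\<close> is kept visible, which is
  all that further steps depend on.\<close>

definition lin_at ::
  "('t \<Rightarrow> (stack_op, stack_res) op_status) \<Rightarrow> ('t, stack_op, stack_res) history \<Rightarrow> int list \<Rightarrow> bool"
where
  "lin_at st h S \<longleftrightarrow> (\<exists>lin. lin_exec st h lin \<and> stack_legal_from [] (map snd lin) \<and>
     state_after [] (map snd lin) = S)"

lemma lin_at_linearize:
  assumes "lin_at st h S" "st t = Pending i oper" "snd (stack_apply oper S) = r"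
  shows "lin_at (st(t := Done i oper r)) h (fst (stack_apply oper S))"
proof -
  obtain lin where l: "lin_exec st h lin" "stack_legal_from [] (map snd lin)"
    "state_after [] (map snd lin) = S" using assms(1) by (auto simp: lin_at_def)
  then show ?thesis unfolding lin_at_def using assms(3) lin_exec.linearize[OF l(1) assms(2)]
    by (intro exI[of _ "lin @ [(i, oper, r)]"]) (auto simp: stack_legal_from_append)
qed

definition sim ::
  "nat \<Rightarrow> nat \<Rightarrow> 't set \<Rightarrow> ('t \<Rightarrow> nat) \<Rightarrow> shared \<Rightarrow> ('t \<Rightarrow> pc) \<Rightarrow>
   ('t, stack_op, stack_res) history \<Rightarrow> bool" where
  "sim K P T agg M L h \<longleftrightarrow> (\<exists>G S. lin_at (status G) h S \<and> global_ok K P T agg M G L S \<and>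
     (\<forall>u \<in> T. thread_ok (agg u) M G u (L u)))"

lemma global_not_applied:
  assumes "global_ok K P T agg M G L S" "frozen G B = None"
  shows "\<not> applied G B"
proof (cases "B \<in> used G")
  case True
  from batch_ok.not_applied[OF global_okD(6)[OF assms(1) True] assms(2)] show ?thesis .
next
  case False
  then show ?thesis using global_okD(5)[OF assms(1)] by (simp add: unused_ok_def)
qed

section \<open>Rules for single steps\<close>

locale sec_state =
  fixes K P :: nat and T :: "'t set" and agg :: "'t \<Rightarrow> nat"
    and M :: shared and G :: "'t ghost" and L :: "'t \<Rightarrow> pc" and S :: "int list"
    and h :: "('t, stack_op, stack_res) history" and t :: 't
  assumes fin: "finite T" and agg_K: "\<And>t. t \<in> T \<Longrightarrow> agg t < K"
    and card_P: "\<And>a. a < K \<Longrightarrow> card {t \<in> T. agg t = a} \<le> P"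
    and lin: "lin_at (status G) h S"
    and glob: "global_ok K P T agg M G L S"
    and thr: "\<And>u. u \<in> T \<Longrightarrow> thread_ok (agg u) M G u (L u)"
    and tT: "t \<in> T"
begin

text \<open>The stepping thread is checked directly, every other thread through \<open>rely\<close>,
  whose consequences for all control points are already available.\<close>

lemma step_intro:
  assumes "lin_at (status G') h' S'" and g: "global_ok K P T agg M' G' (L(t := p')) S'"
    and "thread_ok (agg t) M' G' t p'"
    and r: "\<And>u. u \<in> T \<Longrightarrow> u \<noteq> t \<Longrightarrow> rely (agg u) u (L u) M G M' G'"
  shows "sim K P T agg M' (L(t := p')) h'"
proof -
  have "thread_ok (agg u) M' G' u ((L(t := p')) u)" if "u \<in> T" for u
    using rely_thread_ok[OF r glob g thr] that assms(3) by (cases "u = t") auto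
  with assms(1,2) show ?thesis unfolding sim_def by blast
qed

lemma rely_refl: "rely A u p M G M G"
  by (rule rely.intro) (use global_not_applied[OF glob] in auto)

lemma local_step:
  assumes "thread_ok (agg t) M G t p'" "\<And>B. engaged M G B t \<Longrightarrow> batch_of p' = Some B"
  shows "sim K P T agg M (L(t := p')) h"
proof (rule step_intro[OF lin _ assms(1) rely_refl])
  show "global_ok K P T agg M G (L(t := p')) S"
    using glob assms(2) unfolding global_ok_def by simp
qed

text \<open>The engagement clause sees a control point only through \<open>batch_of\<close>, so it
  is untouched when the thread stays in the same batch.\<close>

lemma local_step_same:
  assumes "thread_ok (agg t) M G t p'" "batch_of p' = batch_of (L t)"
  shows "sim K P T agg M (L(t := p')) h"
  using assms(1) by (rule local_step) (use global_okD(9)[OF glob] assms(2) in simp)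

lemma local_step_none:
  assumes "thread_ok (agg t) M G t p'" "batch_of (L t) = None"
  shows "sim K P T agg M (L(t := p')) h"
  using assms(1) by (rule local_step) (use global_okD(9)[OF glob] assms(2) in fastforce)

lemma slot_facts:
  assumes "push_slot M G u a B s"
  shows "B \<in> used G" "batch_ok P T agg M G B" "a = node_at G B s" "a \<in> node_alloc M"
    "creator G a = u" "s < length (pushes G B)" "fst (pushes G B ! s) = u" "u \<in> members G B"
    "s < P"
proof -
  have s: "s < length (pushes G B)" "pushes G B ! s = (u, a)" using assms by
    (auto simp: push_slot_def)
  show B: "B \<in> used G" using global_used(1)[OF glob s(1)] .
  show ok: "batch_ok P T agg M G B" using global_okD(6)[OF glob B] .
  show "a = node_at G B s" using s by (simp add: node_at_def)
  then show "a \<in> node_alloc M" "creator G a = u" using batch_ok.node_alloc[OF ok s(1)]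
    batch_ok.creator[OF ok s(1)] s by auto
  show "s < length (pushes G B)" "fst (pushes G B ! s) = u" using s by auto
  show m: "u \<in> members G B" using s nth_mem[OF s(1)] by (force simp: members_def)
  then have "u \<in> T" "agg u = owner G B" using batch_ok.members[OF ok] by auto
  then have "owner G B < K" using agg_K by metis
  have "card (fst ` set (pushes G B)) \<le> card {t \<in> T. agg t = owner G B}"
    using fin batch_ok.members[OF ok] by (intro card_mono) (auto simp: members_def)
  moreover have "card (fst ` set (pushes G B)) = length (pushes G B)"
    using batch_ok.distinct[OF ok] distinct_card[of "map fst (pushes G B)"] by simp
  ultimately show "s < P" using s(1) card_P[OF \<open>owner G B < K\<close>] by simp
qed

lemma pop_slot_facts:
  assumes "pop_slot M G u B s"
  shows "B \<in> used G" "batch_ok P T agg M G B" "u \<in> members G B"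
proof -
  have s: "s < length (pops G B)" "pops G B ! s = u" using assms by (auto simp: pop_slot_def)
  show B: "B \<in> used G" using global_used(2)[OF glob s(1)] .
  show ok: "batch_ok P T agg M G B" using global_okD(6)[OF glob B] .
  show "u \<in> members G B" using s by (auto simp: members_def)
qed

lemma retiredD:
  assumes "retired M G B"
  shows "frozen G B = Some (popCountAtFreeze (batches M B), pushCountAtFreeze (batches M B))"
    and "batch_ok P T agg M G B"
  using assms global_okD(6)[OF glob, of B] batch_ok.retired[of P T agg M G B]
  by (auto simp: retired_def)

text \<open>Permission to leave a retired batch. Such a batch engages only the occupants of slots
  that its combiner still has to apply, and \<open>t\<close> has no second slot in it. As
  \<open>engaged\<close> looks at pushes and pops, both kinds of slot have to be excluded.\<close>

lemma not_engaged_push: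
  assumes s: "push_slot M G t a B s" and r: "retired M G B" and f: "frozen G B = Some (pp, pu)"
    and out: "s < pp \<or> pu \<le> s \<or> applied G B" and b: "batch_of (L t) = Some B"
  shows "\<not> engaged M G B' t"
proof
  assume e: "engaged M G B' t"
  have [simp]: "B' = B" using global_okD(9)[OF glob e] b by simp
  note sf = slot_facts[OF s]
  from e r f consider s' where "\<not> applied G B" "pp \<le> s'" "s' < pu" "fst (pushes G B ! s') = t"
    | s' where "pu \<le> s'" "s' < pp" "pops G B ! s' = t"
    by (auto simp: engaged_def)
  then show False
  proof cases
    case 1
    then have "s' = s" using push_slot_inj[OF sf(2) _ sf(6)] sf(7) batch_ok.pushes_le[OF sf(2) f]
      by simp
    then show False using 1 out by simp
  next
    case 2
    then show False using push_pop_disjoint[OF sf(2,6), of s'] batch_ok.pops_le[OF sf(2) f] sf(7)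
      by simp
  qed
qed

lemma not_engaged_pop:
  assumes s: "pop_slot M G t B s" and r: "retired M G B" and f: "frozen G B = Some (pp, pu)"
    and out: "s < pu \<or> pp \<le> s \<or> applied G B" and b: "batch_of (L t) = Some B"
  shows "\<not> engaged M G B' t"
proof
  assume e: "engaged M G B' t"
  have [simp]: "B' = B" using global_okD(9)[OF glob e] b by simp
  note sf = pop_slot_facts[OF s]
  have sl: "s < length (pops G B)" "pops G B ! s = t" using s by (auto simp: pop_slot_def)
  from e r f consider s' where "pp \<le> s'" "s' < pu" "fst (pushes G B ! s') = t"
    | s' where "\<not> applied G B" "pu \<le> s'" "s' < pp" "pops G B ! s' = t"
    by (auto simp: engaged_def)
  then show False
  proof cases
    case 1
    then show False using push_pop_disjoint[OF sf(2) _ sl(1), of s']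
      batch_ok.pushes_le[OF sf(2) f] sl(2)
      by simp
  next
    case 2
    then have "s' = s" using pop_slot_inj[OF sf(2) _ sl(1)] sl(2) batch_ok.pops_le[OF sf(2) f] by
      simp
    then show False using 2 out by simp
  qed
qed

text \<open>A member of a current batch is engaged and hence at a control point inside it. A thread
  outside all batches is therefore no member, which is why nobody takes two slots in one
  batch.\<close>

lemma agg_batch_joinable:
  assumes "batch_of (L t) = None"
  shows "joinable (agg t) G t (agg_batch M (agg t))"
proof -
  let ?B = "agg_batch M (agg t)"
  have B: "?B \<in> used G" "owner G ?B = agg t" using global_okD(2,3)[OF glob agg_K[OF tT]] by auto
  have "t \<notin> members G ?B"
  proof
    assume "t \<in> members G ?B"
    then have "engaged M G ?B t" using B by (simp add: engaged_def retired_def)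
    from global_okD(9)[OF glob this] show False using assms by simp
  qed
  then show ?thesis using B by (simp add: joinable_def)
qed

section \<open>Steps that write no shared memory\<close>

lemma step_push_spin:
  assumes "L t = InPush (PushSpin n B s)"
  shows "sim K P T agg M (L(t := if agg_batch M (agg t) = B then InPush (PushSpin n B s)
        else InPush (PushCheckFrozen n B s))) h"
  using thr[OF tT] assms
  by (intro local_step_same) (auto simp: announcing_def waiting_def retired_def)

lemma step_push_get_batch:
  assumes "L t = InPush (PushGetBatch n)"
  shows "sim K P T agg M (L(t := InPush (PushCount n (agg_batch M (agg t))))) h"
  using thr[OF tT] assms agg_batch_joinable by (intro local_step_none) auto

lemma step_push_check_frozen:
  assumes "L t = InPush (PushCheckFrozen n B s)"
  shows "sim K P T agg M (L(t := if s \<ge> pushCountAtFreeze (batches M B) then InPush (PushGetBatch n)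
        else InPush (PushCheckElim B s))) h"
proof -
  obtain a where a: "n = Some a" "push_slot M G t a B s" "waiting (agg t) G t B"
    "cell M B s = Some a"
    "retired M G B" using thr[OF tT] assms by (auto simp: announcing_def)
  note f = retiredD(1)[OF a(5)] and sf = slot_facts[OF a(2)]
  show ?thesis
  proof (cases "s \<ge> pushCountAtFreeze (batches M B)")
    case True
    have "holds M G t n"
      using a(1,2) True sf(4,5) f by (auto simp: holds_def push_slot_def push_res_def)
    then have "sim K P T agg M (L(t := InPush (PushGetBatch n))) h"
      using not_engaged_push[OF a(2,5) f] True assms by (intro local_step) auto
    then show ?thesis using True by simp
  next
    case False
    then have "sim K P T agg M (L(t := InPush (PushCheckElim B s))) h"
      using a f assms by (intro local_step_same) (auto simp: announcing_def)
    then show ?thesis using False by simp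
  qed
qed

lemma step_push_check_elim:
  assumes "L t = InPush (PushCheckElim B s)"
  shows "sim K P T agg M (L(t := if s < popCountAtFreeze (batches M B) then Returning RTrue
        else InPush (PushCheckCombiner B s))) h"
proof -
  obtain a where a: "push_slot M G t a B s" "waiting (agg t) G t B" "cell M B s = Some a"
    "retired M G B" "s < pushCountAtFreeze (batches M B)"
    using thr[OF tT] assms retiredD(1) by (fastforce simp: announcing_def)
  note f = retiredD(1)[OF a(4)] and sf = slot_facts[OF a(1)]
  show ?thesis
  proof (cases "s < popCountAtFreeze (batches M B)")
    case True
    then have "thread_ok (agg t) M G t (Returning RTrue)"
      using a(1,5) f by (auto simp: push_slot_def push_res_def)
    then have "sim K P T agg M (L(t := Returning RTrue)) h"
      using not_engaged_push[OF a(1,4) f] True assms by (intro local_step) auto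
    then show ?thesis using True by simp
  next
    case False
    then have "sim K P T agg M (L(t := InPush (PushCheckCombiner B s))) h"
      using a f assms by (intro local_step_same) (auto simp: announcing_def)
    then show ?thesis using False by simp
  qed
qed

lemma step_push_check_combiner:
  assumes "L t = InPush (PushCheckCombiner B s)"
  shows "sim K P T agg M (L(t := if s = popCountAtFreeze (batches M B) then InPTS (PTSInit B s)
        else InPush (PushWaitApplied B))) h"
proof -
  obtain a where a: "push_slot M G t a B s" "waiting (agg t) G t B" "cell M B s = Some a"
    "retired M G B" "s < pushCountAtFreeze (batches M B)" "popCountAtFreeze (batches M B) \<le> s"
    using thr[OF tT] assms retiredD(1) by (fastforce simp: announcing_def)
  note f = retiredD(1)[OF a(4)] and sf = slot_facts[OF a(1)]
  show ?thesis
  proof (cases "s = popCountAtFreeze (batches M B)")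
    case True
    \<comment> \<open>With this, \<open>waiting\<close> yields that the batch has not been
      applied.\<close>
    have "combiner G B = Some t" using f a(5) True sf(7) by (simp add: combiner_def)
    then have "push_combining M G t B s (pushCountAtFreeze (batches M B))"
      using a f sf(3) True by (simp add: push_combining_def waiting_def)
    then have "sim K P T agg M (L(t := InPTS (PTSInit B s))) h"
      using a(3) sf(3) assms by (intro local_step_same) auto
    then show ?thesis using True by simp
  next
    case False
    then have "popCountAtFreeze (batches M B) < s" using a(6) by simp
    then have "thread_ok (agg t) M G t (InPush (PushWaitApplied B))" using a f by auto
    then have "sim K P T agg M (L(t := InPush (PushWaitApplied B))) h"
      using assms by (intro local_step_same) auto
    then show ?thesis using False by simp
  qed
qed

lemma step_push_wait_applied:
  assumes "L t = InPush (PushWaitApplied B)"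
  shows "sim K P T agg M (L(t := if isBatchApplied (batches M B) then Returning RTrue
        else InPush (PushWaitApplied B))) h"
proof (cases "isBatchApplied (batches M B)")
  case True
  obtain a s pp pu where a: "push_slot M G t a B s" "retired M G B" "frozen G B = Some (pp, pu)"
    "pp < s" "s < pu" using thr[OF tT] assms by auto
  have ap: "applied G B" using batch_ok.applied[OF slot_facts(2)[OF a(1)] True] .
  then have "thread_ok (agg t) M G t (Returning RTrue)"
    using a by (auto simp: push_slot_def push_res_def)
  then have "sim K P T agg M (L(t := Returning RTrue)) h"
    using not_engaged_push[OF a(1-3)] ap assms by (intro local_step) auto
  then show ?thesis using True by simp
next
  case False
  then show ?thesis using thr[OF tT] assms by (intro local_step_same) auto
qed

lemma push_combining_facts:
  assumes "push_combining M G t B pp pu"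
  shows "pushCountAtFreeze (batches M B) = pu" "pu \<le> length (pushes G B)"
    "batch_ok P T agg M G B" "B \<in> used G"
proof -
  have r: "retired M G B" "frozen G B = Some (pp, pu)" using assms by
    (auto simp: push_combining_def)
  show "pushCountAtFreeze (batches M B) = pu" using retiredD(1)[OF r(1)] r(2) by simp
  show "batch_ok P T agg M G B" using retiredD(2)[OF r(1)] .
  then show "pu \<le> length (pushes G B)" using batch_ok.pushes_le r(2) by fast
  show "B \<in> used G" using r(1) by (simp add: retired_def)
qed

lemma step_pts_init:
  assumes "L t = InPTS (PTSInit B s)"
  shows "sim K P T agg M (L(t := InPTS (PTSLoop B (cell M B s) (cell M B s) (s + 1)))) h"
proof -
  obtain pu where c: "push_combining M G t B s pu" "cell M B s = Some (node_at G B s)"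
    using thr[OF tT] assms by auto
  have "linked M G B s (s + 1) (cell M B s) (cell M B s)" using c(2) by (auto simp: linked_def)
  moreover have "s + 1 \<le> pu" using c(1) by (simp add: push_combining_def)
  ultimately show ?thesis using c assms by (intro local_step_same) auto
qed

lemma step_pts_loop:
  assumes "L t = InPTS (PTSLoop B bt tp i)"
  shows
    "sim K P T agg M (L(t := if i < pushCountAtFreeze (batches M B) then InPTS (PTSWait B bt tp i)
        else InPTS (PTSReadTop B bt tp))) h"
proof -
  obtain pp pu where c: "push_combining M G t B pp pu" "linked M G B pp i bt tp" "i \<le> pu"
    using thr[OF tT] assms by auto
  then show ?thesis using push_combining_facts(1)[OF c(1)] assms by (intro local_step_same) auto
qed

lemma step_pts_wait:
  assumes "L t = InPTS (PTSWait B bt tp i)"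
  shows "sim K P T agg M (L(t := if cell M B i \<noteq> None then InPTS (PTSLink B bt tp i (cell M B i))
        else InPTS (PTSWait B bt tp i))) h"
proof -
  obtain pp pu where c: "push_combining M G t B pp pu" "linked M G B pp i bt tp" "i < pu"
    using thr[OF tT] assms by auto
  have "cell M B i = None \<or> cell M B i = Some (node_at G B i)"
    using push_combining_facts(2)[OF c(1)]
      batch_ok.cell[OF push_combining_facts(3)[OF c(1)], of i] c(3)
    by simp
  then show ?thesis using c assms by (intro local_step_same) auto
qed

lemma step_pts_read_top:
  assumes "L t = InPTS (PTSReadTop B bt tp)"
  shows "sim K P T agg M (L(t := InPTS (PTSSetBot B bt tp (stackTop M)))) h"
  using thr[OF tT] assms by (intro local_step_same) auto

lemma step_pts_cas_failure:
  assumes "L t = InPTS (PTSCas B bt tp x)"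
  shows "sim K P T agg M (L(t := InPTS (PTSReadTop B bt tp))) h"
  using thr[OF tT] assms by (intro local_step_same) auto

lemma step_pop_get_batch:
  assumes "L t = InPop PopGetBatch"
  shows "sim K P T agg M (L(t := InPop (PopCount (agg_batch M (agg t))))) h"
  using thr[OF tT] assms agg_batch_joinable by (intro local_step_none) auto

lemma step_pop_spin:
  assumes "L t = InPop (PopSpin B s)"
  shows "sim K P T agg M (L(t := if agg_batch M (agg t) = B then InPop (PopSpin B s)
        else InPop (PopCheckFrozen B s))) h"
  using thr[OF tT] assms by (intro local_step_same) (auto simp: waiting_def retired_def)

lemma step_pop_check_frozen:
  assumes "L t = InPop (PopCheckFrozen B s)"
  shows "sim K P T agg M (L(t := if s \<ge> popCountAtFreeze (batches M B) then InPop PopGetBatch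
        else InPop (PopCheckElim B s))) h"
proof -
  have a: "pop_slot M G t B s" "waiting (agg t) G t B" "retired M G B" using thr[OF tT] assms by
    auto
  note f = retiredD(1)[OF a(3)]
  show ?thesis
  proof (cases "s \<ge> popCountAtFreeze (batches M B)")
    case True
    then have "thread_ok (agg t) M G t (InPop PopGetBatch)"
      using a(1) f by (auto simp: pop_slot_def pop_res_def)
    then have "sim K P T agg M (L(t := InPop PopGetBatch)) h"
      using not_engaged_pop[OF a(1,3) f] True assms by (intro local_step) auto
    then show ?thesis using True by simp
  next
    case False
    then have "sim K P T agg M (L(t := InPop (PopCheckElim B s))) h"
      using a f assms by (intro local_step_same) auto
    then show ?thesis using False by simp
  qed
qed

lemma step_pop_check_elim:
  assumes "L t = InPop (PopCheckElim B s)"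
  shows "sim K P T agg M (L(t := if s < pushCountAtFreeze (batches M B) then InPop (PopWaitElim B s)
        else InPop (PopCheckCombiner B s))) h"
proof -
  have a: "pop_slot M G t B s" "waiting (agg t) G t B" "retired M G B"
    "\<exists>pp pu. frozen G B = Some (pp, pu) \<and> s < pp" using thr[OF tT] assms by auto
  then show ?thesis using retiredD(1)[OF a(3)] assms by (intro local_step_same) auto
qed

lemma step_pop_wait_elim:
  assumes "L t = InPop (PopWaitElim B s)"
  shows "sim K P T agg M (L(t := if cell M B s \<noteq> None then InPop (PopReadElim B s)
        else InPop (PopWaitElim B s))) h"
  using thr[OF tT] assms by (intro local_step_same) auto

lemma step_pop_read_elim:
  assumes "L t = InPop (PopReadElim B s)"
  shows "sim K P T agg M (L(t := InPop (PopReadValue (cell M B s)))) h"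
proof -
  obtain pp pu where a: "pop_slot M G t B s" "retired M G B" "cell M B s \<noteq> None"
    "frozen G B = Some (pp, pu)" "s < pp" "s < pu" using thr[OF tT] assms by auto
  note ok = pop_slot_facts(2)[OF a(1)]
  have s: "s < length (pushes G B)" using batch_ok.pushes_le[OF ok a(4)] a(6) by simp
  have "cell M B s = Some (node_at G B s)" "node_at G B s \<in> node_alloc M"
    using batch_ok.cell[OF ok s] batch_ok.node_alloc[OF ok s] a(3) by auto
  then have "thread_ok (agg t) M G t (InPop (PopReadValue (cell M B s)))"
    using a by (auto simp: pop_slot_def pop_res_def)
  then show ?thesis using not_engaged_pop[OF a(1,2,4)] a(6) assms by (intro local_step) auto
qed

lemma step_pop_read_value:
  assumes "L t = InPop (PopReadValue q)"
  shows "sim K P T agg M (L(t := Returning (RVal (value_of M q)))) h"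
  using thr[OF tT] assms by (intro local_step_none) auto

lemma step_pop_check_combiner:
  assumes "L t = InPop (PopCheckCombiner B s)"
  shows "sim K P T agg M (L(t := if s = pushCountAtFreeze (batches M B) then InPFS (PFSInit B s)
        else InPop (PopWaitApplied B s))) h"
proof -
  obtain pp pu where a: "pop_slot M G t B s" "waiting (agg t) G t B" "retired M G B"
    "frozen G B = Some (pp, pu)" "pu \<le> s" "s < pp" using thr[OF tT] assms by auto
  have pu: "pu = pushCountAtFreeze (batches M B)" using retiredD(1)[OF a(3)] a(4) by simp
  show ?thesis
  proof (cases "s = pu")
    case True
    have "combiner G B = Some t" using a True by (simp add: combiner_def pop_slot_def)
    then have "pop_combining M G t B pp s"
      using a True by (simp add: pop_combining_def waiting_def)
    then have "sim K P T agg M (L(t := InPFS (PFSInit B s))) h"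
      using assms by (intro local_step_same) auto
    then show ?thesis using True pu by simp
  next
    case False
    then have "sim K P T agg M (L(t := InPop (PopWaitApplied B s))) h"
      using a assms by (intro local_step_same) auto
    then show ?thesis using False pu by simp
  qed
qed

lemma step_pop_wait_applied:
  assumes "L t = InPop (PopWaitApplied B s)"
  shows "sim K P T agg M (L(t := if isBatchApplied (batches M B) then InPop (PopOffset B s)
        else InPop (PopWaitApplied B s))) h"
  using thr[OF tT] assms by (intro local_step_same) auto

lemma step_pop_offset:
  assumes "L t = InPop (PopOffset B s)"
  shows "sim K P T agg M (L(t := InGV (GVInit B (s - pushCountAtFreeze (batches M B))))) h"
proof -
  obtain pp pu where a: "pop_slot M G t B s" "retired M G B" "isBatchApplied (batches M B)"
    "frozen G B = Some (pp, pu)" "pu \<le> s" "s < pp" using thr[OF tT] assms by auto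
  have pu: "pu = pushCountAtFreeze (batches M B)" using retiredD(1)[OF a(2)] a(4) by simp
  note ok = pop_slot_facts(2)[OF a(1)]
  have ap: "applied G B" using batch_ok.applied[OF ok a(3)] .
  have "pu < pp" using a by simp
  from batch_ok.taken[OF ok a(4) this ap] obtain as where "gchain M G (taken G B) as" by blast
  moreover obtain i where
    "status G t = Done i Pop (res_at (nodes M) (follow (nodes M) (taken G B) (s - pu)))"
    using a ap by (auto simp: pop_slot_def pop_res_def)
  ultimately have "thread_ok (agg t) M G t (InGV (GVInit B (s - pu)))"
    using a \<open>pu < pp\<close> by auto
  then show ?thesis using not_engaged_pop[OF a(1,2,4)] ap assms pu by (intro local_step) auto
qed

lemma step_pfs_init:
  assumes "L t = InPFS (PFSInit B s)"
  shows "sim K P T agg M (L(t := InPFS (PFSReadTop B s (popCountAtFreeze (batches M B) - s)))) h"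
proof -
  obtain pp where c: "pop_combining M G t B pp s" using thr[OF tT] assms by auto
  then have "popCountAtFreeze (batches M B) = pp"
    using retiredD(1)[of B] by (simp add: pop_combining_def)
  then show ?thesis using c assms by (intro local_step_same) auto
qed

lemma step_pfs_read_top:
  assumes "L t = InPFS (PFSReadTop B s m)"
  shows "sim K P T agg M (L(t := InPFS (PFSWalk B s m (stackTop M) (stackTop M) m))) h"
proof -
  have "\<exists>as. gchain M G (stackTop M) as" using global_okD(8)[OF glob] by (auto simp: stack_ok_def)
  then show ?thesis using thr[OF tT] assms by (intro local_step_same) auto
qed

lemma step_pfs_walk:
  assumes "L t = InPFS (PFSWalk B s m tp bt (Suc k))"
  shows
    "sim K P T agg M (L(t := InPFS (PFSWalk B s m tp (if bt \<noteq> None then next_of M bt else bt) k))) h"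
proof -
  have c: "\<exists>pp. pop_combining M G t B pp s \<and> m = pp - s" "Suc k \<le> m"
    "bt = follow (nodes M) tp (m - Suc k)" "\<exists>as. gchain M G tp as" using thr[OF tT] assms by auto
  have "follow (nodes M) tp (m - k) = follow (nodes M) tp (Suc (m - Suc k))" using c(2) by
    (simp add: Suc_diff_Suc)
  also have "\<dots> = (if bt \<noteq> None then next_of M bt else bt)"
    using c(3) by (auto simp: follow_Suc split: option.splits)
  finally show ?thesis using c assms by (intro local_step_same) auto
qed

lemma step_pfs_walk_done:
  assumes "L t = InPFS (PFSWalk B s m tp bt 0)"
  shows "sim K P T agg M (L(t := InPFS (PFSCas B s m tp bt))) h"
  using thr[OF tT] assms by (intro local_step_same) auto

lemma step_pfs_cas_failure:
  assumes "L t = InPFS (PFSCas B s m tp bt)"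
  shows "sim K P T agg M (L(t := InPFS (PFSReadTop B s m))) h"
  using thr[OF tT] assms by (intro local_step_same) auto

lemma step_gv_init:
  assumes "L t = InGV (GVInit B j)"
  shows "sim K P T agg M (L(t := InGV (GVWalk (subStackTop (batches M B)) j))) h"
proof -
  obtain pp pu i as where c: "isBatchApplied (batches M B)" "frozen G B = Some (pp, pu)" "pu < pp"
    "gchain M G (taken G B) as"
    "status G t = Done i Pop (res_at (nodes M) (follow (nodes M) (taken G B) j))"
    using thr[OF tT] assms by auto
  have "subStackTop (batches M B) = taken G B"
    using batch_ok.subStackTop[OF global_okD(6)[OF glob global_used(3)[OF glob c(2)]] c(2,3,1)] .
  then show ?thesis using c assms by (intro local_step_none) auto
qed

lemma step_gv_walk:
  assumes "L t = InGV (GVWalk q (Suc j))"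
  shows
    "sim K P T agg M (L(t := if q = None then Returning REmpty else InGV (GVWalk (next_of M q) j))) h"
proof -
  obtain i as where c: "gchain M G q as"
    "status G t = Done i Pop (res_at (nodes M) (follow (nodes M) q (Suc j)))"
    using thr[OF tT] assms by auto
  have "thread_ok (agg t) M G t (if q = None then Returning REmpty else InGV (GVWalk (next_of M q) j))"
    using c by (cases as) (auto simp: res_at_def)
  then show ?thesis using assms by (intro local_step_none) auto
qed

lemma step_gv_walk_done:
  assumes "L t = InGV (GVWalk q 0)"
  shows
    "sim K P T agg M (L(t := if q = None then Returning REmpty else Returning (RVal (value_of M q)))) h"
proof (rule local_step_none)
  show "thread_ok (agg t) M G t (if q = None then Returning REmpty else Returning (RVal (value_of M q)))"
    using thr[OF tT] assms by (auto simp: res_at_def)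
qed (use assms in simp)

lemma step_peek_read_value:
  assumes "L t = InPeek (PeekReadValue q)"
  shows "sim K P T agg M (L(t := Returning (RVal (value_of M q)))) h"
  using thr[OF tT] assms by (intro local_step_none) auto

lemma step_frz_read_pop:
  assumes "L t = InFreeze (FrzReadPop r B s)"
  shows "sim K P T agg M (L(t := InFreeze (FrzWritePop r B s (popCount (batches M B))))) h"
proof -
  have f: "freezing (agg t) M G t r B s" "frozen G B = None" using thr[OF tT] assms by auto
  have "B \<in> used G" using f(1) by (cases r) (auto simp: freezing_def announcing_def waiting_def)
  then have "popCount (batches M B) = length (pops G B)"
    using batch_ok.popCount global_okD(6)[OF glob] by blast
  then show ?thesis using f assms by (intro local_step_same) auto
qed

end

section \<open>Writes to one batch\<close>

lemma upd_batch_simps [simp]: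
  "nodes (upd_batch B f M) = nodes M"
  "node_alloc (upd_batch B f M) = node_alloc M"
  "batch_alloc (upd_batch B f M) = batch_alloc M"
  "agg_batch (upd_batch B f M) = agg_batch M"
  "stackTop (upd_batch B f M) = stackTop M"
  "batches (upd_batch B f M) B' = (if B' = B then f (batches M B) else batches M B')"
  by (simp_all add: upd_batch_def)

lemma upd_batch_invariants [simp]:
  "push_slot (upd_batch B f M) = push_slot M"
  "pop_slot (upd_batch B f M) = pop_slot M"
  "announcing A (upd_batch B f M) = announcing A M"
  "holds (upd_batch B f M) = holds M"
  "retired (upd_batch B f M) = retired M"
  "engaged (upd_batch B f M) = engaged M"
  "stack_ok (upd_batch B f M) = stack_ok M"
  by (simp_all add: fun_eq_iff push_slot_def pop_slot_def announcing_def holds_def retired_def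
      engaged_def stack_ok_def)

lemma ghost_cong:
  assumes "pushes G' = pushes G" "pops G' = pops G" "frozen G' = frozen G"
    "applied G' = applied G" "taken G' = taken G" "claim G' = claim G"
  shows "pub G' = pub G" "push_res G' = push_res G" "pop_res N G' = pop_res N G"
    "claims_ok G' = claims_ok G" "node_at G' = node_at G" "combiner G' = combiner G"
    "members G' = members G"
  by (simp_all add: assms fun_eq_iff pub_def push_res_def pop_res_def claims_ok_def node_at_def
      combiner_def members_def split: option.split)

lemma batch_ok_frame:
  assumes ok: "batch_ok P T agg M G B"
    and "batches M' B = batches M B" "agg_batch M' (owner G B) = agg_batch M (owner G B)"
    and "node_alloc M \<subseteq> node_alloc M'"
    and "\<And>a. a \<in> node_alloc M \<Longrightarrow> creator G' a = creator G a"
    and "\<And>a x. claim G a = Some x \<Longrightarrow> claim G' a = Some x"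
    and "\<And>q as. gchain M G q as \<Longrightarrow> gchain M' G' q as"
    and g: "pushes G' B = pushes G B" "pops G' B = pops G B" "owner G' B = owner G B"
      "freezer G' B = freezer G B" "frozen G' B = frozen G B" "applied G' B = applied G B"
      "taken G' B = taken G B"
  shows "batch_ok P T agg M' G' B"
proof -
  have n: "node_at G' B s = node_at G B s" for s using g by (simp add: node_at_def)
  have m: "members G' B = members G B" using g by (simp add: members_def)
  have al: "a \<in> node_alloc M \<Longrightarrow> a \<in> node_alloc M'" for a using assms(4) by blast
  show ?thesis
  proof (rule batch_ok.intro, goal_cases)
    \<comment> \<open>This is the field \<open>taken\<close>, the only one that depends on the
      contents of nodes.\<close>
    case (17 pp pu)
    then show ?case using batch_ok.taken[OF ok, of pp pu] assms(7) unfolding g by blast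
  qed (use batch_okD[OF ok] in \<open>simp_all add: n m g assms(2,3,5,6) al\<close>)
qed

context sec_state
begin

lemma used_ok: "B \<in> used G \<Longrightarrow> batch_ok P T agg M G B"
  using global_okD(6)[OF glob] .

lemma engaged_batch: "engaged M G B' u \<Longrightarrow> batch_of (L u) = Some B \<Longrightarrow> B = B'"
  using global_okD(9)[OF glob] by fastforce

text \<open>For steps that leave the pool of batches alone; the two that allocate and install a
  batch are treated separately.\<close>

lemma global_ok_frame:
  assumes "\<And>B. B \<in> used G \<Longrightarrow> batch_ok P T agg M' G' B"
    and "claims_ok G'" "stack_ok M' G' S'"
    and "\<And>B u. engaged M' G' B u \<Longrightarrow> u \<noteq> t \<Longrightarrow> engaged M G B u"
    and "\<And>B. engaged M' G' B t \<Longrightarrow> batch_of p' = Some B"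
    and "used G' = used G" "owner G' = owner G" "batch_alloc M' = batch_alloc M"
      "agg_batch M' = agg_batch M"
    and "\<And>B. B \<notin> used G \<Longrightarrow> batches M' B = batches M B \<and> pushes G' B = pushes G B \<and>
      pops G' B = pops G B \<and> freezer G' B = freezer G B \<and> frozen G' B = frozen G B \<and>
      applied G' B = applied G B"
  shows "global_ok K P T agg M' G' (L(t := p')) S'"
proof -
  have "unused_ok G' B" if "B \<notin> used G" for B
    using global_okD(5)[OF glob that] assms(10)[OF that] by (simp add: unused_ok_def)
  moreover have "batch_of ((L(t := p')) u) = Some B" if "engaged M' G' B u" for B u
    using assms(4,5)[of B] that global_okD(9)[OF glob] by (cases "u = t") auto
  ultimately show ?thesis
    using assms(1-3,6-10) global_okD(1-4)[OF glob] unfolding global_ok_def by simp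
qed

lemma batch_step:
  assumes B: "B \<in> used G"
    and ok: "batch_ok P T agg (upd_batch B f M) G B"
    and th: "thread_ok (agg t) (upd_batch B f M) G t p'"
    and b: "\<And>B. engaged M G B t \<Longrightarrow> batch_of p' = Some B"
    and comb: "combiner G B = Some t \<or> subStackTop (f (batches M B)) = subStackTop (batches M B) \<and>
      isBatchApplied (f (batches M B)) = isBatchApplied (batches M B)"
    and frz: "freezer G B = Some t \<or>
      popCountAtFreeze (f (batches M B)) = popCountAtFreeze (batches M B) \<and>
      pushCountAtFreeze (f (batches M B)) = pushCountAtFreeze (batches M B)"
    and cell: "\<And>s. s < length (pushes G B) \<Longrightarrow> cell M B s \<noteq> None \<Longrightarrow>
      eliminationArray (f (batches M B)) ! s = cell M B s"
    and ap: "isBatchApplied (batches M B) \<Longrightarrow> isBatchApplied (f (batches M B))"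
  shows "sim K P T agg (upd_batch B f M) (L(t := p')) h"
proof (rule step_intro[OF lin _ th])
  show "global_ok K P T agg (upd_batch B f M) G (L(t := p')) S"
  proof (rule global_ok_frame)
    show "batch_ok P T agg (upd_batch B f M) G B'" if "B' \<in> used G" for B'
    proof (cases "B' = B")
      case False
      then show ?thesis by (intro batch_ok_frame[OF used_ok[OF that]]) auto
    qed (use ok in simp)
  qed (use B b global_okD(7,8)[OF glob] in auto)
next
  fix u assume u: "u \<in> T" "u \<noteq> t"
  show "rely (agg u) u (L u) M G (upd_batch B f M) G"
    by (rule rely.intro) (use u global_not_applied[OF glob] comb frz cell ap in auto)
qed

lemma frz_slot_facts:
  assumes "freezing A M G t r B s"
  shows "B \<in> used G" "owner G B = A" "freezer G B = Some t" "agg_batch M A = B"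
  using assms by (cases r; auto simp: freezing_def announcing_def waiting_def)+

lemma freezing_upd_batch:
  assumes "\<And>s. eliminationArray (f (batches M B)) = eliminationArray (batches M B)"
  shows "freezing A (upd_batch B f M) G t r B s \<longleftrightarrow> freezing A M G t r B s"
  using assms by (cases r) (auto simp: freezing_def)

lemma step_frz_write_pop:
  assumes "L t = InFreeze (FrzWritePop r B s c)"
  shows "sim K P T agg (upd_batch B (popCountAtFreeze_update (\<lambda>_. c)) M)
    (L(t := InFreeze (FrzReadPush r B s))) h"
proof -
  have f: "freezing (agg t) M G t r B s" "frozen G B = None" "c \<le> length (pops G B)"
    using thr[OF tT] assms by auto
  note ff = frz_slot_facts[OF f(1)]
  show ?thesis
  proof (rule batch_step[OF ff(1)])
    show "batch_ok P T agg (upd_batch B (popCountAtFreeze_update (\<lambda>_. c)) M) G B"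
      by (rule batch_ok.intro) (use batch_okD[OF used_ok[OF ff(1)]] ff f in auto)
    show "thread_ok (agg t) (upd_batch B (popCountAtFreeze_update (\<lambda>_. c)) M) G t
        (InFreeze (FrzReadPush r B s))"
      using f by (simp add: freezing_upd_batch)
    show "batch_of (InFreeze (FrzReadPush r B s)) = Some B'" if "engaged M G B' t" for B'
      using engaged_batch[OF that] assms by simp
  qed (use ff in auto)
qed

lemma step_frz_write_push:
  assumes "L t = InFreeze (FrzWritePush r B s c)"
  shows "sim K P T agg (upd_batch B (pushCountAtFreeze_update (\<lambda>_. c)) M)
    (L(t := InFreeze (FrzAlloc r B s))) h"
proof -
  have f: "freezing (agg t) M G t r B s" "frozen G B = Some (popCountAtFreeze (batches M B), c)"
    using thr[OF tT] assms by auto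
  note ff = frz_slot_facts[OF f(1)]
  show ?thesis
  proof (rule batch_step[OF ff(1)])
    show "batch_ok P T agg (upd_batch B (pushCountAtFreeze_update (\<lambda>_. c)) M) G B"
      by (rule batch_ok.intro) (use batch_okD[OF used_ok[OF ff(1)]] ff f in auto)
    show "thread_ok (agg t) (upd_batch B (pushCountAtFreeze_update (\<lambda>_. c)) M) G t
        (InFreeze (FrzAlloc r B s))"
      using f by (simp add: freezing_upd_batch)
    show "batch_of (InFreeze (FrzAlloc r B s)) = Some B'" if "engaged M G B' t" for B'
      using engaged_batch[OF that] assms by simp
  qed (use ff in auto)
qed

lemma step_push_announce:
  assumes "L t = InPush (PushAnnounce n B s)"
  shows "sim K P T agg (upd_batch B (eliminationArray_update (\<lambda>E. E[s := n])) M)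
    (L(t := if s = 0 then InPush (PushTAS n B s) else InPush (PushSpin n B s))) h"
proof -
  obtain a where a: "n = Some a" "push_slot M G t a B s" "announcing (agg t) M G t n B s"
    using thr[OF tT] assms by (auto simp: announcing_def)
  note sf = slot_facts[OF a(2)]
  note len = batch_ok.length[OF sf(2)]
  have n: "n = Some (node_at G B s)" using a(1) sf(3) by simp
  show ?thesis
  proof (rule batch_step[OF sf(1)])
    show "batch_ok P T agg (upd_batch B (eliminationArray_update (\<lambda>E. E[s := n])) M) G B"
      by (rule batch_ok.intro) (use batch_okD[OF sf(2)] sf(6,9) n in \<open>auto simp: nth_list_update\<close>)
    show "thread_ok (agg t) (upd_batch B (eliminationArray_update (\<lambda>E. E[s := n])) M) G t
        (if s = 0 then InPush (PushTAS n B s) else InPush (PushSpin n B s))"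
      using a(3) sf(9) len by auto
    show "eliminationArray (eliminationArray_update (\<lambda>E. E[s := n]) (batches M B)) ! s' = cell M B s'"
      if "s' < length (pushes G B)" "cell M B s' \<noteq> None" for s'
      using that batch_ok.cell[OF sf(2) sf(6)] sf(9) len n by (cases "s' = s") auto
    show "batch_of (if s = 0 then InPush (PushTAS n B s) else InPush (PushSpin n B s)) = Some B'"
      if "engaged M G B' t" for B'
      using engaged_batch[OF that] assms by simp
  qed auto
qed

lemma step_push_set_applied:
  assumes "L t = InPush (PushSetApplied B)"
  shows
    "sim K P T agg (upd_batch B (isBatchApplied_update (\<lambda>_. True)) M) (L(t := Returning RTrue)) h"
proof -
  obtain a s pu where a: "push_slot M G t a B s" "frozen G B = Some (s, pu)" "s < pu"
    "applied G B" "retired M G B" using thr[OF tT] assms by auto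
  note sf = slot_facts[OF a(1)]
  have comb: "combiner G B = Some t" using a(2,3) sf(7) by (simp add: combiner_def)
  show ?thesis
  proof (rule batch_step[OF sf(1)])
    show "batch_ok P T agg (upd_batch B (isBatchApplied_update (\<lambda>_. True)) M) G B"
      by (rule batch_ok.intro) (use batch_okD[OF sf(2)] a in auto)
    show "thread_ok (agg t) (upd_batch B (isBatchApplied_update (\<lambda>_. True)) M) G t (Returning RTrue)"
      using a by (auto simp: push_slot_def push_res_def)
    show "batch_of (Returning RTrue) = Some B'" if "engaged M G B' t" for B'
      using not_engaged_push[OF a(1,5,2)] a(4) assms that by simp
  qed (use comb in auto)
qed

lemma step_pop_set_applied:
  assumes "L t = InPop (PopSetApplied B s)"
  shows "sim K P T agg (upd_batch B (isBatchApplied_update (\<lambda>_. True)) M)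
    (L(t := InPop (PopOffset B s))) h"
proof -
  obtain pp where a: "pop_slot M G t B s" "frozen G B = Some (pp, s)" "s < pp"
    "applied G B" "retired M G B" "subStackTop (batches M B) = taken G B"
    using thr[OF tT] assms by auto
  note sf = pop_slot_facts[OF a(1)]
  have comb: "combiner G B = Some t" using a(1-3) by (simp add: combiner_def pop_slot_def)
  show ?thesis
  proof (rule batch_step[OF sf(1)])
    show "batch_ok P T agg (upd_batch B (isBatchApplied_update (\<lambda>_. True)) M) G B"
      by (rule batch_ok.intro) (use batch_okD[OF sf(2)] a in auto)
    show "thread_ok (agg t) (upd_batch B (isBatchApplied_update (\<lambda>_. True)) M) G t
        (InPop (PopOffset B s))"
      using a by auto
    show "batch_of (InPop (PopOffset B s)) = Some B'" if "engaged M G B' t" for B'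
      using engaged_batch[OF that] assms by simp
  qed (use comb in auto)
qed

lemma step_pfs_store:
  assumes "L t = InPFS (PFSStore B s tp)"
  shows "sim K P T agg (upd_batch B (subStackTop_update (\<lambda>_. tp)) M)
    (L(t := InPop (PopSetApplied B s))) h"
proof -
  obtain pp where a: "pop_slot M G t B s" "frozen G B = Some (pp, s)" "s < pp"
    "applied G B" "retired M G B" "taken G B = tp" "\<not> isBatchApplied (batches M B)"
    using thr[OF tT] assms by auto
  note sf = pop_slot_facts[OF a(1)]
  have comb: "combiner G B = Some t" using a(1-3) by (simp add: combiner_def pop_slot_def)
  show ?thesis
  proof (rule batch_step[OF sf(1)])
    show "batch_ok P T agg (upd_batch B (subStackTop_update (\<lambda>_. tp)) M) G B"
      by (rule batch_ok.intro) (use batch_okD[OF sf(2)] a in auto)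
    show "thread_ok (agg t) (upd_batch B (subStackTop_update (\<lambda>_. tp)) M) G t
        (InPop (PopSetApplied B s))"
      using a by auto
    show "batch_of (InPop (PopSetApplied B s)) = Some B'" if "engaged M G B' t" for B'
      using engaged_batch[OF that] assms by simp
  qed (use comb in auto)
qed

lemma step_tas_decided:
  assumes d: "isFreezerDecided (batches M B)" and B: "B \<in> used G"
    and th: "thread_ok (agg t) (upd_batch B (isFreezerDecided_update (\<lambda>_. True)) M) G t p'"
    and b: "batch_of p' = batch_of (L t)"
  shows "sim K P T agg (upd_batch B (isFreezerDecided_update (\<lambda>_. True)) M) (L(t := p')) h"
proof (rule batch_step[OF B _ th])
  show "batch_ok P T agg (upd_batch B (isFreezerDecided_update (\<lambda>_. True)) M) G B"
    by (rule batch_ok.intro) (use batch_okD[OF used_ok[OF B]] d in auto)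
qed (use global_okD(9)[OF glob] b in simp_all)

lemma step_tas_freeze:
  assumes d: "\<not> isFreezerDecided (batches M B)" and fs: "frz_slot (agg t) M G t r B s"
    and b: "batch_of (L t) = Some B"
  shows "sim K P T agg (upd_batch B (isFreezerDecided_update (\<lambda>_. True)) M)
    (L(t := InFreeze (FrzReadPop r B s))) h"
proof -
  let ?M = "upd_batch B (isFreezerDecided_update (\<lambda>_. True)) M"
  let ?G = "G\<lparr>freezer := (freezer G)(B := Some t)\<rparr>"
  have B: "B \<in> used G" "owner G B = agg t"
    using fs by (cases r; auto simp: announcing_def waiting_def)+
  note ok = used_ok[OF B(1)]
  \<comment> \<open>The T&S bit mirrors the ghost freezer, so the winner finds the batch unfrozen
    and still current.\<close>
  have f: "freezer G B = None" using batch_ok.decided[OF ok] d by simp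
  note fr = batch_ok.not_frozen[OF ok f] batch_ok.current[OF ok f]
  note [simp] = ghost_cong[of ?G G, simplified]
  have [simp]: "retired x ?G = retired x G" for x by (simp add: fun_eq_iff retired_def)
  have [simp]: "engaged x ?G = engaged x G" "stack_ok x ?G = stack_ok x G"
    "push_slot x ?G = push_slot x G" "pop_slot x ?G = pop_slot x G" "waiting A ?G = waiting A G"
    "announcing A x ?G = announcing A x G" for x A
    by (simp_all add: fun_eq_iff engaged_def stack_ok_def push_slot_def pop_slot_def waiting_def
        announcing_def)
  show ?thesis
  proof (rule step_intro[of ?G])
    show "lin_at (status ?G) h S" using lin by simp
    show "global_ok K P T agg ?M ?G (L(t := InFreeze (FrzReadPop r B s))) S"
    proof (rule global_ok_frame)
      show "batch_ok P T agg ?M ?G B'" if "B' \<in> used G" for B'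
      proof (cases "B' = B")
        case True
        show ?thesis unfolding True by (rule batch_ok.intro) (use batch_okD[OF ok] f in auto)
      next
        case False
        then show ?thesis by (intro batch_ok_frame[OF used_ok[OF that]]) auto
      qed
      show "batch_of (InFreeze (FrzReadPop r B s)) = Some B'" if "engaged ?M ?G B' t" for B'
        using engaged_batch[of B' t] that b by simp
    qed (use B global_okD(7,8)[OF glob] in auto)
    show "thread_ok (agg t) ?M ?G t (InFreeze (FrzReadPop r B s))"
      using fs B fr by (cases r) (auto simp: freezing_def)
    show "rely (agg u) u (L u) M G ?M ?G" if "u \<in> T" "u \<noteq> t" for u
      by (rule rely.intro) (use global_not_applied[OF glob] f in auto)
  qed
qed

lemma step_push_tas:
  assumes "L t = InPush (PushTAS n B s)"
  shows "sim K P T agg (upd_batch B (isFreezerDecided_update (\<lambda>_. True)) M)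
    (L(t := if isFreezerDecided (batches M B) then InPush (PushSpin n B s)
        else InFreeze (FrzReadPop (Pusher n) B s))) h"
proof -
  have a: "announcing (agg t) M G t n B s" "cell M B s = n" using thr[OF tT] assms by auto
  then have B: "B \<in> used G" by (simp add: announcing_def waiting_def)
  show ?thesis
  proof (cases "isFreezerDecided (batches M B)")
    case True
    show ?thesis using step_tas_decided[OF True B, of "InPush (PushSpin n B s)"] a assms True by
      simp
  next
    case False
    show ?thesis using step_tas_freeze[OF False, of "Pusher n" s] a assms False by simp
  qed
qed

lemma step_pop_tas:
  assumes "L t = InPop (PopTAS B s)"
  shows "sim K P T agg (upd_batch B (isFreezerDecided_update (\<lambda>_. True)) M)
    (L(t := if isFreezerDecided (batches M B) then InPop (PopSpin B s)
        else InFreeze (FrzReadPop Popper B s))) h"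
proof -
  have a: "pop_slot M G t B s" "waiting (agg t) G t B" using thr[OF tT] assms by auto
  then have B: "B \<in> used G" by (simp add: waiting_def)
  show ?thesis
  proof (cases "isFreezerDecided (batches M B)")
    case True
    show ?thesis using step_tas_decided[OF True B, of "InPop (PopSpin B s)"] a assms True by simp
  next
    case False
    show ?thesis using step_tas_freeze[OF False, of Popper s] a assms False by simp
  qed
qed

section \<open>Taking a slot\<close>

lemma combiner_member:
  assumes "combiner G B = Some u"
  shows "u \<in> members G B"
proof -
  obtain pp pu where f: "frozen G B = Some (pp, pu)"
    using assms by (auto simp: combiner_def split: option.splits)
  note ok = used_ok[OF global_used(3)[OF glob f]]
  show ?thesis
    using assms f batch_ok.pops_le[OF ok f] batch_ok.pushes_le[OF ok f]
    by (auto simp: combiner_def members_def split: if_splits)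
qed

text \<open>The bound is strict because the joining thread is counted together with the pushers
  already present.\<close>

lemma joinable_length:
  assumes "joinable (agg t) G t B"
  shows "length (pushes G B) < P"
proof -
  have B: "B \<in> used G" "t \<notin> members G B" "owner G B = agg t" using assms by
    (auto simp: joinable_def)
  note ok = used_ok[OF B(1)]
  let ?M = "fst ` set (pushes G B)"
  have "card (insert t ?M) \<le> card {u \<in> T. agg u = agg t}"
    using fin batch_ok.members[OF ok] B(3) tT by (intro card_mono) (auto simp: members_def)
  moreover have "t \<notin> ?M" using B(2) by (simp add: members_def)
  moreover have "card ?M = length (pushes G B)"
    using batch_ok.distinct[OF ok] distinct_card[of "map fst (pushes G B)"] by simp
  ultimately show ?thesis using card_P[OF agg_K[OF tT]] by simp
qed

lemma batch_frozen:
  assumes "frozen G B = Some (pp, pu)"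
  shows "B \<in> used G" "pp \<le> length (pops G B)" "pu \<le> length (pushes G B)"
  using global_used(3)[OF glob assms]
    batch_ok.pops_le[OF used_ok[OF global_used(3)[OF glob assms]] assms]
    batch_ok.pushes_le[OF used_ok[OF global_used(3)[OF glob assms]] assms]
  by auto

lemma step_push_count:
  assumes "L t = InPush (PushCount n B)"
  shows "sim K P T agg (upd_batch B (pushCount_update Suc) M)
    (L(t := InPush (PushAnnounce n B (pushCount (batches M B))))) h"
proof -
  obtain a i where a: "n = Some a" "a \<in> node_alloc M" "creator G a = t" "claim G a = None"
    "status G t = Pending i (Push (value (nodes M a)))" and j: "joinable (agg t) G t B"
    using thr[OF tT] assms by (auto simp: holds_def)
  have B: "B \<in> used G" "owner G B = agg t" "t \<notin> members G B" using j by (auto simp: joinable_def)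
  note ok = used_ok[OF B(1)]
  let ?M = "upd_batch B (pushCount_update Suc) M"
  let ?G = "G\<lparr>pushes := (pushes G)(B := pushes G B @ [(t, a)])\<rparr>"
  have nth: "pushes ?G B' ! s = pushes G B' ! s" if "s < length (pushes G B')" for B' s
    using that by (auto simp: nth_append)
  have frz_nth: "pushes ?G B' ! s = pushes G B' ! s" if "frozen G B' = Some (pp, pu)" "s < pu" for
    B' s pp pu
    using batch_frozen(3)[OF that(1)] that(2) by (intro nth) simp
  have node: "node_at ?G B' s = node_at G B' s" if "s < length (pushes G B')" for B' s
    using nth[OF that] by (simp add: node_at_def)
  have frz_node: "node_at ?G B' s = node_at G B' s" if "frozen G B' = Some (pp, pu)" "s < pu" for
    B' s pp pu
    using frz_nth[OF that] by (simp add: node_at_def)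
  have mem: "members ?G B' = (if B' = B then insert t (members G B) else members G B')" for B'
    by (auto simp: members_def)
  have [simp]: "pub ?G = pub G" "push_res ?G = push_res G" "retired x ?G = retired x G" for x
    by (simp_all add: fun_eq_iff pub_def push_res_def retired_def split: option.split)
  have comb: "combiner ?G B' = combiner G B'" for B'
    using frz_nth[of B'] by (cases "frozen G B'") (auto simp: combiner_def)
  have pres: "pop_res N ?G B' s = pop_res N G B' s" for N B' s
    using frz_node[of B'] by (cases "frozen G B'") (auto simp: pop_res_def)
  have eng: "engaged M G B' u \<or> B' = B \<and> u = t" if "engaged M ?G B' u" for B' u
    using that frz_nth[of B'] mem[of B'] unfolding engaged_def by (fastforce split: if_splits)
  show ?thesis
  proof (rule step_intro[of ?G])
    show "lin_at (status ?G) h S" using lin by simp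
    show "global_ok K P T agg ?M ?G (L(t := InPush (PushAnnounce n B (pushCount (batches M B))))) S"
    proof (rule global_ok_frame)
      show "batch_ok P T agg ?M ?G B'" if "B' \<in> used G" for B'
      proof (cases "B' = B")
        case True
        note d = batch_okD[OF ok]
        show ?thesis unfolding True
        proof (rule batch_ok.intro, goal_cases)
          case 4 show ?case using d(4) B(3) by (auto simp: members_def)
        next
          case (5 u) then show ?case using d(5)[of u] mem[of B] B(2) tT by auto
        next
          case (6 s) then show ?case using d(6)[of s] a(2) node[of s B]
            by (cases "s = length (pushes G B)") (auto simp: node_at_def)
        next
          case (7 s) then show ?case using d(7)[of s] a(3) node[of s B] nth[of s B]
            by (cases "s = length (pushes G B)") (auto simp: node_at_def)
        next
          \<comment> \<open>The new cell is empty by \<open>cell_none\<close>, which applies because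
            the index is below \<open>P\<close>.\<close>
          case (8 s) then show ?case using d(8)[of s] d(20)[of s] joinable_length[OF j] node[of s B]
            by (cases "s = length (pushes G B)") auto
        next
          case (15 pp pu) then show ?case using d(15)[of pp pu] by simp
        next
          case (16 pp pu s) then show ?case using d(16)[of pp pu s] frz_node[of B pp pu s] by simp
        qed (use d in simp_all)
      next
        case False
        then show ?thesis by (intro batch_ok_frame[OF used_ok[OF that]]) auto
      qed
      show "claims_ok ?G"
        using global_okD(7)[OF glob] frz_node unfolding claims_ok_def by fastforce
      show "stack_ok ?M ?G S" using global_okD(8)[OF glob] by (simp add: stack_ok_def)
      show "engaged M G B' u" if "engaged ?M ?G B' u" "u \<noteq> t" for B' u
        using that eng[of B' u] by simp
      show "batch_of (InPush (PushAnnounce n B (pushCount (batches M B)))) = Some B'"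
        if "engaged ?M ?G B' t" for B'
        using that eng[of B' t] global_okD(9)[OF glob, of B' t] assms by auto
    qed (use B(1) in auto)
    have len: "pushCount (batches M B) = length (pushes G B)" using batch_ok.pushCount[OF ok] .
    have "push_res G B (length (pushes G B)) = None"
      using batch_frozen(3)[of B] by (cases "frozen G B") (auto simp: push_res_def)
    \<comment> \<open>A late joiner may find the batch frozen and even applied. Not having been a
      member, it is not the combiner, so \<open>waiting\<close> holds nevertheless.\<close>
    moreover have "combiner G B \<noteq> Some t" using combiner_member B(3) by blast
    ultimately show
      "thread_ok (agg t) ?M ?G t (InPush (PushAnnounce n B (pushCount (batches M B))))"
      using a B len comb by (auto simp: announcing_def push_slot_def waiting_def)
    show "rely (agg u) u (L u) M G ?M ?G" if u: "u \<in> T" "u \<noteq> t" for u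
    proof (rule rely.intro, goal_cases)
      case (2 B' s a' i) then show ?case by simp
    next
      case (3 B' s i) then show ?case by (simp add: pres)
    next
      case (19 B') then show ?case using node by auto
    qed (use u global_not_applied[OF glob] in auto)
  qed
qed

lemma step_pop_count:
  assumes "L t = InPop (PopCount B)"
  shows "sim K P T agg (upd_batch B (popCount_update Suc) M)
    (L(t := if popCount (batches M B) = 0 then InPop (PopTAS B (popCount (batches M B)))
        else InPop (PopSpin B (popCount (batches M B))))) h"
    (is "sim _ _ _ _ _ (L(t := ?p)) _")
proof -
  obtain i where a: "status G t = Pending i Pop" and j: "joinable (agg t) G t B"
    using thr[OF tT] assms by auto
  have B: "B \<in> used G" "owner G B = agg t" "t \<notin> members G B" using j by (auto simp: joinable_def)
  note ok = used_ok[OF B(1)]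
  let ?M = "upd_batch B (popCount_update Suc) M"
  let ?G = "G\<lparr>pops := (pops G)(B := pops G B @ [t])\<rparr>"
  have frz_nth: "pops ?G B' ! s = pops G B' ! s" if "frozen G B' = Some (pp, pu)" "s < pp" for B'
    s pp pu
    using batch_frozen(2)[OF that(1)] that(2) by (auto simp: nth_append)
  have mem: "members ?G B' = (if B' = B then insert t (members G B) else members G B')" for B'
    by (auto simp: members_def)
  have [simp]: "pub ?G = pub G" "push_res ?G = push_res G" "pop_res N ?G = pop_res N G"
    "retired x ?G = retired x G" "claims_ok ?G = claims_ok G" "node_at ?G = node_at G" for x N
    by (simp_all add: fun_eq_iff pub_def push_res_def pop_res_def retired_def claims_ok_def node_at_def
        split: option.split)
  have comb: "combiner ?G B' = combiner G B'" for B'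
    using frz_nth[of B'] by (cases "frozen G B'") (auto simp: combiner_def)
  have eng: "engaged M G B' u \<or> B' = B \<and> u = t" if "engaged M ?G B' u" for B' u
    using that frz_nth[of B'] mem[of B'] unfolding engaged_def by (fastforce split: if_splits)
  show ?thesis
  proof (rule step_intro[of ?G])
    show "lin_at (status ?G) h S" using lin by simp
    show "global_ok K P T agg ?M ?G (L(t := ?p)) S"
    proof (rule global_ok_frame)
      show "batch_ok P T agg ?M ?G B'" if "B' \<in> used G" for B'
      proof (cases "B' = B")
        case True
        note d = batch_okD[OF ok]
        show ?thesis unfolding True
        proof (rule batch_ok.intro, goal_cases)
          case 4 show ?case using d(4) B(3) by (auto simp: members_def)
        next
          case (5 u) then show ?case using d(5)[of u] mem[of B] B(2) tT by auto
        next
          case (14 pp pu) then show ?case using d(14)[of pp pu] by simp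
        qed (use d in simp_all)
      next
        case False
        then show ?thesis by (intro batch_ok_frame[OF used_ok[OF that]]) auto
      qed
      show "claims_ok ?G" using global_okD(7)[OF glob] by simp
      show "stack_ok ?M ?G S" using global_okD(8)[OF glob] by (simp add: stack_ok_def)
      show "engaged M G B' u" if "engaged ?M ?G B' u" "u \<noteq> t" for B' u
        using that eng[of B' u] by simp
      show "batch_of ?p = Some B'" if "engaged ?M ?G B' t" for B'
        using that eng[of B' t] global_okD(9)[OF glob, of B' t] assms by auto
    qed (use B(1) in auto)
    have len: "popCount (batches M B) = length (pops G B)" using batch_ok.popCount[OF ok] .
    have "pop_res (nodes M) G B (length (pops G B)) = None"
      using batch_frozen(2)[of B] by (cases "frozen G B") (auto simp: pop_res_def)
    moreover have "combiner G B \<noteq> Some t" using combiner_member B(3) by blast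
    ultimately have ok': "pop_slot ?M ?G t B (length (pops G B))" "waiting (agg t) ?G t B"
      using a B comb by (simp_all add: pop_slot_def waiting_def)
    have "?p = InPop (PopTAS B (length (pops G B))) \<or> ?p = InPop (PopSpin B (length (pops G B)))"
      using len by auto
    then show "thread_ok (agg t) ?M ?G t ?p"
    proof
      assume p: "?p = InPop (PopTAS B (length (pops G B)))"
      show ?thesis unfolding p thread_ok.simps pop_ok.simps using ok' by blast
    next
      assume p: "?p = InPop (PopSpin B (length (pops G B)))"
      show ?thesis unfolding p thread_ok.simps pop_ok.simps using ok' by blast
    qed
    show "rely (agg u) u (L u) M G ?M ?G" if u: "u \<in> T" "u \<noteq> t" for u
    proof (rule rely.intro, goal_cases)
      case (3 B' s i) then show ?case by simp
    qed (use u global_not_applied[OF glob] in auto)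
  qed
qed

section \<open>Replacing a batch\<close>

lemma step_frz_alloc:
  assumes "L t = InFreeze (FrzAlloc r B s)" and B': "B' \<notin> batch_alloc M"
  shows "sim K P T agg
    (M\<lparr>batch_alloc := insert B' (batch_alloc M), batches := (batches M)(B' := fresh_batch P)\<rparr>)
    (L(t := InFreeze (FrzInstall r B s B'))) h"
    (is "sim _ _ _ _ ?M _ _")
proof -
  have f: "freezing (agg t) M G t r B s"
    "frozen G B = Some (popCountAtFreeze (batches M B), pushCountAtFreeze (batches M B))"
    using thr[OF tT] assms by auto
  note ff = frz_slot_facts[OF f(1)]
  \<comment> \<open>The owner is recorded at allocation, although the batch enters
    \<open>used\<close> only at its installation; in between, the condition \<open>not_used\<close>
    of \<open>rely\<close> reserves it for the freezer.\<close>
  let ?G = "G\<lparr>owner := (owner G)(B' := agg t)\<rparr>"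
  have nu: "B' \<notin> used G" using B' global_okD(1)[OF glob] by blast
  have [simp]: "B \<noteq> B'" using ff(1) nu by blast
  have ret: "retired ?M ?G B1 = retired M G B1" for B1 using nu by (auto simp: retired_def)
  note [simp] = ghost_cong[of ?G G, simplified]
  have eng: "engaged ?M ?G B1 u = engaged M G B1 u" for B1 u
    by (simp add: engaged_def ret)
  show ?thesis
  proof (rule step_intro[of ?G])
    show "lin_at (status ?G) h S" using lin by simp
    have "batch_ok P T agg ?M ?G B1" if "B1 \<in> used G" for B1
      using that nu by (intro batch_ok_frame[OF used_ok[OF that]]) auto
    moreover have "unused_ok ?G B1" if "B1 \<notin> used G" for B1
      using global_okD(5)[OF glob that] by (auto simp: unused_ok_def)
    moreover have "claims_ok ?G" using global_okD(7)[OF glob] by simp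
    moreover have "stack_ok ?M ?G S" using global_okD(8)[OF glob] by (simp add: stack_ok_def)
    moreover have "batch_of ((L(t := InFreeze (FrzInstall r B s B'))) u) = Some B1"
      if "engaged ?M ?G B1 u" for B1 u
      using that eng[of B1 u] global_okD(9)[OF glob, of B1 u] assms by auto
    moreover have "agg_batch M A \<noteq> B'" if "A < K" for A
      using global_okD(2)[OF glob that] nu by blast
    ultimately show "global_ok K P T agg ?M ?G (L(t := InFreeze (FrzInstall r B s B'))) S"
      using global_okD(1-4)[OF glob] unfolding global_ok_def by auto
    have "freezing (agg t) ?M ?G t r B s"
      using f(1) by (cases r)
        (auto simp: freezing_def announcing_def push_slot_def pop_slot_def waiting_def)
    then show "thread_ok (agg t) ?M ?G t (InFreeze (FrzInstall r B s B'))"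
      using f(2) nu by simp
    show "rely (agg u) u (L u) M G ?M ?G" if u: "u \<in> T" "u \<noteq> t" for u
    proof (rule rely.intro, goal_cases)
      case (13 B1) then show ?case using B' by auto
    next
      case (19 B1) 
      then have "B1 \<in> used G" using combiner_member global_used(5)[OF glob] by blast
      then show ?case using nu by auto
    next
      case (20 B1)
      then have "B1 \<in> used G" using global_used(4)[OF glob] by blast
      then show ?case using 20 nu by auto
    next
      case (23 B1) then show ?case by (simp add: ret)
    next
      case (24 B1 s1) then show ?case using nu by auto
    next
      case (25 B1) then show ?case using nu by auto
    qed (use u global_not_applied[OF glob] in auto)
  qed
qed

lemma after_freeze_batch [simp]: "batch_of (after_freeze r B s) = Some B"
  by (cases r) auto

text \<open>Replacing the pointer retires \<open>B\<close> and activates the blank batch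
  \<open>B'\<close>, so engagement can only shrink. Older batches of the aggregator stay retired
  because \<open>B'\<close> was not in \<open>used\<close> before.\<close>

lemma step_frz_install:
  assumes "L t = InFreeze (FrzInstall r B s B')"
  shows "sim K P T agg (M\<lparr>agg_batch := (agg_batch M)(agg t := B')\<rparr>) (L(t := after_freeze r B s)) h"
    (is "sim _ _ _ _ ?M _ _")
proof -
  have f: "freezing (agg t) M G t r B s"
    "frozen G B = Some (popCountAtFreeze (batches M B), pushCountAtFreeze (batches M B))"
    "B' \<in> batch_alloc M" "B' \<notin> used G" "owner G B' = agg t"
    using thr[OF tT] assms by auto
  note ff = frz_slot_facts[OF f(1)]
  let ?G = "G\<lparr>used := insert B' (used G)\<rparr>"
  note [simp] = ghost_cong[of ?G G, simplified]
  have un: "pushes G B' = []" "pops G B' = []" "freezer G B' = None" "frozen G B' = None"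
    "\<not> applied G B'"
    using global_okD(5)[OF glob f(4)] by (auto simp: unused_ok_def)
  have fresh: "batches M B' = fresh_batch P" using global_okD(4)[OF glob f(3,4)] .
  have ret: "retired ?M ?G B1" if "retired M G B1" for B1
    using that f(4) by (auto simp: retired_def)
  have retB: "retired ?M ?G B" using ff(1,2) f(4) by (auto simp: retired_def)
  have eng: "engaged M G B1 u" if "engaged ?M ?G B1 u" for B1 u
    using that ret[of B1] unfolding engaged_def by auto
  have cur: "B1 = B" if "B1 \<in> used G" "owner G B1 = agg t" "\<not> retired M G B1" for B1
    using that ff(4) by (auto simp: retired_def)
  show ?thesis
  proof (rule step_intro[of ?G])
    show "lin_at (status ?G) h S" using lin by simp
    have "batch_ok P T agg ?M ?G B1" if B1: "B1 \<in> used G" for B1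
    proof (cases "owner G B1 = agg t")
      case False
      then show ?thesis by (intro batch_ok_frame[OF used_ok[OF B1]]) auto
    next
      case True
      have fz: "freezer G B1 \<noteq> None"
      proof (cases "retired M G B1")
        case True
        then show ?thesis using batch_ok.current[OF used_ok[OF B1]] by (auto simp: retired_def)
      qed (use cur[OF B1 True] ff(3) in simp)
      have fr:
        "frozen G B1 = Some (popCountAtFreeze (batches M B1), pushCountAtFreeze (batches M B1))"
      proof (cases "retired M G B1")
        case True
        then show ?thesis using retiredD(1) by blast
      qed (use cur[OF B1 True] f(2) in simp)
      show ?thesis
        by (rule batch_ok.intro) (use batch_okD[OF used_ok[OF B1]] fz fr in simp_all)
    qed
    moreover have "batch_ok P T agg ?M ?G B'"
      by (rule batch_ok.intro) (use un fresh f(5) in \<open>auto simp: fresh_batch_def members_def\<close>)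
    moreover have "unused_ok ?G B1" if "B1 \<notin> used ?G" for B1
      using global_okD(5)[OF glob, of B1] that by (auto simp: unused_ok_def)
    moreover have "claims_ok ?G" using global_okD(7)[OF glob] by simp
    moreover have "stack_ok ?M ?G S" using global_okD(8)[OF glob] by (simp add: stack_ok_def)
    moreover have "batch_of ((L(t := after_freeze r B s)) u) = Some B1"
      if "engaged ?M ?G B1 u" for B1 u
      using global_okD(9)[OF glob eng[OF that]] assms by auto
    ultimately show "global_ok K P T agg ?M ?G (L(t := after_freeze r B s)) S"
      using global_okD(1-4)[OF glob] f(3,5) unfolding global_ok_def by auto
    show "thread_ok (agg t) ?M ?G t (after_freeze r B s)"
      using f(1) retB
      by (cases r) (auto simp: freezing_def announcing_def push_slot_def pop_slot_def waiting_def)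
    show "rely (agg u) u (L u) M G ?M ?G" if u: "u \<in> T" "u \<noteq> t" for u
    proof (rule rely.intro, goal_cases)
      case 21 then show ?case using u ff(3,4) by auto
    next
      case (22 B1) then show ?case using u ff(3,4) f(5) by auto
    next
      case (23 B1) then show ?case using ret by simp
    qed (use u global_not_applied[OF glob] in auto)
  qed
qed

section \<open>Allocation and linking of nodes\<close>

lemma pub_alloc:
  assumes "a \<in> pub G"
  shows "a \<in> node_alloc M"
proof -
  obtain B s where "claim G a = Some (B, s)" using assms by (auto simp: pub_def)
  then obtain pp pu where c: "frozen G B = Some (pp, pu)" "s < pu" "node_at G B s = a"
    using global_okD(7)[OF glob] unfolding claims_ok_def by blast
  note bf = batch_frozen[OF c(1)]
  show ?thesis using batch_ok.node_alloc[OF used_ok[OF bf(1)], of s] bf(3) c by simp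
qed

lemma claim_alloc:
  assumes "claim G a = Some (B, s)"
  shows "a \<in> node_alloc M"
proof -
  obtain pp pu where c: "frozen G B = Some (pp, pu)" "s < pu" "node_at G B s = a"
    using global_okD(7)[OF glob] assms unfolding claims_ok_def by blast
  note bf = batch_frozen[OF c(1)]
  show ?thesis using batch_ok.node_alloc[OF used_ok[OF bf(1)], of s] bf(3) c by simp
qed

text \<open>What a write to a node has to respect: recorded results read only the values of
  allocated nodes and the links of published ones.\<close>

lemma pop_res_cong:
  assumes "\<And>a. a \<in> node_alloc M \<Longrightarrow> value (N a) = value (nodes M a)"
    and "\<And>a. a \<in> pub G \<Longrightarrow> N a = nodes M a"
  shows "pop_res N G B s = pop_res (nodes M) G B s"
proof (cases "frozen G B")
  case None
  then show ?thesis by (simp add: pop_res_def)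
next
  case (Some x)
  obtain pp pu where f: "frozen G B = Some (pp, pu)" using Some by (cases x) auto
  note bf = batch_frozen[OF f]
  have "value (N (node_at G B s)) = value (nodes M (node_at G B s))" if "s < pu"
    using assms(1) batch_ok.node_alloc[OF used_ok[OF bf(1)], of s] bf(3) that by simp
  moreover have
    "res_at N (follow N (taken G B) k) = res_at (nodes M) (follow (nodes M) (taken G B) k)"
    if ap: "pu < pp" "applied G B" for k
  proof -
    obtain as where "gchain M G (taken G B) as"
      using batch_ok.taken[OF used_ok[OF bf(1)] f ap] by blast
    then show ?thesis by (rule chain_res_at_cong) (use assms(2) in simp)
  qed
  ultimately show ?thesis using f by (auto simp: pop_res_def)
qed

lemma stack_ok_frame:
  assumes "stack_ok M G S" "stackTop M' = stackTop M"
    and "\<And>a. a \<in> pub G \<Longrightarrow> nodes M' a = nodes M a"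
  shows "stack_ok M' G S"
proof -
  have c: "gchain M' G q as" if "gchain M G q as" for q as
    using chain_mono[OF that] assms(3) by blast
  obtain as where as: "gchain M G (stackTop M) as" "S = map (\<lambda>a. value (nodes M a)) as"
    using assms(1) by (auto simp: stack_ok_def)
  have "map (\<lambda>a. value (nodes M' a)) as = S"
    using chain_set[OF as(1)] assms(3) unfolding as(2) by (intro map_cong) auto
  then show ?thesis using c as(1) assms(1,2) unfolding stack_ok_def by metis
qed

lemma step_push_alloc:
  assumes "L t = InPush (PushAlloc v)" and a: "a \<notin> node_alloc M"
  shows "sim K P T agg
    (M\<lparr>node_alloc := insert a (node_alloc M), nodes := (nodes M)(a := \<lparr>value = v, next = None\<rparr>)\<rparr>)
    (L(t := InPush (PushGetBatch (Some a)))) h"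
    (is "sim _ _ _ _ ?M _ _")
proof -
  obtain i where i: "status G t = Pending i (Push v)" using thr[OF tT] assms by auto
  let ?G = "G\<lparr>creator := (creator G)(a := t)\<rparr>"
  have na: "a' \<noteq> a" if "a' \<in> node_alloc M" for a' using that a by blast
  have np: "a' \<noteq> a" if "a' \<in> pub G" for a' using na pub_alloc that by blast
  have cl: "claim G a = None" using claim_alloc[of a] a by (cases "claim G a") auto
  note [simp] = ghost_cong[of ?G G, simplified]
  have [simp]: "retired ?M ?G = retired M G" by (simp add: fun_eq_iff retired_def)
  have eng: "engaged ?M ?G = engaged M G" by (simp add: fun_eq_iff engaged_def)
  have ch: "gchain ?M G q as" if "gchain M G q as" for q as
    using chain_mono[OF that] np by simp
  have pres: "pop_res (nodes ?M) G B s = pop_res (nodes M) G B s" for B s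
    by (rule pop_res_cong) (use na np in auto)
  show ?thesis
  proof (rule step_intro[of ?G])
    show "lin_at (status ?G) h S" using lin by simp
    have "stack_ok ?M G S"
      by (rule stack_ok_frame[OF global_okD(8)[OF glob]]) (use np in auto)
    then have stk: "stack_ok ?M ?G S" by (simp add: stack_ok_def)
    show "global_ok K P T agg ?M ?G (L(t := InPush (PushGetBatch (Some a)))) S"
    proof (rule global_ok_frame)
      show "batch_ok P T agg ?M ?G B" if "B \<in> used G" for B
        by (rule batch_ok_frame[OF used_ok[OF that]]) (use ch na in auto)
      show "batch_of (InPush (PushGetBatch (Some a))) = Some B" if "engaged ?M ?G B t" for B
        using global_okD(9)[OF glob, of B t] that assms by (auto simp: eng)
    qed (use stk global_okD(7)[OF glob] eng in auto)
    show "thread_ok (agg t) ?M ?G t (InPush (PushGetBatch (Some a)))"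
      using i cl by (simp add: holds_def)
    show "rely (agg u) u (L u) M G ?M ?G" if u: "u \<in> T" "u \<noteq> t" for u
    proof (rule rely.intro, goal_cases)
      case (3 B s i) then show ?case using pres by simp
    next
      case (7 a') then show ?case using np by simp
    next
      case (19 B)
      have "node_at G B s \<noteq> a" if "claim G (node_at G B s) = Some (B, s)" for s
        using claim_alloc[OF that] a by blast
      then show ?case by simp
    qed (use u na global_not_applied[OF glob] in auto)
  qed
qed

text \<open>The node is claimed by \<open>B\<close> and \<open>B\<close> is not yet applied, so it
  is not published and no list in the stack runs through it. Claims being unique, it belongs to no
  other combiner either.\<close>

lemma set_next_step:
  assumes c: "push_combining M G t B pp pu" and s: "pp \<le> s" "s < pu"
    and th: "thread_ok (agg t) (set_next (Some (node_at G B s)) q M) G t p'"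
    and b: "batch_of p' = batch_of (L t)"
  shows "sim K P T agg (set_next (Some (node_at G B s)) q M) (L(t := p')) h"
proof -
  let ?a = "node_at G B s"
  let ?M = "set_next (Some ?a) q M"
  have f: "frozen G B = Some (pp, pu)" "pp < pu" "\<not> applied G B"
    "push_slot M G t (node_at G B pp) B pp"
    using c by (auto simp: push_combining_def)
  have cl: "claim G ?a = Some (B, s)"
    using batch_ok.claim[OF push_combining_facts(3)[OF c] f(1) s(2)] .
  have comb: "combiner G B = Some t" using f by (simp add: combiner_def push_slot_def)
  have np: "?a \<notin> pub G" using cl f(3) by (simp add: pub_def)
  have [simp]: "node_alloc ?M = node_alloc M" "batch_alloc ?M = batch_alloc M"
    "batches ?M = batches M"
    "agg_batch ?M = agg_batch M" "stackTop ?M = stackTop M" "retired ?M = retired M"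
    "engaged ?M = engaged M"
    by (simp_all add: set_next_def fun_eq_iff engaged_def retired_def)
  have val: "value (nodes ?M a) = value (nodes M a)" for a by (simp add: set_next_def)
  have nd: "nodes ?M a = nodes M a" if "a \<noteq> ?a" for a using that by (simp add: set_next_def)
  have ndp: "nodes ?M a = nodes M a" if "a \<in> pub G" for a using nd np that by metis
  have ch: "gchain ?M G q as" if "gchain M G q as" for q as
    using chain_mono[OF that] ndp by blast
  have pres: "pop_res (nodes ?M) G B s = pop_res (nodes M) G B s" for B s
    by (rule pop_res_cong) (use val ndp in auto)
  show ?thesis
  proof (rule step_intro[OF lin _ th])
    have stk: "stack_ok ?M G S"
      by (rule stack_ok_frame[OF global_okD(8)[OF glob]]) (use ndp in auto)
    show "global_ok K P T agg ?M G (L(t := p')) S"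
    proof (rule global_ok_frame)
      show "batch_ok P T agg ?M G B" if "B \<in> used G" for B
        by (rule batch_ok_frame[OF used_ok[OF that]]) (use ch in auto)
    qed (use stk global_okD(7,9)[OF glob] b in auto)
    show "rely (agg u) u (L u) M G ?M G" if u: "u \<in> T" "u \<noteq> t" for u
    proof (rule rely.intro, goal_cases)
      case (3 B s i) then show ?case using pres by simp
    next
      case (7 a') show ?case by (rule conjI[OF 7 ndp[OF 7]])
    next
      case (19 B1)
      \<comment> \<open>A common node would carry both claims, making \<open>t\<close> and
        \<open>u\<close> combiners of the same batch.\<close>
      have "node_at G B1 s1 \<noteq> ?a" if "claim G (node_at G B1 s1) = Some (B1, s1)" for s1
      proof
        assume "node_at G B1 s1 = ?a"
        with that cl have "Some (B1, s1) = Some (B, s)" by metis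
        then have "combiner G B = Some u" using 19 by simp
        then show False using comb u(2) by simp
      qed
      then show ?case using nd by simp
    qed (use u val global_not_applied[OF glob] in auto)
  qed
qed

text \<open>A claim names its slot.\<close>

lemma claimed_node_inj:
  assumes "push_combining M G t B pp pu" "s < pu" "s' < pu" "node_at G B s = node_at G B s'"
  shows "s = s'"
proof -
  have f: "frozen G B = Some (pp, pu)" using assms(1) by (simp add: push_combining_def)
  note cl = batch_ok.claim[OF push_combining_facts(3)[OF assms(1)] f]
  have "Some (B, s) = Some (B, s')" using cl[OF assms(2)] cl[OF assms(3)] assms(4) by metis
  then show ?thesis by blast
qed

lemma push_combining_set_next:
  "push_combining M G t B pp pu \<Longrightarrow> push_combining (set_next q q' M) G t B pp pu"
  by (auto simp: push_combining_def push_slot_def set_next_def retired_def)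

lemma step_pts_link:
  assumes "L t = InPTS (PTSLink B bt tp i x)"
  shows "sim K P T agg (set_next x tp M) (L(t := InPTS (PTSLoop B bt x (i + 1)))) h"
proof -
  obtain pp pu where c: "push_combining M G t B pp pu" "linked M G B pp i bt tp" "i < pu"
    "x = Some (node_at G B i)" using thr[OF tT] assms by auto
  have i: "pp < i" using c(2) by (simp add: linked_def)
  have "linked (set_next x tp M) G B pp (i + 1) bt x"
    unfolding linked_def
  proof (intro conjI allI impI)
    fix j assume j: "pp < j \<and> j < i + 1"
    show "next (nodes (set_next x tp M) (node_at G B j)) = Some (node_at G B (j - 1))"
    proof (cases "j = i")
      case True
      then show ?thesis using c(2,4) by (simp add: set_next_def linked_def)
    next
      case False
      then have "node_at G B j \<noteq> node_at G B i" using claimed_node_inj[OF c(1), of j i] j c(3) by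
        auto
      then show ?thesis using c(2,4) j False by (simp add: set_next_def linked_def)
    qed
  qed (use c i in \<open>auto simp: linked_def\<close>)
  then have "thread_ok (agg t) (set_next x tp M) G t (InPTS (PTSLoop B bt x (i + 1)))"
    using push_combining_set_next[OF c(1), of x tp] c(3) Suc_leI[OF c(3)]
    unfolding thread_ok.simps pts_ok.simps Suc_eq_plus1 by blast
  then show ?thesis using set_next_step[OF c(1) less_imp_le[OF i] c(3), of tp] c(4) assms by simp
qed

lemma step_pts_set_bot:
  assumes "L t = InPTS (PTSSetBot B bt tp x)"
  shows "sim K P T agg (set_next bt x M) (L(t := InPTS (PTSCas B bt tp x))) h"
proof -
  obtain pp pu where c: "push_combining M G t B pp pu" "linked M G B pp pu bt tp"
    using thr[OF tT] assms by auto
  have pu: "pp < pu" and bt: "bt = Some (node_at G B pp)" using c(2) by (auto simp: linked_def)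
  have "linked (set_next bt x M) G B pp pu bt tp"
    unfolding linked_def
  proof (intro conjI allI impI)
    fix j assume j: "pp < j \<and> j < pu"
    then have "node_at G B j \<noteq> node_at G B pp" using claimed_node_inj[OF c(1), of j pp] by auto
    then show "next (nodes (set_next bt x M) (node_at G B j)) = Some (node_at G B (j - 1))"
      using c(2) j by (simp add: set_next_def linked_def)
  qed (use c in \<open>auto simp: linked_def\<close>)
  moreover have "next (nodes (set_next bt x M) (node_at G B pp)) = x" by (simp add: bt set_next_def)
  ultimately have "thread_ok (agg t) (set_next bt x M) G t (InPTS (PTSCas B bt tp x))"
    using push_combining_set_next[OF c(1), of bt x] unfolding thread_ok.simps pts_ok.simps by blast
  then show ?thesis using set_next_step[OF c(1) order.refl pu, of x] bt assms by simp
qed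

section \<open>Invocation, response and Peek\<close>

lemma status_step:
  fixes st :: "(stack_op, stack_res) op_status"
  defines "G' \<equiv> G\<lparr>status := (status G)(t := st)\<rparr>"
  assumes b: "batch_of (L t) = None" and l: "lin_at ((status G)(t := st)) h' S"
    and th: "thread_ok (agg t) M G' t p'"
  shows "sim K P T agg M (L(t := p')) h'"
proof -
  have [simp]: "pushes G' = pushes G" "pops G' = pops G" "owner G' = owner G" "used G' = used G"
    "freezer G' = freezer G" "frozen G' = frozen G" "applied G' = applied G" "taken G' = taken G"
    "creator G' = creator G" "claim G' = claim G" "status G' = (status G)(t := st)"
    by (simp_all add: G'_def)
  note [simp] = ghost_cong[of G' G, simplified]
  have [simp]: "retired x G' = retired x G" for x by (simp add: fun_eq_iff retired_def)
  have [simp]: "engaged M G' = engaged M G" "stack_ok M G' = stack_ok M G"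
    by (simp_all add: fun_eq_iff engaged_def stack_ok_def)
  have l': "lin_at (status G') h' S" using l by simp
  show ?thesis
  proof (rule step_intro[OF l' _ th])
    show "global_ok K P T agg M G' (L(t := p')) S"
    proof (rule global_ok_frame)
      show "batch_ok P T agg M G' B" if "B \<in> used G" for B
        by (rule batch_ok_frame[OF used_ok[OF that]]) auto
      show "batch_of p' = Some B" if "engaged M G' B t" for B
        using global_okD(9)[OF glob, of B t] that b by simp
    qed (use global_okD(7,8)[OF glob] in simp_all)
    show "rely (agg u) u (L u) M G M G'" if u: "u \<in> T" "u \<noteq> t" for u
      by (rule rely.intro) (use u global_not_applied[OF glob] in auto)
  qed
qed

lemma step_peek_read_top:
  assumes "L t = InPeek PeekReadTop"
  shows "sim K P T agg M (L(t := if stackTop M = None then Returning REmpty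
        else InPeek (PeekReadValue (stackTop M)))) h"
proof -
  obtain i where i: "status G t = Pending i Peek" using thr[OF tT] assms by auto
  obtain as where as: "gchain M G (stackTop M) as" "S = map (\<lambda>a. value (nodes M a)) as"
    using global_okD(8)[OF glob] by (auto simp: stack_ok_def)
  have "fst (stack_apply Peek S) = S" by (cases S) auto
  then have l: "lin_at ((status G)(t := Done i Peek (snd (stack_apply Peek S)))) h S"
    using lin_at_linearize[OF lin i refl] by simp
  show ?thesis
    by (rule status_step[OF _ l]) (use assms as pub_alloc in \<open>cases as; auto\<close>)+
qed

lemma step_invoke:
  assumes "L t = Idle"
  shows "sim K P T agg M (L(t := start oper)) (h @ [Inv t oper])"
proof -
  have n: "status G t = NoOp" using thr[OF tT] assms by simp
  obtain ls where ls: "lin_exec (status G) h ls" "stack_legal_from [] (map snd ls)"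
    "state_after [] (map snd ls) = S" using lin by (auto simp: lin_at_def)
  have l: "lin_at ((status G)(t := Pending (length h) oper)) (h @ [Inv t oper]) S"
    unfolding lin_at_def using lin_exec.invoke[OF ls(1) n] ls(2,3) by blast
  show ?thesis
    by (rule status_step[OF _ l]) (use assms in \<open>cases oper; auto\<close>)+
qed

lemma step_return:
  assumes "L t = Returning r"
  shows "sim K P T agg M (L(t := Idle)) (h @ [Res t r])"
proof -
  obtain i oper where n: "status G t = Done i oper r" using thr[OF tT] assms by auto
  obtain ls where ls: "lin_exec (status G) h ls" "stack_legal_from [] (map snd ls)"
    "state_after [] (map snd ls) = S" using lin by (auto simp: lin_at_def)
  have l: "lin_at ((status G)(t := NoOp)) (h @ [Res t r]) S"
    unfolding lin_at_def using lin_exec.return[OF ls(1) n] ls(2,3) by blast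
  show ?thesis
    by (rule status_step[OF _ l]) (use assms in auto)
qed

end

section \<open>Linearizing several operations at once\<close>

lemma thread_ok_slot:
  assumes "thread_ok A M G t p" "batch_of p = Some B"
  shows "(\<exists>a s. push_slot M G t a B s) \<or> (\<exists>s. pop_slot M G t B s)"
proof (cases p)
  case (InFreeze q)
  then obtain r s where "frz_slot A M G t r B s"
    using assms by (cases q) (auto simp: freezing_def)
  then show ?thesis by (cases r) (auto simp: announcing_def)
next
  case (InPush q)
  then show ?thesis using assms by (cases q) (auto simp: announcing_def)
next
  case (InPTS q)
  then show ?thesis using assms by (cases q) (auto simp: push_combining_def)
next
  case (InPop q)
  then show ?thesis using assms by (cases q) auto
next
  case (InPFS q)
  then show ?thesis using assms by (cases q) (auto simp: pop_combining_def)
next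
  case (InGV q)
  then show ?thesis using assms by (cases q) auto
next
  case (InPeek q)
  then show ?thesis using assms by (cases q) auto
qed (use assms in auto)

text \<open>The threads have to be distinct because linearizing one operation must leave the others
  pending. The final status function is described pointwise, as callers need it both inside and
  outside the list.\<close>

lemma lin_at_linearize_list:
  assumes "lin_at st h S" "distinct (map u ss)"
    "\<And>s. s \<in> set ss \<Longrightarrow> \<exists>i. st (u s) = Pending i (f s)"
    "stack_legal_from S (map (\<lambda>s. (f s, r s)) ss)"
  obtains st' where "lin_at st' h (state_after S (map (\<lambda>s. (f s, r s)) ss))"
    and "\<And>s i. s \<in> set ss \<Longrightarrow> st (u s) = Pending i (f s) \<Longrightarrow> st' (u s) = Done i (f s) (r s)"
    and "\<And>t. t \<notin> u ` set ss \<Longrightarrow> st' t = st t"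
  using assms
proof (induction ss arbitrary: st S thesis)
  case Nil
  show ?case by (rule Nil.prems(1)[of st]) (use Nil.prems(2) in simp_all)
next
  case (Cons s ss)
  obtain i where i: "st (u s) = Pending i (f s)" using Cons.prems(4)[of s] by auto
  let ?st = "st(u s := Done i (f s) (r s))" and ?S = "fst (stack_apply (f s) S)"
  have nt: "u s \<notin> u ` set ss" and d: "distinct (map u ss)" using Cons.prems(3) by auto
  have l: "lin_at ?st h ?S" using lin_at_linearize[OF Cons.prems(2) i] Cons.prems(5) by simp
  have p: "\<exists>i. ?st (u s') = Pending i (f s')" if "s' \<in> set ss" for s'
  proof -
    have "u s' \<noteq> u s" using nt that by (metis image_eqI)
    then show ?thesis using Cons.prems(4)[of s'] that by simp
  qed
  have g: "stack_legal_from ?S (map (\<lambda>s. (f s, r s)) ss)" using Cons.prems(5) by simp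
  obtain st' where st': "lin_at st' h (state_after ?S (map (\<lambda>s. (f s, r s)) ss))"
    "\<And>s' i. s' \<in> set ss \<Longrightarrow> ?st (u s') = Pending i (f s') \<Longrightarrow> st' (u s') = Done i (f s') (r s')"
    "\<And>t. t \<notin> u ` set ss \<Longrightarrow> st' t = ?st t"
  proof (rule Cons.IH[OF _ l d p g], goal_cases)
    case (1 st')
    show ?case by (rule that[OF 1(2) 1(3) 1(4)])
  qed
  show ?case
  proof (rule Cons.prems(1)[of st'])
    show "lin_at st' h (state_after S (map (\<lambda>s. (f s, r s)) (s # ss)))" using st'(1) by simp
    show "st' (u s') = Done j (f s') (r s')"
      if "s' \<in> set (s # ss)" "st (u s') = Pending j (f s')" for s' j
    proof (cases "s' \<in> set ss")
      case True
      then have "u s' \<noteq> u s" using nt by (metis image_eqI)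
      then show ?thesis using st'(2)[OF True] that(2) by simp
    next
      case False
      then have "s' = s" using that(1) by simp
      then show ?thesis using st'(3)[OF nt] i that(2) by simp
    qed
    show "st' t = st t" if "t \<notin> u ` set (s # ss)" for t
      using st'(3)[of t] that by simp
  qed
qed

lemma pushes_legal:
  "stack_legal_from S (map (\<lambda>s. (Push (v s), RTrue)) ss) \<and>
   state_after S (map (\<lambda>s. (Push (v s), RTrue)) ss) = map v (rev ss) @ S"
  by (induction ss arbitrary: S) auto

text \<open>Result number \<open>k\<close> is expressed as a walk of \<open>k\<close> links from the
  old top, which is what GetValue computes. A walk past the end corresponds to popping from an empty
  stack.\<close>

lemma chain_pops_legal:
  assumes "chain N D p as"
  shows
    "stack_legal_from (map (\<lambda>a. value (N a)) as) (map (\<lambda>k. (Pop, res_at N (follow N p k))) [0..<m]) \<and>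
    state_after (map (\<lambda>a. value (N a)) as) (map (\<lambda>k. (Pop, res_at N (follow N p k))) [0..<m]) =
      map (\<lambda>a. value (N a)) (drop m as)"
proof (induction m)
  case 0 then show ?case by simp
next
  case (Suc m)
  have "stack_apply Pop (map (\<lambda>a. value (N a)) (drop m as)) =
      (map (\<lambda>a. value (N a)) (drop (Suc m) as), res_at N (follow N p m))"
  proof (cases "m < length as")
    case True
    then have "drop m as = as ! m # drop (Suc m) as" by (simp add: Cons_nth_drop_Suc)
    then show ?thesis using chain_follow[OF assms, of m] True by (simp add: res_at_def)
  next
    case False
    then show ?thesis using chain_follow[OF assms, of m] by (simp add: res_at_def)
  qed
  then show ?case using Suc by (simp add: stack_legal_from_append)
qed

lemma pairs_legal:
  "stack_legal_from S (concat (map (\<lambda>s. [(Push (v s), RTrue), (Pop, RVal (v s))]) ss)) \<and>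
   state_after S (concat (map (\<lambda>s. [(Push (v s), RTrue), (Pop, RVal (v s))]) ss)) = S"
  by (induction ss) auto

text \<open>Eliminated operations are linearized alternately, while \<open>batch_ok\<close> lists
  the pushers before the poppers.\<close>

lemma distinct_interleave:
  assumes "distinct (xs @ ys)" "n \<le> length xs" "n \<le> length ys"
  shows "distinct (concat (map (\<lambda>k. [xs ! k, ys ! k]) [0..<n]))"
  using assms(2,3)
proof (induction n)
  case 0 then show ?case by simp
next
  case (Suc n)
  have "xs ! n \<noteq> xs ! k" "ys ! n \<noteq> ys ! k" if "k < n" for k
    using assms(1) Suc.prems that by (auto simp: nth_eq_iff_index_eq)
  moreover have "xs ! k \<noteq> ys ! l" if "k \<le> n" "l \<le> n" for k l
  proof
    assume "xs ! k = ys ! l"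
    moreover have "xs ! k \<in> set xs" "ys ! l \<in> set ys" using that Suc.prems by auto
    ultimately show False using assms(1) by auto
  qed
  ultimately show ?case using Suc by (auto, (metis less_imp_le order.refl)+)
qed

section \<open>Steps that complete operations of other threads\<close>

context sec_state
begin

text \<open>Lets a helper learn that an operation is pending. The occupant's own assertion provides
  some slot in the batch it is in, and uniqueness of slots identifies it with the given one.\<close>

lemma slot_status:
  assumes "batch_of (L u) = Some B" "u \<in> T"
  shows "s < length (pushes G B) \<Longrightarrow> fst (pushes G B ! s) = u \<Longrightarrow> push_slot M G u (node_at G B s) B s"
    and "s < length (pops G B) \<Longrightarrow> pops G B ! s = u \<Longrightarrow> pop_slot M G u B s"
proof -
  from thread_ok_slot[OF thr[OF assms(2)] assms(1)]
  consider a s' where "push_slot M G u a B s'" | s' where "pop_slot M G u B s'" by blast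
  note c = this
  { assume s: "s < length (pushes G B)" "fst (pushes G B ! s) = u"
    note ok = used_ok[OF global_used(1)[OF glob s(1)]]
    from c show "push_slot M G u (node_at G B s) B s"
    proof cases
      case 1
      note sf = slot_facts[OF 1]
      have "s = s'" using push_slot_inj[OF ok s(1) sf(6)] s(2) sf(7) by simp
      then show ?thesis using 1 sf(3) by simp
    next
      case 2
      then show ?thesis using push_pop_disjoint[OF ok s(1), of s'] s(2) by (auto simp: pop_slot_def)
    qed }
  { assume s: "s < length (pops G B)" "pops G B ! s = u"
    note ok = used_ok[OF global_used(2)[OF glob s(1)]]
    from c show "pop_slot M G u B s"
    proof cases
      case 1
      note sf = slot_facts[OF 1]
      then show ?thesis using push_pop_disjoint[OF ok sf(6) s(1)] s(2) by simp
    next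
      case 2
      then have "s = s'" using pop_slot_inj[OF ok s(1), of s'] s(2) by (simp add: pop_slot_def)
      then show ?thesis using 2 by simp
    qed }
qed

text \<open>A single write publishes the nodes of the slots from \<open>pp\<close> to
  \<open>pu - 1\<close>. The pushes take effect in the order of their slots, which agrees with the
  links: each node points to the one in the slot below, and the first to the old top.\<close>

lemma step_pts_cas_success:
  assumes Lt: "L t = InPTS (PTSCas B bt tp x)" and top: "stackTop M = x"
  shows "sim K P T agg (M\<lparr>stackTop := tp\<rparr>) (L(t := InPush (PushSetApplied B))) h"
    (is "sim _ _ _ _ ?M _ _")
proof -
  obtain pp pu where c: "push_combining M G t B pp pu" "linked M G B pp pu bt tp"
    "next (nodes M (node_at G B pp)) = x"
    using thr[OF tT] Lt by auto
  have f: "frozen G B = Some (pp, pu)" "pp < pu" "retired M G B" "\<not> applied G B"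
    "push_slot M G t (node_at G B pp) B pp" using c(1) by (auto simp: push_combining_def)
  note bf = batch_frozen[OF f(1)] and pf = push_combining_facts[OF c(1)]
  note ok = pf(3)
  have comb: "combiner G B = Some t" using f by (simp add: combiner_def push_slot_def)
  obtain as where as: "gchain M G x as" "S = map (\<lambda>a. value (nodes M a)) as"
    using global_okD(8)[OF glob] top by (auto simp: stack_ok_def)
  let ?u = "\<lambda>s. fst (pushes G B ! s)" and ?v = "\<lambda>s. value (nodes M (node_at G B s))"
  have act: "batch_of (L (?u s)) = Some B" "?u s \<in> T" if "pp \<le> s" "s < pu" for s
  proof -
    have "engaged M G B (?u s)" using f(1,4) that by (auto simp: engaged_def)
    then show "batch_of (L (?u s)) = Some B" using global_okD(9)[OF glob] by blast
    have "?u s \<in> members G B" using bf(3) that by (auto simp: members_def)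
    then show "?u s \<in> T" using batch_ok.members[OF ok] by blast
  qed
  have pend: "\<exists>i. status G (?u s) = Pending i (Push (?v s))" if "pp \<le> s" "s < pu" for s
    using slot_status(1)[OF act[OF that], of s] that bf(3) f(1,4)
    by (auto simp: push_slot_def push_res_def)
  have dist: "distinct (map ?u [pp..<pu])"
    using push_slot_inj[OF ok] bf(3) by (auto simp: distinct_map inj_on_def)
  note legal = pushes_legal[of S ?v "[pp..<pu]"]
  obtain st' where l: "lin_at st' h (map ?v (rev [pp..<pu]) @ S)"
    and st_in: "\<And>s i. pp \<le> s \<Longrightarrow> s < pu \<Longrightarrow> status G (?u s) = Pending i (Push (?v s)) \<Longrightarrow>
      st' (?u s) = Done i (Push (?v s)) RTrue"
    and st_out: "\<And>u. u \<notin> ?u ` {pp..<pu} \<Longrightarrow> st' u = status G u"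
    by (rule lin_at_linearize_list[OF lin dist, of "\<lambda>s. Push (?v s)" "\<lambda>_. RTrue"])
      (use legal pend in auto)
  define G' where "G' = G\<lparr>applied := (applied G)(B := True), status := st'\<rparr>"
  have [simp]: "pushes G' = pushes G" "pops G' = pops G" "owner G' = owner G" "used G' = used G"
    "freezer G' = freezer G" "frozen G' = frozen G" "taken G' = taken G"
    "creator G' = creator G" "claim G' = claim G" "status G' = st'"
    "applied G' = (applied G)(B := True)"
    by (simp_all add: G'_def)
  have [simp]: "claims_ok G' = claims_ok G" "node_at G' = node_at G" "combiner G' = combiner G"
    "members G' = members G" "retired ?M G' = retired M G"
    by (simp_all add: fun_eq_iff claims_ok_def node_at_def combiner_def members_def retired_def
        split: option.split)
  have cl: "claim G (node_at G B s) = Some (B, s)" if "s < pu" for s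
    using batch_ok.claim[OF ok f(1) that] .
  have pub_sub: "pub G \<subseteq> pub G'"
  proof
    fix a assume "a \<in> pub G"
    then obtain B1 s pp1 pu1 where "claim G a = Some (B1, s)" "frozen G B1 = Some (pp1, pu1)"
      "pp1 \<le> s"
      "applied G B1" by (auto simp: pub_def)
    then have "claim G' a = Some (B1, s) \<and> frozen G' B1 = Some (pp1, pu1) \<and> pp1 \<le> s \<and> applied G' B1"
      by simp
    then show "a \<in> pub G'" unfolding pub_def by blast
  qed
  have pub_new: "node_at G B s \<in> pub G'" if "pp \<le> s" "s < pu" for s
    using cl[OF that(2)] that f(1) by (auto simp: pub_def)
  have pub_cases: "a \<in> pub G \<or> (\<exists>s. pp \<le> s \<and> s < pu \<and> a = node_at G B s)" if a': "a \<in> pub G'" for a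
  proof -
    have "\<exists>B1 s pp1 pu1. claim G a = Some (B1, s) \<and> frozen G B1 = Some (pp1, pu1) \<and> pp1 \<le> s \<and>
        applied G' B1" using a' unfolding pub_def by simp
    then obtain B1 s pp1 pu1 where a: "claim G a = Some (B1, s)" "frozen G B1 = Some (pp1, pu1)"
      "pp1 \<le> s"
      "applied G' B1" by blast
    show ?thesis
    proof (cases "B1 = B")
      case True
      then show ?thesis using a f(1) global_okD(7)[OF glob] unfolding claims_ok_def by fastforce
    next
      case False
      then show ?thesis using a by (auto simp: pub_def)
    qed
  qed
  have ch: "gchain ?M G' q as" if "gchain M G q as" for q as
    using chain_mono[OF that, of "pub G'" "nodes M"] pub_sub by auto
  \<comment> \<open>Stated for every prefix, because each new node, and not only the new top, has to
    start a published list.\<close>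
  have pre: "gchain ?M G' (Some (node_at G B (k - 1))) (map (node_at G B) (rev [pp..<k]) @ as)"
    if "pp < k" "k \<le> pu" for k
    using that
  proof (induction k)
    case (Suc k)
    show ?case
    proof (cases "pp < k")
      case True
      then have "next (nodes M (node_at G B k)) = Some (node_at G B (k - 1))"
        using c(2) Suc.prems by (simp add: linked_def)
      then show ?thesis using Suc True pub_new[of k] by simp
    next
      case False
      then have "k = pp" using Suc.prems by simp
      then show ?thesis using ch[OF as(1)] c(3) pub_new[of pp] f(2) by simp
    qed
  qed simp
  have tp: "tp = Some (node_at G B (pu - 1))" using c(2) by (simp add: linked_def)
  have stk: "stack_ok ?M G' (map ?v (rev [pp..<pu]) @ S)"
    unfolding stack_ok_def
  proof (intro conjI ballI)
    show "\<exists>as. gchain ?M G' (stackTop ?M) as \<and>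
        map ?v (rev [pp..<pu]) @ S = map (\<lambda>a. value (nodes ?M a)) as"
      using pre[OF f(2) order.refl] tp as(2) by (intro exI conjI) (auto simp: comp_def)
    fix a assume "a \<in> pub G'"
    from pub_cases[OF this] show "\<exists>as. gchain ?M G' (Some a) as"
    proof
      assume "a \<in> pub G"
      then show ?thesis using global_okD(8)[OF glob] ch unfolding stack_ok_def by blast
    next
      assume "\<exists>s. pp \<le> s \<and> s < pu \<and> a = node_at G B s"
      then obtain s where "pp \<le> s" "s < pu" "a = node_at G B s" by blast
      then have "gchain ?M G' (Some a) (map (node_at G B) (rev [pp..<Suc s]) @ as)"
        using pre[of "Suc s"] by (simp del: upt_Suc)
      then show ?thesis by blast
    qed
  qed
  have eng: "engaged M G B1 u" if "engaged ?M G' B1 u" for B1 u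
    using that by (auto simp: engaged_def split: if_splits)
  have out: "st' u = status G u" if "batch_of (L u) \<noteq> Some B" for u
    using st_out[of u] act(1) that by fastforce
  have pr: "push_res G' B1 = push_res G B1" "pop_res N G' B1 = pop_res N G B1" if "B1 \<noteq> B" for B1 N
    using that by (auto simp: fun_eq_iff push_res_def pop_res_def split: option.split)
  \<comment> \<open>In the combined range both the status and \<open>push_res\<close> turn to
    \<open>RTrue\<close>; everywhere else both stay as they were.\<close>
  have ps: "st' u = stat i (Push (value (nodes M a))) (push_res G' B1 s)"
    if "batch_of (L u) = Some B1" "s < length (pushes G B1)" "pushes G B1 ! s = (u, a)"
      "status G u = stat i (Push (value (nodes M a))) (push_res G B1 s)" for u B1 s a i
  proof (cases "B1 = B \<and> pp \<le> s \<and> s < pu")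
    case True
    then have "a = node_at G B s" "u = ?u s" using that(3) by (simp_all add: node_at_def)
    then show ?thesis using st_in[of s i] True that(4) f(1,4) by (simp add: push_res_def)
  next
    case False
    have "u \<notin> ?u ` {pp..<pu}"
    proof
      assume "u \<in> ?u ` {pp..<pu}"
      then obtain s' where s': "u = ?u s'" "pp \<le> s'" "s' < pu" by auto
      then have "B1 = B" using act(1)[of s'] that(1) by simp
      then have "s = s'" using push_slot_inj[OF ok, of s s'] that(2,3) s' bf(3) by simp
      then show False using False s' \<open>B1 = B\<close> by simp
    qed
    then have "st' u = status G u" by (rule st_out)
    moreover have "push_res G' B1 s = push_res G B1 s"
      using False pr(1)[of B1] f(1) by (cases "B1 = B") (auto simp: push_res_def)
    ultimately show ?thesis using that(4) by simp
  qed
  \<comment> \<open>Since \<open>pp < pu\<close>, every served pop of \<open>B\<close> was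
    eliminated, so applying \<open>B\<close> alters no pop result.\<close>
  have qs: "st' u = stat i Pop (pop_res N G' B1 s)"
    if "batch_of (L u) = Some B1" "s < length (pops G B1)" "pops G B1 ! s = u"
      "status G u = stat i Pop (pop_res N G B1 s)" for u B1 s i N
  proof -
    have "u \<notin> ?u ` {pp..<pu}"
    proof
      assume "u \<in> ?u ` {pp..<pu}"
      then obtain s' where s': "u = ?u s'" "pp \<le> s'" "s' < pu" by auto
      then have "B1 = B" using act(1)[of s'] that(1) by simp
      then show False using push_pop_disjoint[OF ok, of s' s] that(2,3) s' bf(3) by simp
    qed
    then have "st' u = status G u" by (rule st_out)
    moreover have "pop_res N G' B1 s = pop_res N G B1 s"
      using pr(2)[of B1] f(1,2) by (cases "B1 = B") (auto simp: pop_res_def)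
    ultimately show ?thesis using that(4) by simp
  qed
  show ?thesis
  proof (rule step_intro[of G'])
    show "lin_at (status G') h (map ?v (rev [pp..<pu]) @ S)" using l by simp
    show "global_ok K P T agg ?M G' (L(t := InPush (PushSetApplied B))) (map ?v (rev [pp..<pu]) @ S)"
    proof (rule global_ok_frame)
      show "batch_ok P T agg ?M G' B1" if "B1 \<in> used G" for B1
      proof (cases "B1 = B")
        case True
        have "\<not> isBatchApplied (batches M B)" using batch_ok.applied[OF ok] f(4) by blast
        then show ?thesis unfolding True
          by (intro batch_ok.intro) (use batch_okD[OF ok] f(1,2) in simp_all)
      next
        case False
        then show ?thesis using ch by (intro batch_ok_frame[OF used_ok[OF that]]) auto
      qed
      show "batch_of (InPush (PushSetApplied B)) = Some B1" if "engaged ?M G' B1 t" for B1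
        using engaged_batch[OF eng[OF that]] Lt by simp
    qed (use stk eng global_okD(7)[OF glob] bf(1) in auto)
    have "push_slot ?M G' t (node_at G B pp) B pp"
      using f(5) ps[of t B pp "node_at G B pp"] Lt by (auto simp: push_slot_def)
    then show "thread_ok (agg t) ?M G' t (InPush (PushSetApplied B))"
      using f(1-3) by auto
    show "rely (agg u) u (L u) M G ?M G'" if u: "u \<in> T" "u \<noteq> t" for u
    proof (rule rely.intro, goal_cases)
      case 1 then show ?case using out[of u] by simp
    next
      case (2 B1 s a i) then show ?case using ps by simp
    next
      case (3 B1 s i) then show ?case using qs by simp
    next
      case (7 a) then show ?case using pub_sub by auto
    next
      case (15 B1) then show ?case using global_not_applied[OF glob] f(1) by auto
    next
      case (19 B1) then show ?case using comb u(2) by auto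
    next
      case (23 B1) then show ?case by simp
    qed (use u in auto)
  qed
qed

lemma step_pfs_cas_success:
  assumes Lt: "L t = InPFS (PFSCas B s m tp bt)" and top: "stackTop M = tp"
  shows "sim K P T agg (M\<lparr>stackTop := bt\<rparr>) (L(t := InPFS (PFSStore B s tp))) h"
    (is "sim _ _ _ _ ?M _ _")
proof -
  obtain pp where c: "pop_combining M G t B pp s" "m = pp - s" "bt = follow (nodes M) tp m"
    using thr[OF tT] Lt by auto
  have f: "frozen G B = Some (pp, s)" "s < pp" "retired M G B" "\<not> applied G B"
    "pop_slot M G t B s" using c(1) by (auto simp: pop_combining_def)
  note bf = batch_frozen[OF f(1)]
  note ok = used_ok[OF bf(1)]
  have comb: "combiner G B = Some t" using f by (simp add: combiner_def pop_slot_def)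
  obtain as where as: "gchain M G tp as" "S = map (\<lambda>a. value (nodes M a)) as"
    using global_okD(8)[OF glob] top by (auto simp: stack_ok_def)
  let ?u = "\<lambda>k. pops G B ! (s + k)" and ?r = "\<lambda>k. res_at (nodes M) (follow (nodes M) tp k)"
  let ?S = "map (\<lambda>a. value (nodes M a)) (drop m as)"
  have act: "batch_of (L (?u k)) = Some B" "?u k \<in> T" if "k < m" for k
  proof -
    have k: "s \<le> s + k" "s + k < pp" using that c(2) by auto
    then have "engaged M G B (?u k)" using f(1,4) unfolding engaged_def by blast
    then show "batch_of (L (?u k)) = Some B" using global_okD(9)[OF glob] by blast
    have "?u k \<in> members G B" using bf(2) k by (auto simp: members_def)
    then show "?u k \<in> T" using batch_ok.members[OF ok] by blast
  qed
  have pend: "\<exists>i. status G (?u k) = Pending i Pop" if "k < m" for k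
  proof -
    have k: "s + k < pp" "s + k < length (pops G B)" using that c(2) bf(2) by auto
    from slot_status(2)[OF act[OF that] k(2) refl] show ?thesis
      using f(1,4) k(1) by (auto simp: pop_slot_def pop_res_def)
  qed
  have dist: "distinct (map ?u [0..<m])"
  proof -
    have "k = k'" if "k < m" "k' < m" "?u k = ?u k'" for k k'
      using pop_slot_inj[OF ok, of "s + k" "s + k'"] that bf(2) c(2) by simp
    then show ?thesis by (auto simp: distinct_map inj_on_def)
  qed
  note legal = chain_pops_legal[OF as(1), of m]
  obtain st' where l: "lin_at st' h ?S"
    and st_in: "\<And>k i. k < m \<Longrightarrow> status G (?u k) = Pending i Pop \<Longrightarrow> st' (?u k) = Done i Pop (?r k)"
    and st_out: "\<And>u. u \<notin> ?u ` {..<m} \<Longrightarrow> st' u = status G u"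
    by (rule lin_at_linearize_list[OF lin dist, of "\<lambda>_. Pop" ?r])
      (use legal pend as(2) in \<open>auto simp: atLeast0LessThan\<close>)
  define G' where
    "G' = G\<lparr>applied := (applied G)(B := True), taken := (taken G)(B := tp), status := st'\<rparr>"
  have [simp]: "pushes G' = pushes G" "pops G' = pops G" "owner G' = owner G" "used G' = used G"
    "freezer G' = freezer G" "frozen G' = frozen G" "taken G' = (taken G)(B := tp)"
    "creator G' = creator G" "claim G' = claim G" "status G' = st'"
    "applied G' = (applied G)(B := True)"
    by (simp_all add: G'_def)
  have [simp]: "claims_ok G' = claims_ok G" "node_at G' = node_at G" "combiner G' = combiner G"
    "members G' = members G" "retired ?M G' = retired M G"
    by (simp_all add: fun_eq_iff claims_ok_def node_at_def combiner_def members_def retired_def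
        split: option.split)
  \<comment> \<open>Nothing is published here: claimed slots of \<open>B\<close> lie below
    \<open>s\<close>, while publication starts at \<open>pp\<close> and
    \<open>s < pp\<close>.\<close>
  have pub: "pub G' = pub G"
  proof -
    have "claim G a = Some (B1, s1) \<and> frozen G B1 = Some (pp1, pu1) \<and> pp1 \<le> s1 \<and> applied G' B1 \<longleftrightarrow>
        claim G a = Some (B1, s1) \<and> frozen G B1 = Some (pp1, pu1) \<and> pp1 \<le> s1 \<and> applied G B1"
      for a B1 s1 pp1 pu1
    proof (cases "B1 = B")
      case True
      have "\<not> pp \<le> s1" if "claim G a = Some (B, s1)"
        using global_okD(7)[OF glob] that f(1,2) unfolding claims_ok_def by fastforce
      then show ?thesis using True f(1) by auto
    qed simp
    then show ?thesis unfolding pub_def by simp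
  qed
  have stk: "stack_ok ?M G' ?S"
  proof -
    have "gchain M G bt (drop m as)" unfolding c(3) using chain_follow_chain[OF as(1)] .
    then show ?thesis using global_okD(8)[OF glob] by (auto simp: stack_ok_def pub)
  qed
  have eng: "engaged M G B1 u" if "engaged ?M G' B1 u" for B1 u
    using that by (auto simp: engaged_def split: if_splits)
  have out: "st' u = status G u" if "batch_of (L u) \<noteq> Some B" for u
    using st_out[of u] act(1) that by fastforce
  have pr: "push_res G' B1 = push_res G B1" "pop_res N G' B1 = pop_res N G B1" if "B1 \<noteq> B" for B1 N
    using that by (auto simp: fun_eq_iff push_res_def pop_res_def split: option.split)
  have ps: "st' u = stat i (Push (value (nodes M a))) (push_res G' B1 s1)"
    if "batch_of (L u) = Some B1" "s1 < length (pushes G B1)" "pushes G B1 ! s1 = (u, a)"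
      "status G u = stat i (Push (value (nodes M a))) (push_res G B1 s1)" for u B1 s1 a i
  proof -
    have "u \<notin> ?u ` {..<m}"
    proof
      assume "u \<in> ?u ` {..<m}"
      then obtain k where k: "u = ?u k" "k < m" by auto
      then have "B1 = B" using act(1)[of k] that(1) by simp
      moreover have "s + k < length (pops G B)" using k(2) bf(2) c(2) by simp
      ultimately show False using push_pop_disjoint[OF ok, of s1 "s + k"] that(2,3) k by simp
    qed
    then have "st' u = status G u" by (rule st_out)
    moreover have "push_res G' B1 s1 = push_res G B1 s1"
      using pr(1)[of B1] f(1,2) by (cases "B1 = B") (auto simp: push_res_def)
    ultimately show ?thesis using that(4) by simp
  qed
  have qs: "st' u = stat i Pop (pop_res (nodes M) G' B1 s1)"
    if "batch_of (L u) = Some B1" "s1 < length (pops G B1)" "pops G B1 ! s1 = u"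
      "status G u = stat i Pop (pop_res (nodes M) G B1 s1)" for u B1 s1 i
  proof (cases "B1 = B \<and> s \<le> s1 \<and> s1 < pp")
    case True
    then have k: "s1 - s < m" "u = ?u (s1 - s)" using that(3) c(2) by auto
    have "status G u = Pending i Pop" using that(4) True f(1,4) by (simp add: pop_res_def)
    then have "st' u = Done i Pop (?r (s1 - s))" using st_in[OF k(1)] k(2) by simp
    then show ?thesis using True f(1) by (simp add: pop_res_def)
  next
    case False
    have "u \<notin> ?u ` {..<m}"
    proof
      assume "u \<in> ?u ` {..<m}"
      then obtain k where k: "u = ?u k" "k < m" by auto
      then have "B1 = B" using act(1)[of k] that(1) by simp
      moreover have "s + k < length (pops G B)" "s + k < pp" using k(2) bf(2) c(2) by simp_all
      ultimately have "s1 = s + k" using pop_slot_inj[OF ok, of s1 "s + k"] that(2,3) k by simp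
      then show False using False \<open>s + k < pp\<close> \<open>B1 = B\<close> by simp
    qed
    then have "st' u = status G u" by (rule st_out)
    moreover have "pop_res (nodes M) G' B1 s1 = pop_res (nodes M) G B1 s1"
      using False pr(2)[of B1] f(1) by (cases "B1 = B") (auto simp: pop_res_def)
    ultimately show ?thesis using that(4) by simp
  qed
  \<comment> \<open>\<open>subStackTop\<close> has not been written yet; its clause in
    \<open>batch_ok\<close> is guarded by this flag.\<close>
  have nba: "\<not> isBatchApplied (batches M B)" using batch_ok.applied[OF ok] f(4) by blast
  show ?thesis
  proof (rule step_intro[of G'])
    show "lin_at (status G') h ?S" using l by simp
    show "global_ok K P T agg ?M G' (L(t := InPFS (PFSStore B s tp))) ?S"
    proof (rule global_ok_frame)
      show "batch_ok P T agg ?M G' B1" if "B1 \<in> used G" for B1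
      proof (cases "B1 = B")
        case True
        show ?thesis unfolding True
        proof (rule batch_ok.intro, goal_cases)
          case 17 then show ?case using as(1) pub by auto
        qed (use batch_okD[OF ok] f(1,2) nba in simp_all)
      next
        case False
        then show ?thesis using pub by (intro batch_ok_frame[OF used_ok[OF that]]) auto
      qed
      show "batch_of (InPFS (PFSStore B s tp)) = Some B1" if "engaged ?M G' B1 t" for B1
        using engaged_batch[OF eng[OF that]] Lt by simp
    qed (use stk eng global_okD(7)[OF glob] bf(1) in auto)
    have "pop_slot ?M G' t B s"
      using f(5) qs[of t B s] Lt by (auto simp: pop_slot_def)
    then show "thread_ok (agg t) ?M G' t (InPFS (PFSStore B s tp))"
      using f(1-3) nba by auto
    show "rely (agg u) u (L u) M G ?M G'" if u: "u \<in> T" "u \<noteq> t" for u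
    proof (rule rely.intro, goal_cases)
      case 1 then show ?case using out[of u] by simp
    next
      case (2 B1 s a i) then show ?case using ps by simp
    next
      case (3 B1 s i) then show ?case using qs by simp
    next
      case (7 a) then show ?case using pub by auto
    next
      case (15 B1) then show ?case using global_not_applied[OF glob] f(1) by auto
    next
      case (18 B1) then show ?case using f(4) by auto
    next
      case (19 B1) then show ?case using comb u(2) by auto
    next
      case (23 B1) then show ?case by simp
    qed (use u in auto)
  qed
qed

text \<open>At this read both slots of each eliminated pair are occupied: \<open>pushCount\<close>
  is the exact number of pushers now, and \<open>pp\<close> was read earlier. So all pairs can take
  effect together. At the same moment every served push, eliminated or not, claims its node for this
  batch.\<close>

lemma step_frz_read_push:
  assumes Lt: "L t = InFreeze (FrzReadPush r B s)"
  shows "sim K P T agg M (L(t := InFreeze (FrzWritePush r B s (pushCount (batches M B))))) h"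
proof -
  define pp where "pp = popCountAtFreeze (batches M B)"
  define pu where "pu = length (pushes G B)"
  have f: "freezing (agg t) M G t r B s" "frozen G B = None" "pp \<le> length (pops G B)"
    using thr[OF tT] Lt by (auto simp: pp_def)
  note ff = frz_slot_facts[OF f(1)]
  note ok = used_ok[OF ff(1)]
  \<comment> \<open>The aggregator still points to \<open>B\<close>, so all members are engaged and
    hence at control points inside \<open>B\<close>.\<close>
  have nret: "\<not> retired M G B" using ff by (simp add: retired_def)
  have nap: "\<not> applied G B" using global_not_applied[OF glob f(2)] .
  have mem: "batch_of (L u) = Some B" "u \<in> T" if "u \<in> members G B" for u
    using global_okD(9)[OF glob, of B u] that nret batch_ok.members[OF ok that] by
      (auto simp: engaged_def)
  have mem1: "fst (pushes G B ! k) \<in> members G B" if "k < length (pushes G B)" for k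
    using that by (auto simp: members_def)
  have mem2: "pops G B ! k \<in> members G B" if "k < length (pops G B)" for k
    using that by (auto simp: members_def)
  have slot1: "push_slot M G (fst (pushes G B ! k)) (node_at G B k) B k" if
    "k < length (pushes G B)" for k
    using slot_status(1)[OF mem[OF mem1[OF that]] that] by simp
  have slot2: "pop_slot M G (pops G B ! k) B k" if "k < length (pops G B)" for k
    using slot_status(2)[OF mem[OF mem2[OF that]] that] by simp
  define e where "e = min pp pu"
  have e: "e \<le> length (pushes G B)" "e \<le> length (pops G B)" using f(3) by (auto simp: e_def pu_def)
  let ?v = "\<lambda>k. value (nodes M (node_at G B k))"
  \<comment> \<open>\<open>(k, True)\<close> stands for the push in slot \<open>k\<close>,
    \<open>(k, False)\<close> for the pop matched with it.\<close>
  define ss where "ss = concat (map (\<lambda>k. [(k, True), (k, False)]) [0..<e])"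
  define un where "un x = (if snd x then fst (pushes G B ! fst x) else pops G B ! fst x)" for x ::
    "nat \<times> bool"
  define fn where "fn x = (if snd x then Push (?v (fst x)) else Pop)" for x :: "nat \<times> bool"
  define rn where "rn x = (if snd x then RTrue else RVal (?v (fst x)))" for x :: "nat \<times> bool"
  have ss_set: "set ss = {..<e} \<times> UNIV" by (auto simp: ss_def)
  have pend1: "\<exists>i. status G (fst (pushes G B ! k)) = Pending i (Push (?v k))" if "k < e" for k
    using slot1[of k] that e f(2) by (auto simp: push_slot_def push_res_def)
  have pend2: "\<exists>i. status G (pops G B ! k) = Pending i Pop" if "k < e" for k
    using slot2[of k] that e f(2) by (auto simp: pop_slot_def pop_res_def)
  have "map un ss = concat (map (\<lambda>k. [map fst (pushes G B) ! k, pops G B ! k]) [0..<e])"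
    unfolding ss_def map_concat map_map using e by (intro arg_cong[of _ _ concat] map_cong)
      (auto simp: un_def)
  then have dist: "distinct (map un ss)"
    using distinct_interleave[OF batch_ok.distinct[OF ok], of e] e by simp
  have "map (\<lambda>x. (fn x, rn x)) ss = concat (map (\<lambda>k. [(Push (?v k), RTrue), (Pop, RVal (?v k))]) [0..<e])"
    unfolding ss_def map_concat map_map by (simp add: fn_def rn_def comp_def)
  then have legal: "stack_legal_from S (map (\<lambda>x. (fn x, rn x)) ss)"
    "state_after S (map (\<lambda>x. (fn x, rn x)) ss) = S"
    using pairs_legal[of S ?v "[0..<e]"] by simp_all
  have pend: "\<exists>i. status G (un x) = Pending i (fn x)" if "x \<in> set ss" for x
    using that pend1 pend2 by (auto simp: ss_set un_def fn_def)
  obtain st' where l: "lin_at st' h (state_after S (map (\<lambda>x. (fn x, rn x)) ss))"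
    and st_in:
      "\<And>x i. x \<in> set ss \<Longrightarrow> status G (un x) = Pending i (fn x) \<Longrightarrow> st' (un x) = Done i (fn x) (rn x)"
    and st_out: "\<And>u. u \<notin> un ` set ss \<Longrightarrow> st' u = status G u"
    using lin_at_linearize_list[OF lin dist pend legal(1)] by blast
  \<comment> \<open>Each node was created by the thread in its slot, and these threads are distinct.
    This makes the inverse used for \<open>cl\<close> meaningful.\<close>
  have inj: "inj_on (node_at G B) {..<pu}"
  proof (rule inj_onI)
    fix k k' assume k: "k \<in> {..<pu}" "k' \<in> {..<pu}" "node_at G B k = node_at G B k'"
    then have "fst (pushes G B ! k) = fst (pushes G B ! k')"
      using batch_ok.creator[OF ok, of k] batch_ok.creator[OF ok, of k'] by (simp add: pu_def)
    then show "k = k'" using push_slot_inj[OF ok] k by (simp add: pu_def)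
  qed
  define cl where "cl a = (if a \<in> node_at G B ` {..<pu}
    then Some (B, inv_into {..<pu} (node_at G B) a) else claim G a)" for a
  have cl_in: "cl (node_at G B k) = Some (B, k)" if "k < pu" for k
    using that inv_into_f_f[OF inj, of k] by (simp add: cl_def)
  have cl_out: "cl a = claim G a" if "a \<notin> node_at G B ` {..<pu}" for a using that by
    (simp add: cl_def)
  \<comment> \<open>Even a node already offered in an earlier batch is unclaimed;
    \<open>push_slot\<close> records this as long as \<open>B\<close> is not frozen.\<close>
  have cl_none: "claim G (node_at G B k) = None" if "k < pu" for k
    using slot1[of k] that f(2) by (simp add: push_slot_def pu_def)
  have cl_mono: "cl a = Some x" if "claim G a = Some x" for a x
    using that cl_none cl_out by (cases "a \<in> node_at G B ` {..<pu}") auto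
  have cl_cases: "claim G a = Some (B1, k) \<or> B1 = B \<and> k < pu \<and> a = node_at G B k"
    if "cl a = Some (B1, k)" for a B1 k
  proof (cases "a \<in> node_at G B ` {..<pu}")
    case True
    then obtain k' where "k' < pu" "a = node_at G B k'" by auto
    then show ?thesis using that cl_in[of k'] by simp
  next
    case False
    then show ?thesis using that cl_out by simp
  qed
  define G' where "G' = G\<lparr>frozen := (frozen G)(B := Some (pp, pu)), claim := cl, status := st'\<rparr>"
  have [simp]: "pushes G' = pushes G" "pops G' = pops G" "owner G' = owner G" "used G' = used G"
    "freezer G' = freezer G" "frozen G' = (frozen G)(B := Some (pp, pu))" "taken G' = taken G"
    "creator G' = creator G" "claim G' = cl" "status G' = st'" "applied G' = applied G"
    by (simp_all add: G'_def)
  have [simp]: "node_at G' = node_at G" "members G' = members G" "retired M G' = retired M G"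
    by (simp_all add: fun_eq_iff node_at_def members_def retired_def)
  \<comment> \<open>All new claims concern \<open>B\<close>, which is not applied, so no node
    becomes published.\<close>
  have pub: "pub G' = pub G"
  proof (intro equalityI subsetI)
    fix a assume "a \<in> pub G'"
    then have "\<exists>B1 k pp1 pu1. cl a = Some (B1, k) \<and> frozen G' B1 = Some (pp1, pu1) \<and> pp1 \<le> k \<and>
        applied G B1" unfolding pub_def by simp
    then obtain B1 k pp1 pu1 where a: "cl a = Some (B1, k)" "frozen G' B1 = Some (pp1, pu1)"
      "pp1 \<le> k"
      "applied G B1" by blast
    then have "B1 \<noteq> B" using nap by blast
    then have "claim G a = Some (B1, k)" "frozen G B1 = Some (pp1, pu1)" using cl_cases[OF a(1)]
      a(2) by auto
    then show "a \<in> pub G" using a(3,4) unfolding pub_def by blast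
  next
    fix a assume "a \<in> pub G"
    then obtain B1 k pp1 pu1 where a: "claim G a = Some (B1, k)" "frozen G B1 = Some (pp1, pu1)"
      "pp1 \<le> k"
      "applied G B1" unfolding pub_def by blast
    then have "B1 \<noteq> B" using nap by blast
    then have "cl a = Some (B1, k) \<and> frozen G' B1 = Some (pp1, pu1) \<and> pp1 \<le> k \<and> applied G B1"
      using cl_mono[OF a(1)] a by simp
    then show "a \<in> pub G'" unfolding pub_def by auto
  qed
  have eng: "engaged M G B1 u" if "engaged M G' B1 u" for B1 u
  proof (cases "B1 = B")
    case True
    have "u \<in> members G B" using that f(3) mem1 mem2 unfolding True
      by (auto simp: engaged_def pu_def)
    then show ?thesis using True nret by (simp add: engaged_def)
  next
    case False
    then show ?thesis using that by (simp add: engaged_def)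
  qed
  have pr: "push_res G' B1 = push_res G B1" "pop_res N G' B1 = pop_res N G B1" if "B1 \<noteq> B" for B1 N
    using that by (auto simp: fun_eq_iff push_res_def pop_res_def split: option.split)
  have un_mem: "un x \<in> members G B" if "x \<in> set ss" for x
    using that e mem1[of "fst x"] mem2[of "fst x"] by (auto simp: ss_set un_def)
  have out: "st' u = status G u" if "batch_of (L u) \<noteq> Some B" for u
    using st_out[of u] un_mem mem(1) that by blast
  have ps: "st' u = stat i (Push (value (nodes M a))) (push_res G' B1 s1)"
    if "batch_of (L u) = Some B1" "s1 < length (pushes G B1)" "pushes G B1 ! s1 = (u, a)"
      "status G u = stat i (Push (value (nodes M a))) (push_res G B1 s1)" for u B1 s1 a i
  proof (cases "B1 = B")
    case False
    then show ?thesis using out[of u] pr(1) that by simp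
  next
    case True
    then have a: "a = node_at G B s1" "u = fst (pushes G B ! s1)" "s1 < pu"
      "s1 < length (pushes G B)"
      using that(2,3) by (simp_all add: node_at_def pu_def)
    have p: "status G u = Pending i (Push (value (nodes M a)))"
      using that(4) True f(2) by (simp add: push_res_def)
    show ?thesis
    proof (cases "s1 < pp")
      case True
      then have "(s1, True) \<in> set ss" using a(3) by (simp add: ss_set e_def)
      from st_in[OF this, of i] have "st' u = Done i (Push (value (nodes M a))) RTrue"
        using p a by (simp add: un_def fn_def rn_def)
      then show ?thesis using True a(3) \<open>B1 = B\<close> by (simp add: push_res_def)
    next
      case False
      have "u \<notin> un ` set ss"
      proof
        assume "u \<in> un ` set ss"
        then obtain k b where k: "k < e" "u = un (k, b)" by (auto simp: ss_set)
        show False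
        proof (cases b)
          case True
          then have "s1 = k" using push_slot_inj[OF ok a(4), of k] k e a(2) by (simp add: un_def)
          then show False using k(1) False by (simp add: e_def)
        next
          case False
          then show False using push_pop_disjoint[OF ok a(4), of k] k e a(2) by (simp add: un_def)
        qed
      qed
      then show ?thesis using st_out[of u] p False nap \<open>B1 = B\<close> by (simp add: push_res_def)
    qed
  qed
  have qs: "st' u = stat i Pop (pop_res (nodes M) G' B1 s1)"
    if "batch_of (L u) = Some B1" "s1 < length (pops G B1)" "pops G B1 ! s1 = u"
      "status G u = stat i Pop (pop_res (nodes M) G B1 s1)" for u B1 s1 i
  proof (cases "B1 = B")
    case False
    then show ?thesis using out[of u] pr(2) that by simp
  next
    case True
    then have a: "u = pops G B ! s1" "s1 < length (pops G B)" using that(2,3) by simp_all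
    have p: "status G u = Pending i Pop" using that(4) True f(2) by (simp add: pop_res_def)
    show ?thesis
    proof (cases "s1 < e")
      case True
      then have "(s1, False) \<in> set ss" by (simp add: ss_set)
      from st_in[OF this, of i] have "st' u = Done i Pop (RVal (?v s1))"
        using p a by (simp add: un_def fn_def rn_def)
      then show ?thesis using True \<open>B1 = B\<close> by (simp add: pop_res_def e_def)
    next
      case False
      have "u \<notin> un ` set ss"
      proof
        assume "u \<in> un ` set ss"
        then obtain k b where k: "k < e" "u = un (k, b)" by (auto simp: ss_set)
        show False
        proof (cases b)
          case True
          then show False using push_pop_disjoint[OF ok _ a(2), of k] k e a(1) by (simp add: un_def)
        next
          case b: False
          then have "s1 = k" using pop_slot_inj[OF ok a(2), of k] k e a(1) by (simp add: un_def)
          then show False using k(1) False by simp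
        qed
      qed
      then show ?thesis using st_out[of u] p False nap \<open>B1 = B\<close> by (simp add: pop_res_def e_def)
    qed
  qed
  have pslot: "push_slot M G' u a B s1" if "push_slot M G u a B s1" "batch_of (L u) = Some B" for
    u a s1
    using that ps[of u B s1 a] unfolding push_slot_def by (auto simp: pu_def)
  have qslot: "pop_slot M G' u B s1" if "pop_slot M G u B s1" "batch_of (L u) = Some B" for u s1
    using that qs[of u B s1] unfolding pop_slot_def by auto
  show ?thesis
  proof (rule step_intro[of G'])
    show "lin_at (status G') h S" using l legal(2) by simp
    show "global_ok K P T agg M G' (L(t := InFreeze (FrzWritePush r B s (pushCount (batches M B))))) S"
    proof (rule global_ok_frame)
      show "batch_ok P T agg M G' B1" if "B1 \<in> used G" for B1
      proof (cases "B1 = B")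
        case True
        show ?thesis unfolding True
          by (rule batch_ok.intro)
            (use batch_okD[OF ok] f ff nap cl_in pub in \<open>simp_all add: pu_def\<close>)
      next
        case False
        then show ?thesis using pub cl_mono by (intro batch_ok_frame[OF used_ok[OF that]]) auto
      qed
      show "claims_ok G'"
        unfolding claims_ok_def
      proof (intro allI impI)
        fix a B1 k assume "claim G' a = Some (B1, k)"
        then have "cl a = Some (B1, k)" by simp
        from cl_cases[OF this]
        show "\<exists>pp pu. frozen G' B1 = Some (pp, pu) \<and> k < pu \<and> node_at G' B1 k = a"
        proof
          assume "claim G a = Some (B1, k)"
          then obtain pp1 pu1 where "frozen G B1 = Some (pp1, pu1)" "k < pu1" "node_at G B1 k = a"
            using global_okD(7)[OF glob] unfolding claims_ok_def by blast
          moreover have "B1 \<noteq> B" using calculation(1) f(2) by auto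
          ultimately show ?thesis by simp
        qed auto
      qed
      show "stack_ok M G' S" using global_okD(8)[OF glob] pub by (simp add: stack_ok_def)
      show "batch_of (InFreeze (FrzWritePush r B s (pushCount (batches M B)))) = Some B1"
        if "engaged M G' B1 t" for B1
        using engaged_batch[OF eng[OF that]] Lt by simp
    qed (use eng ff(1) in auto)
    have "frz_slot (agg t) M G' t r B s"
      using f(1) pslot[of t _ s] qslot[of t s] Lt nap
      by (cases r) (auto simp: freezing_def announcing_def waiting_def)
    then show "thread_ok (agg t) M G' t (InFreeze (FrzWritePush r B s (pushCount (batches M B))))"
      using ff batch_ok.pushCount[OF ok] by (simp add: freezing_def pp_def pu_def)
    show "rely (agg u) u (L u) M G M G'" if u: "u \<in> T" "u \<noteq> t" for u
    proof (rule rely.intro, goal_cases)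
      case 1 then show ?case using out[of u] by simp
    next
      case (2 B1 s a i) then show ?case using ps by simp
    next
      case (3 B1 s i) then show ?case using qs by simp
    next
      case (7 a) then show ?case using pub by auto
    next
      \<comment> \<open>If a node of \<open>u\<close> is claimed now, it sits in the slot of
        \<open>u\<close> below \<open>pu\<close>, as \<open>rely\<close> demands for a new
        claim.\<close>
      case (8 a)
      show ?case
      proof (cases "a \<in> node_at G B ` {..<pu}")
        case True
        then obtain k where k: "k < pu" "a = node_at G B k" by auto
        then have "fst (pushes G B ! k) = u"
          using batch_ok.creator[OF ok, of k] 8(3) by (simp add: pu_def)
        then have "pushes G B ! k = (u, a)" using k(2) by (cases "pushes G B ! k")
          (simp add: node_at_def)
        moreover have "batch_of (L u) = Some B"
          using mem(1)[OF mem1[of k]] k(1) \<open>fst (pushes G B ! k) = u\<close> by (simp add: pu_def)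
        ultimately show ?thesis using k(1) by (auto simp: pu_def)
      next
        case False
        then show ?thesis using cl_out 8(2) by simp
      qed
    next
      case (14 B1 x) then show ?case using f(2) by auto
    next
      case (15 B1) then show ?case using global_not_applied[OF glob] by auto
    next
      case (16 B1) then show ?case using ff(3) u(2) by auto
    next
      case (19 B1) then show ?case by simp
    next
      case (23 B1) then show ?case by simp
    qed (use u in auto)
  qed
qed

section \<open>The simulation\<close>

lemmas steps =
  step_frz_read_pop step_frz_write_pop step_frz_read_push step_frz_write_push step_frz_alloc
  step_frz_install step_push_alloc step_push_get_batch step_push_count step_push_announce
  step_push_tas step_push_spin step_push_check_frozen step_push_check_elim
  step_push_check_combiner step_push_set_applied step_push_wait_applied step_pts_init
  step_pts_loop step_pts_wait step_pts_link step_pts_read_top step_pts_set_bot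
  step_pts_cas_success step_pts_cas_failure step_pop_get_batch step_pop_count step_pop_tas
  step_pop_spin step_pop_check_frozen step_pop_check_elim step_pop_wait_elim step_pop_read_elim
  step_pop_read_value step_pop_check_combiner step_pop_set_applied step_pop_wait_applied
  step_pop_offset step_pfs_init step_pfs_read_top step_pfs_walk step_pfs_walk_done
  step_pfs_cas_success step_pfs_cas_failure step_pfs_store step_gv_init step_gv_walk
  step_gv_walk_done step_peek_read_top step_peek_read_value

lemma sim_step:
  assumes "sec_step P (agg t) M (L t) M' p'"
  shows "sim K P T agg M' (L(t := p')) h"
  using assms by cases (hypsubst, rule steps, (assumption | rule refl)+)+

end

lemma sim_init:
  fixes T :: "'t set" and agg :: "'t \<Rightarrow> nat"
  assumes "initial K P M"
  shows "sim K P T agg M (\<lambda>_. Idle) []"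
proof -
  \<comment> \<open>Aggregators and initial batches correspond one to one, so \<open>owner\<close>
    can start as the inverse of \<open>agg_batch\<close>.\<close>
  define G :: "'t ghost" where "G = \<lparr>pushes = \<lambda>_. [], pops = \<lambda>_. [],
    owner = inv_into {..<K} (agg_batch M), used = batch_alloc M, freezer = \<lambda>_. None,
    frozen = \<lambda>_. None, applied = \<lambda>_. False, taken = \<lambda>_. None, creator = \<lambda>_. undefined,
    claim = \<lambda>_. None, status = \<lambda>_. NoOp\<rparr>"
  have i: "stackTop M = None" "inj_on (agg_batch M) {..<K}" "batch_alloc M = agg_batch M ` {..<K}"
    "\<And>B. B \<in> batch_alloc M \<Longrightarrow> batches M B = fresh_batch P"
    using assms by (auto simp: initial_def)
  have [simp]: "pushes G = (\<lambda>_. [])" "pops G = (\<lambda>_. [])" "used G = batch_alloc M"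
    "freezer G = (\<lambda>_. None)" "frozen G = (\<lambda>_. None)" "applied G = (\<lambda>_. False)"
      "claim G = (\<lambda>_. None)"
    "status G = (\<lambda>_. NoOp)" "owner G = inv_into {..<K} (agg_batch M)"
    by (simp_all add: G_def)
  have [simp]: "pub G = {}" "members G B = {}" for B by (simp_all add: pub_def members_def)
  have cur: "agg_batch M (owner G B) = B" if "B \<in> batch_alloc M" for B
    using that i(3) by (simp add: f_inv_into_f)
  have "batch_ok P T agg M G B" if "B \<in> batch_alloc M" for B
    by (rule batch_ok.intro) (use i(4)[OF that] cur[OF that] in \<open>auto simp: fresh_batch_def\<close>)
  moreover have "\<not> engaged M G B u" for B u by (simp add: engaged_def)
  moreover have "stack_ok M G []" using i(1) by (auto simp: stack_ok_def intro!: exI[of _ "[]"])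
  ultimately have "global_ok K P T agg M G (\<lambda>_. Idle) []"
    using i(2,3) inv_into_f_f[OF i(2)] unfolding global_ok_def unused_ok_def claims_ok_def by auto
  moreover have "lin_at (status G) [] []" unfolding lin_at_def using lin_exec.init by
    (intro exI[of _ "[]"]) simp
  moreover have "\<forall>u \<in> T. thread_ok (agg u) M G u Idle" by simp
  ultimately show ?thesis unfolding sim_def by blast
qed

theorem theoremB8:
  fixes T :: "'t set" and agg :: "'t \<Rightarrow> nat" and K P :: nat
    and h :: "('t, stack_op, stack_res) history"
  assumes "finite T"
    and "K \<ge> 1"
    and "\<And>t. t \<in> T \<Longrightarrow> agg t < K"
    and "\<And>a. a < K \<Longrightarrow> card {t \<in> T. agg t = a} \<le> P"
    and "sec_history K P T agg h"
  shows "linearizable stack_legal h"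
proof -
  obtain M L where "sec_execution K P T agg M L h" using assms(5) by (auto simp: sec_history_def)
  then have "sim K P T agg M L h"
  proof (induction rule: sec_execution.induct)
    case (exec_init M)
    then show ?case by (rule sim_init)
  next
    case (exec_invoke M L h t oper)
    then obtain G S where "sec_state K P T agg M G L S h t"
      using assms(1,3,4) unfolding sim_def sec_state_def by blast
    then show ?case using exec_invoke.hyps(3) by (rule sec_state.step_invoke)
  next
    case (exec_step M L h t M' p')
    then obtain G S where "sec_state K P T agg M G L S h t"
      using assms(1,3,4) unfolding sim_def sec_state_def by blast
    then show ?case using exec_step.hyps(3) by (rule sec_state.sim_step)
  next
    case (exec_return M L h t r)
    then obtain G S where "sec_state K P T agg M G L S h t"
      using assms(1,3,4) unfolding sim_def sec_state_def by blast
    then show ?case using exec_return.hyps(3) by (rule sec_state.step_return)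
  qed
  \<comment> \<open>The invariants have served their purpose; only the recorded list and its
    legality from the empty stack are kept.\<close>
  then obtain st S lin where "lin_exec st h lin" "stack_legal (map snd lin)"
    unfolding sim_def lin_at_def stack_legal_def by blast
  then show ?thesis by (rule lin_exec_linearizable)
qed

end
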